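(* Let $(G,V)$ be an orthogonal representation of a compact Lie group $G$ on a Euclidean space $V$, let $q\in V$, and let $k$ be a nonnegative integer. If $\mathrm{copol}(G,V)\leq k$, then the slice representation at $q$ satisfies $\mathrm{copol}(G_q,\nu_q(Gq))\leq k$.
   Context: An orthogonal representation $(G,V)$ is a linear isometric action of a compact Lie group $G$ on a finite-dimensional Euclidean space $V$. $G_q$ is the isotropy group of $q$ and $\nu_q(Gq)$ is the normal space at $q$ to the orbit $Gq$; the slice representation at $q$ is the orthogonal representation of $G_q$ on $\nu_q(Gq)$ via the differential. A point is called $G$-regular if it lies on a principal orbit. For a nonnegative integer $k$, a $k$-section of $(G,V)$ is a connected, complete submanifold $\Sigma$ of $V$ such that: (C1) $\Sigma$ is totally geodesic in $V$; (C2) $\Sigma$ intersects all $G$-orbits; (C3) for every $G$-regular point $p\in\Sigma$, $T_p\Sigma$ contains the normal space $\nu_p(Gp)$ of the orbit as a subspace of codimension $k$; (C4) for every $G$-regular point $p\in\Sigma$, if $gp\in\Sigma$ for some $g\in G$, then $g\Sigma=\Sigma$. Through a given $G$-regular point, the set of all $k$-sections ($k=0,1,2,\dots$) has a unique minimal element with respect to inclusion; if this minimal element is a $k_0$-section then the copolarity is $\mathrm{copol}(G,V)=k_0$ (independent of the regular point). *)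

theory Defs
  imports "HOL-Analysis.Analysis" "HOL-Algebra.Group_Action"
begin

text \<open>
  Smoothness. On an open set a map is \<open>C\<^sup>k\<close> if it is \<open>k\<close> times differentiable and all iterated
  directional derivatives are continuous. On an arbitrary subset of a Euclidean space a map is
  smooth if near each point it is the restriction of a smooth map on an open set; for open subsets
  of a linear subspace this is smoothness intrinsic to the subspace. Working with subspaces of a
  Euclidean type, rather than with the type itself, is what admits dimension 0.
\<close>

primrec Ck_on :: "nat \<Rightarrow> ('a::euclidean_space \<Rightarrow> 'b::euclidean_space) \<Rightarrow> 'a set \<Rightarrow> bool" where
  "Ck_on 0 f U \<longleftrightarrow> continuous_on U f"
| "Ck_on (Suc k) f U \<longleftrightarrow>
     (\<forall>x\<in>U. f differentiable (at x)) \<and> (\<forall>v. Ck_on k (\<lambda>x. frechet_derivative f (at x) v) U)"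

definition smooth_on :: "'a::euclidean_space set \<Rightarrow> ('a \<Rightarrow> 'b::euclidean_space) \<Rightarrow> bool" where
  "smooth_on A f \<longleftrightarrow>
     (\<forall>x\<in>A. \<exists>U g. open U \<and> x \<in> U \<and> (\<forall>k. Ck_on k g U) \<and> (\<forall>y\<in>A \<inter> U. g y = f y))"

text \<open>
  Charts take values in a fixed linear subspace \<open>E\<close> of a Euclidean space, so the manifold has
  dimension \<open>dim E\<close>.
\<close>

definition chart :: "'g topology \<Rightarrow> 'e::euclidean_space set \<Rightarrow> 'g set \<Rightarrow> ('g \<Rightarrow> 'e) \<Rightarrow> bool" where
  "chart T E U \<phi> \<longleftrightarrow>
     openin T U \<and> openin (top_of_set E) (\<phi> ` U) \<and>
     homeomorphic_map (subtopology T U) (top_of_set (\<phi> ` U)) \<phi>"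

definition smooth_atlas ::
  "'g topology \<Rightarrow> 'e::euclidean_space set \<Rightarrow> ('g set \<times> ('g \<Rightarrow> 'e)) set \<Rightarrow> bool" where
  "smooth_atlas T E \<A> \<longleftrightarrow>
     (\<forall>(U, \<phi>)\<in>\<A>. chart T E U \<phi>) \<and>
     (\<Union>(U, \<phi>)\<in>\<A>. U) = topspace T \<and>
     (\<forall>(U, \<phi>)\<in>\<A>. \<forall>(W, \<psi>)\<in>\<A>. smooth_on (\<phi> ` (U \<inter> W)) (\<psi> \<circ> inv_into U \<phi>))"

definition compact_lie_group ::
  "('g, 'm) monoid_scheme \<Rightarrow> 'g topology \<Rightarrow> 'e::euclidean_space set \<Rightarrow>
     ('g set \<times> ('g \<Rightarrow> 'e)) set \<Rightarrow> bool" where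
  "compact_lie_group G T E \<A> \<longleftrightarrow>
     group G \<and> topspace T = carrier G \<and>
     Hausdorff_space T \<and> second_countable T \<and> compact_space T \<and>
     subspace E \<and> smooth_atlas T E \<A> \<and>
     continuous_map (prod_topology T T) T (\<lambda>(x, y). x \<otimes>\<^bsub>G\<^esub> y) \<and>
     continuous_map T T (\<lambda>x. inv\<^bsub>G\<^esub> x) \<and>
     (\<forall>(U, \<phi>)\<in>\<A>. \<forall>(U', \<phi>')\<in>\<A>. \<forall>(W, \<psi>)\<in>\<A>.
        smooth_on {(\<phi> x, \<phi>' y) | x y. x \<in> U \<and> y \<in> U' \<and> x \<otimes>\<^bsub>G\<^esub> y \<in> W}
          (\<lambda>(a, b). \<psi> (inv_into U \<phi> a \<otimes>\<^bsub>G\<^esub> inv_into U' \<phi>' b))) \<and>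
     (\<forall>(U, \<phi>)\<in>\<A>. \<forall>(W, \<psi>)\<in>\<A>.
        smooth_on {\<phi> x | x. x \<in> U \<and> inv\<^bsub>G\<^esub> x \<in> W} (\<lambda>a. \<psi> (inv\<^bsub>G\<^esub> (inv_into U \<phi> a))))"

text \<open>
  Orthogonal representations on a Euclidean space \<open>V\<close>, given as a linear subspace of a Euclidean
  type with the induced inner product. As in \<^locale>\<open>group_action\<close>, the maps \<open>\<rho> g\<close> are only
  meaningful on \<open>V\<close>.
\<close>

definition orthogonal_representation ::
  "('g, 'm) monoid_scheme \<Rightarrow> ('g set \<times> ('g \<Rightarrow> 'e::euclidean_space)) set \<Rightarrow>
     'v::euclidean_space set \<Rightarrow> ('g \<Rightarrow> 'v \<Rightarrow> 'v) \<Rightarrow> bool" where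
  "orthogonal_representation G \<A> V \<rho> \<longleftrightarrow>
     subspace V \<and> group_action G V \<rho> \<and>
     (\<forall>g\<in>carrier G. \<forall>x\<in>V. \<forall>y\<in>V. \<rho> g (x + y) = \<rho> g x + \<rho> g y) \<and>
     (\<forall>g\<in>carrier G. \<forall>c. \<forall>x\<in>V. \<rho> g (c *\<^sub>R x) = c *\<^sub>R \<rho> g x) \<and>
     (\<forall>g\<in>carrier G. \<forall>x\<in>V. norm (\<rho> g x) = norm x) \<and>
     (\<forall>(U, \<phi>)\<in>\<A>. smooth_on (\<phi> ` U \<times> V) (\<lambda>(a, x). \<rho> (inv_into U \<phi> a) x))"

definition tangent_space :: "'v::euclidean_space set \<Rightarrow> 'v \<Rightarrow> 'v set" where
  "tangent_space S p =
     {v. \<exists>c e. e > 0 \<and> smooth_on {-e<..<e} c \<and> c ` {-e<..<e} \<subseteq> S \<and> c 0 = p \<and>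
           (c has_vector_derivative v) (at (0::real))}"

definition normal_space_in :: "'v::euclidean_space set \<Rightarrow> 'v set \<Rightarrow> 'v \<Rightarrow> 'v set" where
  "normal_space_in V S p = V \<inter> (tangent_space S p)\<^sup>\<bottom>"

definition submanifold :: "'v::euclidean_space set \<Rightarrow> bool" where
  "submanifold S \<longleftrightarrow>
     (\<exists>d. \<forall>p\<in>S. \<exists>(U::'v set) (U'::'v set) \<phi> \<psi> E.
        open U \<and> p \<in> U \<and> open U' \<and> homeomorphism U U' \<phi> \<psi> \<and> smooth_on U \<phi> \<and> smooth_on U' \<psi> \<and>
        subspace E \<and> dim E = d \<and> \<phi> ` (S \<inter> U) = E \<inter> U')"

text \<open>
  The Levi-Civita connection of the metric induced on \<open>S\<close> is the tangential part of the Euclidean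
  derivative, so a curve in \<open>S\<close> is a geodesic of \<open>S\<close> iff its acceleration is normal to \<open>S\<close>.
\<close>

definition geodesic_on :: "real set \<Rightarrow> 'v::euclidean_space set \<Rightarrow> (real \<Rightarrow> 'v) \<Rightarrow> bool" where
  "geodesic_on I S c \<longleftrightarrow>
     smooth_on I c \<and> c ` I \<subseteq> S \<and>
     (\<forall>t\<in>I. vector_derivative (\<lambda>s. vector_derivative c (at s)) (at t) \<in> (tangent_space S (c t))\<^sup>\<bottom>)"

definition totally_geodesic_in :: "'v::euclidean_space set \<Rightarrow> 'v set \<Rightarrow> bool" where
  "totally_geodesic_in V S \<longleftrightarrow>
     S \<subseteq> V \<and> (\<forall>I c. open I \<and> is_interval I \<and> geodesic_on I S c \<longrightarrow> geodesic_on I V c)"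

definition geodesically_complete :: "'v::euclidean_space set \<Rightarrow> bool" where
  "geodesically_complete S \<longleftrightarrow>
     (\<forall>p\<in>S. \<forall>v\<in>tangent_space S p.
        \<exists>c. geodesic_on UNIV S c \<and> c 0 = p \<and> (c has_vector_derivative v) (at 0))"

text \<open>
  An orbit is principal if its orbit type is maximal, i.e. its isotropy groups are conjugate to
  subgroups of every isotropy group.
\<close>

definition principal_orbit ::
  "('g, 'm) monoid_scheme \<Rightarrow> 'v set \<Rightarrow> ('g \<Rightarrow> 'v \<Rightarrow> 'v) \<Rightarrow> 'v set \<Rightarrow> bool" where
  "principal_orbit G V \<rho> X \<longleftrightarrow>
     (\<exists>p\<in>V. X = orbit G \<rho> p \<and>
        (\<forall>x\<in>V. \<exists>g\<in>carrier G.
           (\<lambda>h. g \<otimes>\<^bsub>G\<^esub> h \<otimes>\<^bsub>G\<^esub> inv\<^bsub>G\<^esub> g) ` stabilizer G \<rho> p \<subseteq> stabilizer G \<rho> x))"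

definition regular_point ::
  "('g, 'm) monoid_scheme \<Rightarrow> 'v set \<Rightarrow> ('g \<Rightarrow> 'v \<Rightarrow> 'v) \<Rightarrow> 'v \<Rightarrow> bool" where
  "regular_point G V \<rho> p \<longleftrightarrow> p \<in> V \<and> principal_orbit G V \<rho> (orbit G \<rho> p)"

definition k_section ::
  "('g, 'm) monoid_scheme \<Rightarrow> 'v::euclidean_space set \<Rightarrow> ('g \<Rightarrow> 'v \<Rightarrow> 'v) \<Rightarrow> nat \<Rightarrow> 'v set \<Rightarrow> bool" where
  "k_section G V \<rho> k \<Sigma> \<longleftrightarrow>
     \<Sigma> \<subseteq> V \<and> submanifold \<Sigma> \<and> connected \<Sigma> \<and> geodesically_complete \<Sigma> \<and>
     totally_geodesic_in V \<Sigma> \<and>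
     (\<forall>X\<in>orbits G V \<rho>. \<Sigma> \<inter> X \<noteq> {}) \<and>
     (\<forall>p\<in>\<Sigma>. regular_point G V \<rho> p \<longrightarrow>
        normal_space_in V (orbit G \<rho> p) p \<subseteq> tangent_space \<Sigma> p \<and>
        dim (tangent_space \<Sigma> p) = dim (normal_space_in V (orbit G \<rho> p) p) + k) \<and>
     (\<forall>p\<in>\<Sigma>. regular_point G V \<rho> p \<longrightarrow>
        (\<forall>g\<in>carrier G. \<rho> g p \<in> \<Sigma> \<longrightarrow> \<rho> g ` \<Sigma> = \<Sigma>))"

definition sections_through ::
  "('g, 'm) monoid_scheme \<Rightarrow> 'v::euclidean_space set \<Rightarrow> ('g \<Rightarrow> 'v \<Rightarrow> 'v) \<Rightarrow> 'v \<Rightarrow> 'v set set" where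
  "sections_through G V \<rho> p = {\<Sigma>. p \<in> \<Sigma> \<and> (\<exists>k. k_section G V \<rho> k \<Sigma>)}"

definition minimal_section ::
  "('g, 'm) monoid_scheme \<Rightarrow> 'v::euclidean_space set \<Rightarrow> ('g \<Rightarrow> 'v \<Rightarrow> 'v) \<Rightarrow> 'v \<Rightarrow> 'v set \<Rightarrow> bool" where
  "minimal_section G V \<rho> p \<Sigma> \<longleftrightarrow>
     \<Sigma> \<in> sections_through G V \<rho> p \<and>
     (\<forall>\<Sigma>'\<in>sections_through G V \<rho> p. \<Sigma>' \<subseteq> \<Sigma> \<longrightarrow> \<Sigma>' = \<Sigma>)"

text \<open>
  For an orthogonal representation of a compact Lie group the number below exists and is unique:
  minimal sections through regular points exist, and their \<open>k\<close> does not depend on any choice.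
  It depends only on the group and its action, not on the smooth structure of the group.
\<close>

definition copolarity ::
  "('g, 'm) monoid_scheme \<Rightarrow> 'v::euclidean_space set \<Rightarrow> ('g \<Rightarrow> 'v \<Rightarrow> 'v) \<Rightarrow> nat" where
  "copolarity G V \<rho> =
     (THE k. \<exists>p \<Sigma>. regular_point G V \<rho> p \<and> minimal_section G V \<rho> p \<Sigma> \<and> k_section G V \<rho> k \<Sigma>)"

definition isotropy_group ::
  "('g, 'm) monoid_scheme \<Rightarrow> ('g \<Rightarrow> 'v \<Rightarrow> 'v) \<Rightarrow> 'v \<Rightarrow> ('g, 'm) monoid_scheme" where
  "isotropy_group G \<rho> q = G\<lparr>carrier := stabilizer G \<rho> q\<rparr>"

definition slice_action ::
  "('g, 'm) monoid_scheme \<Rightarrow> 'v::euclidean_space set \<Rightarrow> ('g \<Rightarrow> 'v \<Rightarrow> 'v) \<Rightarrow> 'v \<Rightarrow> 'g \<Rightarrow> 'v \<Rightarrow> 'v" where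
  "slice_action G V \<rho> q g =
     restrict (frechet_derivative (\<rho> g) (at q within V)) (normal_space_in V (orbit G \<rho> q) q)"

end

theory Submission
  imports Defs
begin

text \<open>
  A complete totally geodesic submanifold of a Euclidean space that contains 0 is a linear subspace,
  so a \<open>k\<close>-section is a linear subspace \<open>S\<close> that contains a regular point and, at each of its regular
  points \<open>p\<close>, the normal space \<open>\<nu>\<^sub>p\<close>, as a subspace of codimension \<open>k\<close>; moreover \<open>g\<close> maps \<open>S\<close> to itself as
  soon as it maps a regular point of \<open>S\<close> into \<open>S\<close>. Minimal sections are obtained by intersection, and the
  copolarity is the least \<open>k\<close> for which a \<open>k\<close>-section exists.

  Move a section \<open>S\<close> so that \<open>q \<in> S\<close>. Then \<open>S \<inter> \<nu>\<^sub>q\<close> is a section of the slice representation at \<open>q\<close>: with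
  \<open>N\<close> the group of all \<open>g\<close> preserving \<open>S\<close>, a vector of \<open>S\<close> normal to \<open>N q\<close> is normal to \<open>G q\<close>, so the
  orthogonal projection to \<open>\<nu>\<^sub>q\<close> maps \<open>S\<close> into itself, and for small regular \<open>v \<in> \<nu>\<^sub>q\<close> the normal space of
  the slice representation at \<open>v\<close> is the isomorphic projection of \<open>\<nu>\<^bsub>q+v\<^esub> \<subseteq> S\<close>. Hence its codimension in
  \<open>S \<inter> \<nu>\<^sub>q\<close> is at most that of \<open>\<nu>\<^bsub>q+v\<^esub>\<close> in \<open>S\<close>.

  Everything depends on \<open>G\<close> only through its image, a compact group of linear isometries. Its Lie
  algebra consists of the \<open>X\<close> with \<open>exp (t X)\<close> in the group for all \<open>t\<close>; by the argument for the closed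
  subgroup theorem it contains all limits of \<open>(g\<^sub>n - 1) / \<delta>\<^sub>n\<close> with \<open>\<delta>\<^sub>n \<rightarrow> 0\<close>. This yields that \<open>p\<close> is the point
  of its orbit nearest to \<open>p + v\<close> for all small normal vectors \<open>v\<close>, which replaces the slice theorem.
\<close>
section \<open>The Banach algebra of endomorphisms\<close>

text \<open>A copy of the bounded operators in which composition is the multiplication, so that
  powers and \<open>exp\<close> of a Banach algebra apply to operators.\<close>

typedef (overloaded) 'a endo = "UNIV :: ('a::euclidean_space \<Rightarrow>\<^sub>L 'a) set"
  morphisms blin Endo by simp

setup_lifting type_definition_endo

instantiation endo :: (euclidean_space) real_normed_algebra_1
begin

lift_definition zero_endo :: "'a endo" is 0 .
lift_definition one_endo :: "'a endo" is id_blinfun .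
lift_definition plus_endo :: "'a endo \<Rightarrow> 'a endo \<Rightarrow> 'a endo" is "(+)" .
lift_definition minus_endo :: "'a endo \<Rightarrow> 'a endo \<Rightarrow> 'a endo" is "(-)" .
lift_definition uminus_endo :: "'a endo \<Rightarrow> 'a endo" is uminus .
lift_definition times_endo :: "'a endo \<Rightarrow> 'a endo \<Rightarrow> 'a endo" is "\<lambda>f g. f o\<^sub>L g" .
lift_definition scaleR_endo :: "real \<Rightarrow> 'a endo \<Rightarrow> 'a endo" is "(*\<^sub>R)" .
lift_definition norm_endo :: "'a endo \<Rightarrow> real" is norm .
definition dist_endo :: "'a endo \<Rightarrow> 'a endo \<Rightarrow> real" where "dist_endo x y = norm (x - y)"
definition sgn_endo :: "'a endo \<Rightarrow> 'a endo" where "sgn_endo x = scaleR (inverse (norm x)) x"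
definition [code del]:
  "(uniformity :: ('a endo \<times> 'a endo) filter) = (INF e\<in>{0 <..}. principal {(x, y). dist x y < e})"
definition open_endo :: "'a endo set \<Rightarrow> bool" where
  "open_endo S = (\<forall>x\<in>S. \<forall>\<^sub>F (x', y) in uniformity. x' = x \<longrightarrow> y \<in> S)"

instance
proof
  fix a b :: real and x y z :: "'a endo"
  show "x + y + z = x + (y + z)" "x + y = y + x" "0 + x = x" "- x + x = 0" "x - y = x + - y"
    "a *\<^sub>R (x + y) = a *\<^sub>R x + a *\<^sub>R y" "(a + b) *\<^sub>R x = a *\<^sub>R x + b *\<^sub>R x"
    "a *\<^sub>R b *\<^sub>R x = (a * b) *\<^sub>R x" "1 *\<^sub>R x = x"
    "norm (x + y) \<le> norm x + norm y" "norm (a *\<^sub>R x) = \<bar>a\<bar> * norm x" "(norm x = 0) = (x = 0)"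
    by (transfer; simp add: algebra_simps norm_triangle_ineq)+
  show "x * y * z = x * (y * z)" "1 * x = x" "x * 1 = x" "(x + y) * z = x * z + y * z"
    "x * (y + z) = x * y + x * z" "a *\<^sub>R x * y = a *\<^sub>R (x * y)" "x * a *\<^sub>R y = a *\<^sub>R (x * y)"
    by (transfer; auto intro!: blinfun_eqI simp: blinfun.bilinear_simps)+
  show "(0 :: 'a endo) \<noteq> 1" "norm (1 :: 'a endo) = 1"
    by (transfer; metis norm_blinfun_id norm_zero zero_neq_one)+
  show "norm (x * y) \<le> norm x * norm y"
    by transfer (rule norm_blinfun_compose)
qed (simp_all add: dist_endo_def sgn_endo_def uniformity_endo_def open_endo_def)

end

lemma blin_Cauchy: "Cauchy X \<longleftrightarrow> Cauchy (\<lambda>n. blin (X n))"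
  by (simp add: Cauchy_def dist_norm norm_endo.rep_eq minus_endo.rep_eq)

lemma Endo_tendsto: "f \<longlonglongrightarrow> l \<Longrightarrow> (\<lambda>n. Endo (f n)) \<longlonglongrightarrow> Endo l"
  by (simp add: LIMSEQ_def dist_norm norm_endo.rep_eq minus_endo.rep_eq Endo_inverse)

instance endo :: (euclidean_space) banach
proof
  fix X :: "nat \<Rightarrow> 'a endo"
  assume "Cauchy X"
  then obtain l where "(\<lambda>n. blin (X n)) \<longlonglongrightarrow> l"
    using blin_Cauchy Cauchy_convergent convergent_def by blast
  from Endo_tendsto[OF this] show "convergent X"
    by (auto simp: convergent_def blin_inverse)
qed

instance endo :: (euclidean_space) heine_borel
proof
  fix X :: "nat \<Rightarrow> 'a endo"
  assume "bounded (range X)"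
  then have "bounded (range (\<lambda>n. blin (X n)))"
    by (simp add: bounded_iff norm_endo.rep_eq)
  then obtain l r where "strict_mono (r :: nat \<Rightarrow> nat)" "((\<lambda>n. blin (X n)) \<circ> r) \<longlonglongrightarrow> l"
    using bounded_imp_convergent_subsequence by blast
  with Endo_tendsto[OF this(2)] show "\<exists>l r. strict_mono (r :: nat \<Rightarrow> nat) \<and> (X \<circ> r) \<longlonglongrightarrow> l"
    by (auto simp: blin_inverse o_def)
qed

lift_definition act :: "'a::euclidean_space endo \<Rightarrow> 'a \<Rightarrow> 'a" (infixr "\<cdot>" 75) is blinfun_apply .

lemma bounded_bilinear_act: "bounded_bilinear (\<cdot>)"
proof
  show "\<exists>K. \<forall>A (x :: 'a). norm (A \<cdot> x) \<le> norm A * norm x * K"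
    by (rule exI[of _ 1], transfer) (simp add: norm_blinfun)
qed (transfer; simp add: blinfun.bilinear_simps)+

interpretation act: bounded_bilinear "(\<cdot>)" by (rule bounded_bilinear_act)

lemma act_mult [simp]: "(A * B) \<cdot> x = A \<cdot> B \<cdot> x"
  by transfer simp

lemma act_one [simp]: "1 \<cdot> x = x"
  by transfer simp

lemma norm_act: "norm (A \<cdot> x) \<le> norm A * norm x"
  by transfer (rule norm_blinfun)

lemma norm_endo_bound: "0 \<le> b \<Longrightarrow> (\<And>x. norm (A \<cdot> x) \<le> b * norm x) \<Longrightarrow> norm A \<le> b"
  by transfer (rule norm_blinfun_bound)

lemma endo_eqI: "(\<And>x. A \<cdot> x = B \<cdot> x) \<Longrightarrow> A = B"
  by transfer (rule blinfun_eqI)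

lemma linear_act: "linear ((\<cdot>) A)"
  by (simp add: act.bounded_linear_right bounded_linear.linear)

lemma endo_of_linear: 
  assumes "linear f" shows "\<exists>A. \<forall>x. A \<cdot> x = f x"
proof -
  have "bounded_linear f" using assms by (simp add: linear_conv_bounded_linear)
  then have "Endo (Blinfun f) \<cdot> x = f x" for x
    by (simp add: act.rep_eq Endo_inverse bounded_linear_Blinfun_apply)
  then show ?thesis by blast
qed

section \<open>Compact groups of isometries and their Lie algebras\<close>

text \<open>Derivatives are exploited through difference quotients along one null sequence: a closed
  set containing the quotients contains the derivative, and \<open>lie_limit\<close> takes such
  quotients as input.\<close>

lemma has_vector_derivative_sequentially:
  fixes f :: "real \<Rightarrow> 'b::real_normed_vector"
  assumes f: "(f has_vector_derivative D) (at x)" and d: "\<delta> \<longlonglongrightarrow> 0" "\<And>n. \<delta> n \<noteq> 0"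
  shows "(\<lambda>n. (1 / \<delta> n) *\<^sub>R (f (x + \<delta> n) - f x)) \<longlonglongrightarrow> D"
proof -
  have "(\<lambda>h. norm (f (x + h) - f x - h *\<^sub>R D) / norm h) \<midarrow>0\<rightarrow> 0"
    using f by (simp add: has_vector_derivative_def has_derivative_at)
  moreover have "filterlim \<delta> (at 0) sequentially"
    using d by (simp add: filterlim_at)
  ultimately have "(\<lambda>n. norm (f (x + \<delta> n) - f x - \<delta> n *\<^sub>R D) / norm (\<delta> n)) \<longlonglongrightarrow> 0"
    by (rule filterlim_compose)
  moreover have "norm (f (x + \<delta> n) - f x - \<delta> n *\<^sub>R D) / norm (\<delta> n)
      = norm ((1 / \<delta> n) *\<^sub>R (f (x + \<delta> n) - f x) - D)" for n
  proof -
    have "(1 / \<delta> n) *\<^sub>R (f (x + \<delta> n) - f x) - D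
        = (1 / \<delta> n) *\<^sub>R (f (x + \<delta> n) - f x - \<delta> n *\<^sub>R D)"
      using d(2) by (simp add: scaleR_diff_right)
    then show ?thesis by simp
  qed
  ultimately show ?thesis
    by (simp add: tendsto_norm_zero_iff LIM_zero_iff)
qed

lemma exp_act_has_vector_derivative:
  "((\<lambda>t. exp (t *\<^sub>R X) \<cdot> x) has_vector_derivative exp (t *\<^sub>R X) \<cdot> X \<cdot> x) (at t)"
  using bounded_linear.has_vector_derivative[OF act.bounded_linear_left
      exp_scaleR_has_vector_derivative_right[of X t UNIV], of x] by simp

text \<open>The curve \<open>exp (t *\<^sub>R X) \<cdot> p\<close> has velocity
  \<open>exp (t *\<^sub>R X) \<cdot> X \<cdot> p\<close>, which vanishes identically.\<close>

lemma exp_act_fixed: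
  assumes "X \<cdot> p = 0" shows "exp (t *\<^sub>R X) \<cdot> p = p"
proof -
  have "\<And>s. s \<in> UNIV \<Longrightarrow> ((\<lambda>t. exp (t *\<^sub>R X) \<cdot> p) has_vector_derivative 0) (at s within UNIV)"
    using exp_act_has_vector_derivative[of X p] assms by (simp add: act.zero_right)
  then obtain c where "\<And>s. exp (s *\<^sub>R X) \<cdot> p = c"
    using has_vector_derivative_zero_constant[OF convex_UNIV] by (metis UNIV_I)
  from this[of t] this[of 0] show ?thesis by simp
qed

text \<open>Telescoping: the factors \<open>g\<close> are exchanged for \<open>b\<close> one at a
  time. Those to the left are contractions, those to the right form a power of \<open>b\<close>
  bounded by \<open>M\<close>.\<close>

lemma norm_power_diff_le:
  fixes g b :: "'a::real_normed_algebra_1"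
  assumes "norm g \<le> 1" "\<And>j. j < m \<Longrightarrow> norm (b ^ j) \<le> M"
  shows "norm (g ^ m - b ^ m) \<le> real m * M * norm (g - b)"
  using assms(2)
proof (induction m)
  case (Suc m)
  have "g ^ Suc m - b ^ Suc m = g * (g ^ m - b ^ m) + (g - b) * b ^ m"
    by (simp add: algebra_simps)
  also have "norm \<dots> \<le> norm (g * (g ^ m - b ^ m)) + norm ((g - b) * b ^ m)"
    by (rule norm_triangle_ineq)
  also have "\<dots> \<le> 1 * norm (g ^ m - b ^ m) + norm (g - b) * M"
    using Suc.prems assms(1)
    by (intro add_mono order_trans[OF norm_mult_ineq] mult_mono) auto
  also have "\<dots> \<le> real (Suc m) * M * norm (g - b)"
    using Suc by (simp add: algebra_simps)
  finally show ?case .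
qed simp

lemma exp_power_commuting:
  fixes X :: "'a::{real_normed_algebra_1,banach}"
  shows "exp (t *\<^sub>R X) ^ m = exp ((real m * t) *\<^sub>R X)"
proof (induction m)
  case (Suc m)
  have "exp (t *\<^sub>R X + (real m * t) *\<^sub>R X) = exp (t *\<^sub>R X) * exp ((real m * t) *\<^sub>R X)"
    by (rule exp_add_commuting) simp
  with Suc show ?case by (simp add: algebra_simps)
qed simp

lemma tendsto_exp_scaleR:
  fixes X :: "'a::{real_normed_algebra_1,banach}"
  assumes "(f \<longlongrightarrow> t) F"
  shows "((\<lambda>n. exp (f n *\<^sub>R X)) \<longlongrightarrow> exp (t *\<^sub>R X)) F"
proof -
  have "isCont (\<lambda>t. exp (t *\<^sub>R X)) t"
    using exp_scaleR_has_vector_derivative_right has_vector_derivative_continuous by blast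
  then show ?thesis using assms isCont_tendsto_compose by blast
qed

text \<open>Norms are preserved on the whole type and not only on \<open>V\<close>: a representation
  on \<open>V\<close> enters through its extension by the identity on the orthogonal
  complement.\<close>

locale ortho_group =
  fixes H :: "'v::euclidean_space endo set"
  assumes one_mem: "1 \<in> H"
    and mult_mem: "g \<in> H \<Longrightarrow> h \<in> H \<Longrightarrow> g * h \<in> H"
    and inverse_mem: "g \<in> H \<Longrightarrow> \<exists>h\<in>H. g * h = 1 \<and> h * g = 1"
    and norm_act_eq: "g \<in> H \<Longrightarrow> norm (g \<cdot> x) = norm x"
    and compact: "compact H"

definition lie :: "'v::euclidean_space endo set \<Rightarrow> 'v endo set" where
  "lie H = {X. \<forall>t. exp (t *\<^sub>R X) \<in> H}"

context ortho_group
begin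

lemma inner_act_eq: "g \<in> H \<Longrightarrow> (g \<cdot> x) \<bullet> (g \<cdot> y) = x \<bullet> y"
  by (simp add: dot_norm norm_act_eq flip: act.add_right)

lemma obtain_inverse:
  assumes "g \<in> H"
  obtains g' where "g' \<in> H" "g * g' = 1" "g' * g = 1" "\<And>x. g \<cdot> g' \<cdot> x = x" "\<And>x. g' \<cdot> g \<cdot> x = x"
    "\<And>x y. (g \<cdot> x) \<bullet> y = x \<bullet> (g' \<cdot> y)"
proof -
  obtain g' where g': "g' \<in> H" "g * g' = 1" "g' * g = 1"
    using inverse_mem assms by blast
  have 1: "g \<cdot> g' \<cdot> x = x" "g' \<cdot> g \<cdot> x = x" for x
    using g' act_mult act_one by metis+
  have "(g \<cdot> x) \<bullet> y = x \<bullet> (g' \<cdot> y)" for x y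
    using inner_act_eq[OF g'(1), of "g \<cdot> x" y] 1 by simp
  with g' 1 show ?thesis using that by blast
qed

lemma norm_mem_le: "g \<in> H \<Longrightarrow> norm g \<le> 1"
  by (rule norm_endo_bound) (auto simp: norm_act_eq)

lemma power_mem: "g \<in> H \<Longrightarrow> g ^ n \<in> H"
  by (induction n) (auto simp: one_mem mult_mem)

lemma closed: "closed H"
  by (simp add: compact compact_imp_closed)

text \<open>With \<open>m n\<close> the integer part of \<open>t / \<delta> n\<close>, the powers
  \<open>g n ^ m n\<close> lie in the closed set \<open>H\<close> and tend to
  \<open>exp (t *\<^sub>R X)\<close>. Indeed \<open>g n\<close> differs from
  \<open>exp (\<delta> n *\<^sub>R X)\<close> by o(\<open>\<delta> n\<close>), and taking the power
  multiplies this error by a factor of order \<open>t / \<delta> n\<close> only.\<close>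

lemma lie_limit:
  assumes g: "\<And>n. g n \<in> H" and d: "\<And>n. \<delta> n > 0" "\<delta> \<longlonglongrightarrow> 0"
    and X: "(\<lambda>n. (1 / \<delta> n) *\<^sub>R (g n - 1)) \<longlonglongrightarrow> X"
  shows "X \<in> lie H"
proof -
  have pos: "exp (t *\<^sub>R X) \<in> H" if t: "t \<ge> 0" for t
  proof -
    define m where "m n = nat \<lfloor>t / \<delta> n\<rfloor>" for n
    define b where "b n = exp (\<delta> n *\<^sub>R X)" for n
    have m_le: "real (m n) * \<delta> n \<le> t" for n
    proof -
      have "real (m n) \<le> t / \<delta> n" using t d(1)[of n] by (simp add: m_def)
      then show ?thesis using d(1)[of n] by (simp add: field_simps)
    qed
    have m_ge: "t - \<delta> n \<le> real (m n) * \<delta> n" for n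
    proof -
      have "t / \<delta> n - 1 \<le> real (m n)" using t d(1)[of n] by (simp add: m_def)
      then show ?thesis using d(1)[of n] by (simp add: field_simps)
    qed
    have "(\<lambda>n. t - \<delta> n) \<longlonglongrightarrow> t - 0" using d by (intro tendsto_intros)
    then have m_lim: "(\<lambda>n. real (m n) * \<delta> n) \<longlonglongrightarrow> t"
      using real_tendsto_sandwich[of "\<lambda>n. t - \<delta> n" "\<lambda>n. real (m n) * \<delta> n" sequentially "\<lambda>_. t" t] m_le m_ge
      by simp
    have b_pow: "b n ^ m n = exp ((real (m n) * \<delta> n) *\<^sub>R X)" for n
      by (simp add: b_def exp_power_commuting)
    have lim_b: "(\<lambda>n. b n ^ m n) \<longlonglongrightarrow> exp (t *\<^sub>R X)"
      unfolding b_pow by (rule tendsto_exp_scaleR[OF m_lim])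
    have bound: "norm (g n ^ m n - b n ^ m n)
        \<le> t * exp (t * norm X) * norm ((1 / \<delta> n) *\<^sub>R (g n - 1) - (1 / \<delta> n) *\<^sub>R (b n - 1))" for n
    proof -
      have "norm (b n ^ j) \<le> exp (t * norm X)" if "j < m n" for j
      proof -
        have "norm (b n ^ j) \<le> exp (norm ((real j * \<delta> n) *\<^sub>R X))"
          unfolding b_def exp_power_commuting by (rule norm_exp)
        also have "real j * \<delta> n \<le> real (m n) * \<delta> n"
          using that d(1)[of n] by (intro mult_right_mono) auto
        then have "real j * \<delta> n \<le> t"
          using m_le[of n] by linarith
        then have "norm ((real j * \<delta> n) *\<^sub>R X) \<le> t * norm X"
          using d(1)[of n] by (simp add: mult_right_mono)
        finally show ?thesis by simp
      qed
      then have "norm (g n ^ m n - b n ^ m n) \<le> real (m n) * exp (t * norm X) * norm (g n - b n)"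
        by (rule norm_power_diff_le[OF norm_mem_le[OF g]])
      also have "norm (g n - b n)
          = \<delta> n * norm ((1 / \<delta> n) *\<^sub>R (g n - 1) - (1 / \<delta> n) *\<^sub>R (b n - 1))"
      proof -
        have "(1 / \<delta> n) *\<^sub>R (g n - 1) - (1 / \<delta> n) *\<^sub>R (b n - 1) = (1 / \<delta> n) *\<^sub>R (g n - b n)"
          by (simp add: algebra_simps)
        then show ?thesis using d(1)[of n] by simp
      qed
      also have "real (m n) * exp (t * norm X) * (\<delta> n * norm ((1 / \<delta> n) *\<^sub>R (g n - 1) - (1 / \<delta> n) *\<^sub>R (b n - 1)))
          = (real (m n) * \<delta> n) * (exp (t * norm X) * norm ((1 / \<delta> n) *\<^sub>R (g n - 1) - (1 / \<delta> n) *\<^sub>R (b n - 1)))"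
        by (simp only: mult_ac)
      also have "\<dots> \<le> t * (exp (t * norm X) * norm ((1 / \<delta> n) *\<^sub>R (g n - 1) - (1 / \<delta> n) *\<^sub>R (b n - 1)))"
        by (rule mult_right_mono[OF m_le]) simp
      finally show ?thesis by (simp add: mult.assoc)
    qed
    have "(\<lambda>n. (1 / \<delta> n) *\<^sub>R (b n - 1)) \<longlonglongrightarrow> X"
      using has_vector_derivative_sequentially[OF exp_scaleR_has_vector_derivative_right[of X 0 UNIV] d(2)] d(1)
      by (simp add: b_def less_imp_neq[symmetric])
    then have "(\<lambda>n. t * exp (t * norm X) * norm ((1 / \<delta> n) *\<^sub>R (g n - 1) - (1 / \<delta> n) *\<^sub>R (b n - 1)))
        \<longlonglongrightarrow> t * exp (t * norm X) * norm (X - X)"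
      using X by (intro tendsto_intros)
    then have "(\<lambda>n. g n ^ m n - b n ^ m n) \<longlonglongrightarrow> 0"
      by (intro Lim_null_comparison[OF always_eventually[OF allI[OF bound]]]) simp
    from tendsto_add[OF this lim_b] have "(\<lambda>n. g n ^ m n) \<longlonglongrightarrow> exp (t *\<^sub>R X)" by simp
    then show ?thesis
      by (rule closed_sequentially[OF closed _, rotated]) (simp add: power_mem g)
  qed
  \<comment> \<open>For negative \<open>t\<close> the exponential is inverse to one already in
    \<open>H\<close>; inverses in an algebra are unique, so it equals the inverse that
    \<open>H\<close> provides.\<close>
  have "exp (t *\<^sub>R X) \<in> H" for t
  proof (cases "t \<ge> 0")
    case False
    then have "exp ((-t) *\<^sub>R X) \<in> H" by (intro pos) simp
    then obtain h where h: "h \<in> H" "exp ((-t) *\<^sub>R X) * h = 1" using inverse_mem by blast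
    have "exp (t *\<^sub>R X + (-t) *\<^sub>R X) = exp (t *\<^sub>R X) * exp ((-t) *\<^sub>R X)"
      by (rule exp_add_commuting) simp
    then have "exp (t *\<^sub>R X) * exp ((-t) *\<^sub>R X) = 1" by simp
    then have "exp (t *\<^sub>R X) = exp (t *\<^sub>R X) * (exp ((-t) *\<^sub>R X) * h)" using h by simp
    also have "\<dots> = h" by (simp only: mult.assoc[symmetric] \<open>exp (t *\<^sub>R X) * exp ((-t) *\<^sub>R X) = 1\<close>) simp
    finally show ?thesis using h by simp
  qed (use pos in auto)
  then show ?thesis by (simp add: lie_def)
qed

lemma exp_mem: "X \<in> lie H \<Longrightarrow> exp (t *\<^sub>R X) \<in> H"
  by (simp add: lie_def)

text \<open>Differentiate at 0 the inner product of \<open>exp (t *\<^sub>R X) \<cdot> x\<close> and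
  \<open>exp (t *\<^sub>R X) \<cdot> y\<close>, which is constant.\<close>

lemma lie_skew:
  assumes "X \<in> lie H" shows "(X \<cdot> x) \<bullet> y = - (x \<bullet> (X \<cdot> y))"
proof -
  let ?e = "\<lambda>t x. exp (t *\<^sub>R X) \<cdot> x"
  have "((\<lambda>t. ?e t x \<bullet> ?e t y) has_vector_derivative (?e 0 x \<bullet> ?e 0 (X \<cdot> y) + ?e 0 (X \<cdot> x) \<bullet> ?e 0 y)) (at 0)"
    by (rule bounded_bilinear.has_vector_derivative[OF bounded_bilinear_inner
        exp_act_has_vector_derivative exp_act_has_vector_derivative])
  moreover have "(\<lambda>t. ?e t x \<bullet> ?e t y) = (\<lambda>t. x \<bullet> y)"
    using inner_act_eq exp_mem[OF assms] by auto
  ultimately have "((\<lambda>t. x \<bullet> y) has_vector_derivative (x \<bullet> (X \<cdot> y) + (X \<cdot> x) \<bullet> y)) (at 0)"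
    by simp
  with has_vector_derivative_const[of "x \<bullet> y" "at (0::real)"]
  have "x \<bullet> (X \<cdot> y) + (X \<cdot> x) \<bullet> y = 0"
    using vector_derivative_unique_at by blast
  then show ?thesis by simp
qed

text \<open>For sums, the curve \<open>exp (t *\<^sub>R X) * exp (t *\<^sub>R Y)\<close> stays in
  \<open>H\<close> and has velocity \<open>X + Y\<close> at 0. It need not be a one-parameter group,
  but \<open>lie_limit\<close> asks only for its difference quotients.\<close>

lemma subspace_lie: "subspace (lie H)"
proof (rule subspaceI)
  show "0 \<in> lie H" by (simp add: lie_def one_mem)
next
  fix X Y assume XY: "X \<in> lie H" "Y \<in> lie H"
  let ?f = "\<lambda>t. exp (t *\<^sub>R X) * exp (t *\<^sub>R Y)"
  have "(?f has_vector_derivative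
      (exp (0 *\<^sub>R X) * (exp (0 *\<^sub>R Y) * Y) + (exp (0 *\<^sub>R X) * X) * exp (0 *\<^sub>R Y))) (at (0::real))"
    by (rule bounded_bilinear.has_vector_derivative[OF bounded_bilinear_mult
        exp_scaleR_has_vector_derivative_right exp_scaleR_has_vector_derivative_right])
  then have f: "(?f has_vector_derivative (X + Y)) (at 0)" by (simp add: add.commute)
  have "(\<lambda>n. (1 / (1 / real (Suc n))) *\<^sub>R (?f (0 + 1 / real (Suc n)) - ?f 0)) \<longlonglongrightarrow> X + Y"
    by (rule has_vector_derivative_sequentially[OF f LIMSEQ_Suc[OF lim_1_over_n]]) simp
  then have "(\<lambda>n. (1 / (1 / real (Suc n))) *\<^sub>R (?f (1 / real (Suc n)) - 1)) \<longlonglongrightarrow> X + Y"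
    by simp
  then show "X + Y \<in> lie H"
    by (rule lie_limit[rotated 3])
       (auto intro: LIMSEQ_Suc lim_1_over_n mult_mem exp_mem XY simp del: of_nat_Suc)
next
  fix X and c :: real assume "X \<in> lie H" then show "c *\<^sub>R X \<in> lie H"
    by (simp add: lie_def)
qed

lemma subspace_lie_act: "subspace ((\<lambda>X. X \<cdot> p) ` lie H)"
  by (rule linear_subspace_image[OF bounded_linear.linear[OF act.bounded_linear_left] subspace_lie])

text \<open>
  As \<open>norm (g \<cdot> p) = norm p\<close>, maximality of \<open>(g \<cdot> p) \<bullet> x\<close> at \<open>g = 1\<close> means that \<open>p\<close> is a point of its
  orbit nearest to \<open>x\<close>.
\<close>

lemma inner_lie_eq_0:
  assumes max: "\<And>g. g \<in> H \<Longrightarrow> (g \<cdot> p) \<bullet> x \<le> p \<bullet> x" and X: "X \<in> lie H"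
  shows "(X \<cdot> p) \<bullet> x = 0"
proof -
  have "((\<lambda>t. (exp (t *\<^sub>R X) \<cdot> p) \<bullet> x) has_vector_derivative (exp (0 *\<^sub>R X) \<cdot> X \<cdot> p) \<bullet> x) (at 0)"
    by (rule bounded_linear.has_vector_derivative[OF bounded_linear_inner_left exp_act_has_vector_derivative])
  then have "DERIV (\<lambda>t. (exp (t *\<^sub>R X) \<cdot> p) \<bullet> x) 0 :> (X \<cdot> p) \<bullet> x"
    by (simp add: has_real_derivative_iff_has_vector_derivative)
  then show ?thesis
    by (rule DERIV_local_max[of _ _ _ 1]) (use max exp_mem[OF X] in auto)
qed

end

section \<open>Normal slices and isotropy groups\<close>

lemma has_vector_derivative_mem_subspace:
  fixes f :: "real \<Rightarrow> 'b::euclidean_space"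
  assumes f: "(f has_vector_derivative D) (at x)" and S: "subspace S"
    and e: "e > 0" "\<And>t. \<bar>t - x\<bar> < e \<Longrightarrow> f t \<in> S"
  shows "D \<in> S"
proof -
  \<comment> \<open>The double \<open>Suc\<close> keeps every increment strictly below
    \<open>e\<close>, also for \<open>n = 0\<close>.\<close>
  let ?d = "\<lambda>n. e * (1 / real (Suc (Suc n)))"
  have "?d \<longlonglongrightarrow> e * 0"
    by (intro tendsto_intros LIMSEQ_Suc[OF LIMSEQ_Suc[OF lim_1_over_n]])
  then have "(\<lambda>n. (1 / ?d n) *\<^sub>R (f (x + ?d n) - f x)) \<longlonglongrightarrow> D"
    using e by (intro has_vector_derivative_sequentially[OF f]) auto
  moreover have "(1 / ?d n) *\<^sub>R (f (x + ?d n) - f x) \<in> S" for n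
    using e by (intro subspace_scale[OF S] subspace_diff[OF S] e(2))
      (auto simp: add_pos_nonneg divide_less_eq)
  ultimately show ?thesis
    by (rule closed_sequentially[OF closed_subspace[OF S], rotated])
qed

lemma power2_norm_diff: "(norm (a - b))\<^sup>2 = a \<bullet> a + b \<bullet> b - 2 * (a \<bullet> b)"
  by (simp add: power2_norm_eq_inner inner_diff_left inner_diff_right inner_commute)

definition stab :: "'v::euclidean_space endo set \<Rightarrow> 'v \<Rightarrow> 'v endo set" where
  "stab H p = {g \<in> H. g \<cdot> p = p}"

text \<open>The tangent space of the orbit is represented by the velocities
  \<open>X \<cdot> p\<close>. Agreement with the normal space formed from smooth curves is
  \<open>normal_space_in_orbit\<close>.\<close>

definition nrm :: "'v::euclidean_space endo set \<Rightarrow> 'v set \<Rightarrow> 'v \<Rightarrow> 'v set" where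
  "nrm H V p = {v \<in> V. \<forall>X\<in>lie H. (X \<cdot> p) \<bullet> v = 0}"

text \<open>\<open>stab H (g \<cdot> p)\<close> is the conjugate of \<open>stab H p\<close> by
  \<open>g\<close>, so the orbit type of \<open>p\<close> is maximal.\<close>

definition reg :: "'v::euclidean_space endo set \<Rightarrow> 'v set \<Rightarrow> 'v \<Rightarrow> bool" where
  "reg H V p \<longleftrightarrow> p \<in> V \<and> (\<forall>x\<in>V. \<exists>g\<in>H. stab H (g \<cdot> p) \<subseteq> stab H x)"

context ortho_group
begin

text \<open>
  Otherwise there are points \<open>x n \<rightarrow> p\<close> of the normal space whose nearest orbit points \<open>k n \<cdot> p\<close>
  differ from \<open>p\<close>. Choosing \<open>k n\<close> closest to 1 in its coset, the directions of \<open>k n - 1\<close> accumulate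
  at some \<open>X\<close> in the Lie algebra with \<open>X \<cdot> p \<noteq> 0\<close>. Both \<open>p\<close> and \<open>k n \<cdot> p\<close> are critical for the
  distance to \<open>x n\<close>; subtracting the two conditions gives \<open>(X \<cdot> X \<cdot> p) \<bullet> p = 0\<close> in the limit.
\<close>

lemma small_normal_nearest:
  "\<exists>s>0. \<forall>v. (\<forall>X\<in>lie H. (X \<cdot> p) \<bullet> v = 0) \<and> norm v < s \<longrightarrow>
     (\<forall>g\<in>H. (g \<cdot> p) \<bullet> (p + v) \<le> p \<bullet> (p + v))"
proof (rule ccontr)
  assume neg: "\<not> ?thesis"
  have "\<exists>v k. (\<forall>X\<in>lie H. (X \<cdot> p) \<bullet> v = 0) \<and> norm v < 1 / real (Suc n) \<and> k \<in> H \<and> k \<cdot> p \<noteq> p \<and>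
      (\<forall>h\<in>H. (h \<cdot> p) \<bullet> (p + v) \<le> (k \<cdot> p) \<bullet> (p + v)) \<and>
      (\<forall>h\<in>H. h \<cdot> p = k \<cdot> p \<longrightarrow> norm (k - 1) \<le> norm (h - 1))" for n
  proof -
    have "\<not> (\<forall>v. (\<forall>X\<in>lie H. (X \<cdot> p) \<bullet> v = 0) \<and> norm v < 1 / real (Suc n) \<longrightarrow>
        (\<forall>g\<in>H. (g \<cdot> p) \<bullet> (p + v) \<le> p \<bullet> (p + v)))"
      using neg[unfolded not_ex, rule_format, of "1 / real (Suc n)"] by simp
    then obtain v g0 where v: "\<forall>X\<in>lie H. (X \<cdot> p) \<bullet> v = 0" "norm v < 1 / real (Suc n)"
      and g0: "g0 \<in> H" "(g0 \<cdot> p) \<bullet> (p + v) > p \<bullet> (p + v)" by force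
    have "continuous_on H (\<lambda>g. (g \<cdot> p) \<bullet> (p + v))"
      by (intro continuous_intros act.continuous_on)
    then obtain g where g: "g \<in> H" "\<And>h. h \<in> H \<Longrightarrow> (h \<cdot> p) \<bullet> (p + v) \<le> (g \<cdot> p) \<bullet> (p + v)"
      using continuous_attains_sup[OF compact] one_mem by blast
    let ?K = "H \<inter> (\<lambda>h. h \<cdot> p) -` {g \<cdot> p}"
    have "closed ((\<lambda>h. h \<cdot> p) -` {g \<cdot> p})"
      by (intro closed_vimage closed_singleton continuous_intros act.continuous_on)
    then have "compact ?K" using compact by blast
    moreover have "continuous_on ?K (\<lambda>h. norm (h - 1))"
      by (intro continuous_intros)
    ultimately obtain k where k: "k \<in> ?K" "\<And>h. h \<in> ?K \<Longrightarrow> norm (k - 1) \<le> norm (h - 1)"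
      using continuous_attains_inf[of ?K "\<lambda>h. norm (h - 1)"] g(1) by blast
    have "k \<cdot> p \<noteq> p" using g(2)[OF g0(1)] g0(2) k by auto
    with v k g show ?thesis by (intro exI[of _ v] exI[of _ k]) auto
  qed
  then obtain v k where v: "\<And>n X. X \<in> lie H \<Longrightarrow> (X \<cdot> p) \<bullet> v n = 0" "\<And>n. norm (v n) < 1 / real (Suc n)"
    and k: "\<And>n. k n \<in> H" "\<And>n. k n \<cdot> p \<noteq> p"
    and k_max: "\<And>n h. h \<in> H \<Longrightarrow> (h \<cdot> p) \<bullet> (p + v n) \<le> (k n \<cdot> p) \<bullet> (p + v n)"
    and k_min: "\<And>n h. h \<in> H \<Longrightarrow> h \<cdot> p = k n \<cdot> p \<Longrightarrow> norm (k n - 1) \<le> norm (h - 1)"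
    by metis
  have v_lim: "v \<longlonglongrightarrow> 0"
    using v(2) by (intro Lim_null_comparison[OF always_eventually LIMSEQ_Suc[OF lim_1_over_n]]) (auto intro: less_imp_le)
  have orbit_dist: "norm (k n \<cdot> p - p) \<le> 2 * norm (v n)" for n
  proof -
    have "(norm (k n \<cdot> p - (p + v n)))\<^sup>2 \<le> (norm (p - (p + v n)))\<^sup>2"
      unfolding power2_norm_diff inner_act_eq[OF k(1)] using k_max[OF one_mem, of n] by simp
    then have "(norm (k n \<cdot> p - (p + v n)))\<^sup>2 \<le> (norm (v n))\<^sup>2" by simp
    then have "norm (k n \<cdot> p - (p + v n)) \<le> norm (v n)"
      by (rule power2_le_imp_le) simp
    moreover have "norm (k n \<cdot> p - p) \<le> norm (k n \<cdot> p - (p + v n)) + norm (v n)"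
      using norm_triangle_ineq[of "k n \<cdot> p - (p + v n)" "v n"] by simp
    ultimately show ?thesis by simp
  qed
  have "(\<lambda>n. 2 * norm (v n)) \<longlonglongrightarrow> 2 * norm (0 :: 'v)" by (intro tendsto_intros v_lim)
  then have "(\<lambda>n. k n \<cdot> p - p) \<longlonglongrightarrow> 0"
    by (intro Lim_null_comparison[OF always_eventually[OF allI[OF orbit_dist]]]) simp
  then have orbit_lim: "(\<lambda>n. k n \<cdot> p) \<longlonglongrightarrow> p" by (simp add: LIM_zero_iff)
  \<comment> \<open>A limit \<open>l\<close> of the \<open>k n\<close> fixes \<open>p\<close>, so
    multiplying \<open>k (r1 n)\<close> on the right by the inverse of \<open>l\<close> stays in the
    same coset and tends to 1. By minimality within the coset, \<open>k (r1 n)\<close> itself tends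
    to 1.\<close>
  obtain l r1 where l: "l \<in> H" and r1: "strict_mono r1" "(k \<circ> r1) \<longlonglongrightarrow> l"
    using compact[unfolded compact_eq_seq_compact_metric seq_compact_def] k(1) by metis
  have "(\<lambda>n. k (r1 n) \<cdot> p) \<longlonglongrightarrow> l \<cdot> p"
    using r1(2) by (intro act.tendsto tendsto_const) (simp add: o_def)
  moreover have "(\<lambda>n. k (r1 n) \<cdot> p) \<longlonglongrightarrow> p"
    using LIMSEQ_subseq_LIMSEQ[OF orbit_lim r1(1)] by (simp add: o_def)
  ultimately have lp: "l \<cdot> p = p" using LIMSEQ_unique by blast
  obtain l' where l': "l' \<in> H" "l * l' = 1" "\<And>x. l' \<cdot> l \<cdot> x = x"
    using obtain_inverse[OF l] by metis
  have l'p: "l' \<cdot> p = p" using l'(3)[of p] lp by simp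
  have k_le: "norm (k (r1 n) - 1) \<le> norm (k (r1 n) * l' - 1)" for n
    by (rule k_min) (auto simp: mult_mem k l' l'p)
  have "(\<lambda>n. norm (k (r1 n) * l' - 1)) \<longlonglongrightarrow> norm (l * l' - 1)"
    using r1(2) by (intro tendsto_intros) (simp add: o_def)
  then have k1_lim: "(\<lambda>n. k (r1 n) - 1) \<longlonglongrightarrow> 0"
    using l'(2) by (intro Lim_null_comparison[OF always_eventually[OF allI[OF k_le]]]) simp
  define d where "d n = norm (k (r1 n) - 1)" for n
  have d_pos: "d n > 0" for n using k(2)[of "r1 n"] by (auto simp: d_def)
  have d_lim: "d \<longlonglongrightarrow> 0" using k1_lim by (simp add: d_def[abs_def] tendsto_norm_zero)
  have "\<forall>n. (1 / d n) *\<^sub>R (k (r1 n) - 1) \<in> sphere 0 1"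
    using d_pos by (simp add: d_def)
  then obtain X r2 where X: "X \<in> sphere 0 1" and r2: "strict_mono r2"
    "((\<lambda>n. (1 / d n) *\<^sub>R (k (r1 n) - 1)) \<circ> r2) \<longlonglongrightarrow> X"
    by (rule seq_compactE[OF compact_imp_seq_compact[OF compact_sphere]]) blast
  define j where "j n = k (r1 (r2 n))" for n
  define e where "e n = d (r2 n)" for n
  define u where "u n = v (r1 (r2 n))" for n
  have e_pos: "e n > 0" for n using d_pos by (simp add: e_def)
  have e_lim: "e \<longlonglongrightarrow> 0" using LIMSEQ_subseq_LIMSEQ[OF d_lim r2(1)] by (simp add: e_def[abs_def] o_def)
  have j_dir: "(\<lambda>n. (1 / e n) *\<^sub>R (j n - 1)) \<longlonglongrightarrow> X" using r2(2) by (simp add: j_def e_def o_def)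
  have j_mem: "j n \<in> H" for n by (simp add: j_def k)
  have u_lim: "u \<longlonglongrightarrow> 0"
    using LIMSEQ_subseq_LIMSEQ[OF v_lim strict_mono_o[OF r1(1) r2(1)]] by (simp add: u_def[abs_def] o_def)
  have X_lie: "X \<in> lie H" by (rule lie_limit[OF j_mem e_pos e_lim j_dir])
  have jp_dir: "(\<lambda>n. (1 / e n) *\<^sub>R (j n \<cdot> p - p)) \<longlonglongrightarrow> X \<cdot> p"
    using act.tendsto[OF j_dir tendsto_const[of p]] by (simp add: act.scaleR_left act.diff_left)
  \<comment> \<open>Otherwise \<open>exp (- e n *\<^sub>R X)\<close> fixes \<open>p\<close>.
    Multiplying \<open>j n\<close> by it on the right keeps the coset but cancels the first-order
    part of \<open>j n - 1\<close>, leaving a distance o(\<open>e n\<close>) from 1, although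
    \<open>e n\<close> is the least distance in the coset.\<close>
  have "X \<cdot> p \<noteq> 0"
  proof
    assume Xp: "X \<cdot> p = 0"
    define c where "c n = exp ((- e n) *\<^sub>R X)" for n
    have c: "c n \<in> H" "c n \<cdot> p = p" for n
      by (simp_all only: c_def exp_mem[OF X_lie] exp_act_fixed[OF Xp])
    have "(\<lambda>n. - e n) \<longlonglongrightarrow> - 0" by (intro tendsto_intros e_lim)
    then have me: "(\<lambda>n. - e n) \<longlonglongrightarrow> 0" by simp
    have c_lim: "c \<longlonglongrightarrow> 1" using tendsto_exp_scaleR[OF me, of X] by (simp add: c_def[abs_def])
    have c_dir: "(\<lambda>n. (1 / - e n) *\<^sub>R (c n - 1)) \<longlonglongrightarrow> X"
      using has_vector_derivative_sequentially[OF exp_scaleR_has_vector_derivative_right[of X 0 UNIV] me] e_pos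
      by (simp add: c_def less_imp_neq[symmetric])
    have "(\<lambda>n. ((1 / e n) *\<^sub>R (j n - 1)) * c n - (1 / - e n) *\<^sub>R (c n - 1)) \<longlonglongrightarrow> X * 1 - X"
      by (intro tendsto_intros j_dir c_lim c_dir)
    then have "(\<lambda>n. norm (((1 / e n) *\<^sub>R (j n - 1)) * c n - (1 / - e n) *\<^sub>R (c n - 1))) \<longlonglongrightarrow> 0"
      by (simp add: tendsto_norm_zero)
    moreover have "norm (((1 / e n) *\<^sub>R (j n - 1)) * c n - (1 / - e n) *\<^sub>R (c n - 1)) \<ge> 1" for n
    proof -
      have "((1 / e n) *\<^sub>R (j n - 1)) * c n - (1 / - e n) *\<^sub>R (c n - 1) = (1 / e n) *\<^sub>R (j n * c n - 1)"
        by (simp add: algebra_simps)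
      moreover have "e n \<le> norm (j n * c n - 1)"
        unfolding e_def d_def j_def by (rule k_min) (auto simp: mult_mem k c)
      ultimately show ?thesis using e_pos[of n] by (simp only: norm_scaleR) (simp add: field_simps)
    qed
    ultimately have "(1 :: real) \<le> 0"
      using LIMSEQ_le_const by blast
    then show False by simp
  qed
  have crit1: "(X \<cdot> p) \<bullet> (p + u n) = 0" for n
    using v(1)[OF X_lie, of "r1 (r2 n)"] lie_skew[OF X_lie, of p p]
    by (simp add: u_def inner_add_right inner_commute)
  have crit2: "(X \<cdot> j n \<cdot> p) \<bullet> (p + u n) = 0" for n
  proof (rule inner_lie_eq_0[OF _ X_lie])
    fix g assume "g \<in> H"
    then show "(g \<cdot> j n \<cdot> p) \<bullet> (p + u n) \<le> (j n \<cdot> p) \<bullet> (p + u n)"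
      using k_max[OF mult_mem[OF _ j_mem], of g n "r1 (r2 n)"] by (simp add: j_def u_def)
  qed
  have "(X \<cdot> ((1 / e n) *\<^sub>R (j n \<cdot> p - p))) \<bullet> (p + u n) = 0" for n
    using crit1[of n] crit2[of n] by (simp add: act.diff_right act.scaleR_right inner_diff_left)
  moreover have "(\<lambda>n. (X \<cdot> ((1 / e n) *\<^sub>R (j n \<cdot> p - p))) \<bullet> (p + u n)) \<longlonglongrightarrow> (X \<cdot> X \<cdot> p) \<bullet> (p + 0)"
    by (intro tendsto_intros act.tendsto jp_dir u_lim)
  ultimately have "(X \<cdot> X \<cdot> p) \<bullet> p = 0" by (simp add: LIMSEQ_const_iff)
  then have "(X \<cdot> p) \<bullet> (X \<cdot> p) = 0" using lie_skew[OF X_lie, of "X \<cdot> p" p] by simp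
  then show False using \<open>X \<cdot> p \<noteq> 0\<close> by simp
qed

text \<open>If \<open>g\<close> fixes an interior point of the segment, \<open>g \<cdot> p\<close>
  and \<open>p\<close> have the same inner product with it. Replacing \<open>p\<close> by
  \<open>g \<cdot> p\<close> cannot increase the product with \<open>x\<close>, by
  \<open>max\<close>, nor that with \<open>p\<close>, by Cauchy-Schwarz. Equality with
  \<open>p\<close> forces \<open>g \<cdot> p = p\<close>, and then the end \<open>x\<close> is fixed
  as well.\<close>

lemma stab_segment:
  assumes max: "\<And>g. g \<in> H \<Longrightarrow> (g \<cdot> p) \<bullet> x \<le> p \<bullet> x" and t: "0 < t" "t < 1"
  shows "stab H ((1 - t) *\<^sub>R p + t *\<^sub>R x) = stab H p \<inter> stab H x"
proof
  show "stab H p \<inter> stab H x \<subseteq> stab H ((1 - t) *\<^sub>R p + t *\<^sub>R x)"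
    by (auto simp: stab_def act.add_right act.scaleR_right)
next
  show "stab H ((1 - t) *\<^sub>R p + t *\<^sub>R x) \<subseteq> stab H p \<inter> stab H x"
  proof
    fix g assume "g \<in> stab H ((1 - t) *\<^sub>R p + t *\<^sub>R x)"
    then have g: "g \<in> H" and gy: "g \<cdot> ((1 - t) *\<^sub>R p + t *\<^sub>R x) = (1 - t) *\<^sub>R p + t *\<^sub>R x"
      by (auto simp: stab_def)
    have "(g \<cdot> p) \<bullet> ((1 - t) *\<^sub>R p + t *\<^sub>R x) = p \<bullet> ((1 - t) *\<^sub>R p + t *\<^sub>R x)"
      using inner_act_eq[OF g, of p "(1 - t) *\<^sub>R p + t *\<^sub>R x"] gy by simp
    then have eq: "(1 - t) * (p \<bullet> p - (g \<cdot> p) \<bullet> p) = t * ((g \<cdot> p) \<bullet> x - p \<bullet> x)"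
      by (simp add: inner_add_right algebra_simps)
    also have "\<dots> \<le> 0" using max[OF g] t by (simp add: mult_le_0_iff)
    finally have "p \<bullet> p - (g \<cdot> p) \<bullet> p \<le> 0" using t by (simp add: mult_le_0_iff)
    moreover have "(norm (g \<cdot> p - p))\<^sup>2 = 2 * (p \<bullet> p - (g \<cdot> p) \<bullet> p)"
      using inner_act_eq[OF g, of p p]
      by (simp add: power2_norm_eq_inner inner_diff_left inner_diff_right inner_commute)
    moreover have "(norm (g \<cdot> p - p))\<^sup>2 \<ge> 0" by simp
    ultimately have gp: "g \<cdot> p = p" by simp
    with gy t have "g \<cdot> x = x" by (simp add: act.add_right act.scaleR_right)
    with gp g show "g \<in> stab H p \<inter> stab H x" by (simp add: stab_def)
  qed
qed

text \<open>\<open>p + v\<close> is the midpoint of \<open>p\<close> and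
  \<open>p + 2 *\<^sub>R v\<close>. For \<open>v\<close> of half the admissible size,
  \<open>p\<close> is a nearest orbit point to the latter, so \<open>stab_segment\<close>
  applies.\<close>

lemma stab_add_small:
  "\<exists>s>0. \<forall>v. (\<forall>X\<in>lie H. (X \<cdot> p) \<bullet> v = 0) \<and> norm v < s \<longrightarrow> stab H (p + v) = stab H p \<inter> stab H v"
proof -
  obtain s where s: "s > 0" "\<And>v g. (\<forall>X\<in>lie H. (X \<cdot> p) \<bullet> v = 0) \<Longrightarrow> norm v < s \<Longrightarrow> g \<in> H \<Longrightarrow>
     (g \<cdot> p) \<bullet> (p + v) \<le> p \<bullet> (p + v)"
    using small_normal_nearest by blast
  have "stab H (p + v) = stab H p \<inter> stab H v"
    if v: "\<forall>X\<in>lie H. (X \<cdot> p) \<bullet> v = 0" "norm v < s / 2" for v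
  proof -
    have "(g \<cdot> p) \<bullet> (p + 2 *\<^sub>R v) \<le> p \<bullet> (p + 2 *\<^sub>R v)" if "g \<in> H" for g
      using v by (intro s(2) that) auto
    moreover have "(1 - 1 / 2) *\<^sub>R p + (1 / 2) *\<^sub>R (p + 2 *\<^sub>R v) = p + v"
      by (rule euclidean_eqI) (simp add: inner_simps field_simps)
    ultimately have "stab H (p + v) = stab H p \<inter> stab H (p + 2 *\<^sub>R v)"
      using stab_segment[of p "p + 2 *\<^sub>R v" "1 / 2"] by simp
    also have "\<dots> = stab H p \<inter> stab H v"
      by (auto simp: stab_def act.add_right act.scaleR_right)
    finally show ?thesis .
  qed
  then show ?thesis using s(1) by (intro exI[of _ "s / 2"]) auto
qed

text \<open>By compactness some \<open>g \<cdot> y\<close> is nearest to \<open>p\<close> in the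
  orbit of \<open>y\<close>. Passing \<open>h\<close> to the other side of the inner product shows
  that \<open>p\<close> is then also nearest to \<open>g \<cdot> y\<close> in its own orbit.\<close>

lemma nearest_exists: "\<exists>g\<in>H. \<forall>h\<in>H. (h \<cdot> p) \<bullet> (g \<cdot> y) \<le> p \<bullet> (g \<cdot> y)"
proof -
  have "continuous_on H (\<lambda>g. p \<bullet> (g \<cdot> y))"
    by (intro continuous_intros act.continuous_on)
  then obtain g where g: "g \<in> H" "\<And>h. h \<in> H \<Longrightarrow> p \<bullet> (h \<cdot> y) \<le> p \<bullet> (g \<cdot> y)"
    using continuous_attains_sup[OF compact] one_mem by blast
  have "(h \<cdot> p) \<bullet> (g \<cdot> y) \<le> p \<bullet> (g \<cdot> y)" if h: "h \<in> H" for h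
  proof -
    obtain h' where h': "h' \<in> H" "\<And>x y. (h \<cdot> x) \<bullet> y = x \<bullet> (h' \<cdot> y)"
      using obtain_inverse[OF h] by metis
    then show ?thesis using g(2)[OF mult_mem[OF h'(1) g(1)]] by simp
  qed
  with g show ?thesis by blast
qed

lemma stab_move_subset:
  assumes "stab H p \<subseteq> stab H x" "g \<in> H" shows "stab H (g \<cdot> p) \<subseteq> stab H (g \<cdot> x)"
proof
  fix h assume h: "h \<in> stab H (g \<cdot> p)"
  obtain g' where g': "g' \<in> H" "\<And>x. g \<cdot> g' \<cdot> x = x" "\<And>x. g' \<cdot> g \<cdot> x = x"
    using obtain_inverse[OF assms(2)] by metis
  have "g' * h * g \<in> stab H p"
    using h g' assms(2) by (auto simp: stab_def mult_mem)
  then have "g' \<cdot> h \<cdot> g \<cdot> x = x" using assms(1) by (auto simp: stab_def)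
  then have "h \<cdot> g \<cdot> x = g \<cdot> x" using g'(2) by metis
  with h show "h \<in> stab H (g \<cdot> x)" by (simp add: stab_def)
qed

lemma dim_act_image: "g \<in> H \<Longrightarrow> dim ((\<cdot>) g ` S) = dim S"
proof (rule dim_image_eq[OF linear_act])
  assume "g \<in> H"
  then show "inj_on ((\<cdot>) g) (span S)" by (metis inj_onI obtain_inverse)
qed

end

section \<open>Regular points\<close>

lemma (in ortho_group) lie_act_mem:
  assumes "X \<in> lie H" "subspace W" "p \<in> W" "\<And>g x. g \<in> H \<Longrightarrow> x \<in> W \<Longrightarrow> g \<cdot> x \<in> W"
  shows "X \<cdot> p \<in> W"
  using has_vector_derivative_mem_subspace[OF exp_act_has_vector_derivative[of X p 0] assms(2) zero_less_one]
    exp_mem[OF assms(1)] assms(3,4) by simp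

locale ortho_action = ortho_group H for H :: "'v::euclidean_space endo set" +
  fixes V :: "'v set"
  assumes subspace_V: "subspace V" and act_mem: "g \<in> H \<Longrightarrow> x \<in> V \<Longrightarrow> g \<cdot> x \<in> V"
begin

lemma subspace_nrm: "subspace (nrm H V p)"
  by (rule subspaceI)
     (auto simp: nrm_def inner_add_right subspace_0[OF subspace_V] intro: subspace_add[OF subspace_V] subspace_scale[OF subspace_V])

lemma nrm_subset: "nrm H V p \<subseteq> V"
  by (auto simp: nrm_def)

text \<open>A consequence of skewness; it allows nearest-point arguments to exchange the two
  points.\<close>

lemma nrm_sym:
  assumes "p \<in> V" "q \<in> nrm H V p" shows "p \<in> nrm H V q"
proof -
  have "(X \<cdot> q) \<bullet> p = 0" if X: "X \<in> lie H" for X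
  proof -
    have "(X \<cdot> q) \<bullet> p = - ((X \<cdot> p) \<bullet> q)" using lie_skew[OF X, of q p] by (simp only: inner_commute)
    also have "\<dots> = 0" using assms(2) X by (simp add: nrm_def)
    finally show ?thesis .
  qed
  with assms(1) show ?thesis by (simp add: nrm_def)
qed

lemma self_nrm:
  assumes "p \<in> V" shows "p \<in> nrm H V p"
proof -
  have "(X \<cdot> p) \<bullet> p = 0" if "X \<in> lie H" for X
    using lie_skew[OF that, of p p] inner_commute[of p "X \<cdot> p"] by simp
  with assms show ?thesis by (simp add: nrm_def)
qed

lemma nearest_nrm:
  "x \<in> V \<Longrightarrow> (\<And>g. g \<in> H \<Longrightarrow> (g \<cdot> p) \<bullet> x \<le> p \<bullet> x) \<Longrightarrow> x \<in> nrm H V p"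
  using inner_lie_eq_0 by (auto simp: nrm_def)

lemma normal_decomposition:
  assumes "p \<in> V" "x \<in> V"
  obtains X w where "X \<in> lie H" "w \<in> nrm H V p" "x = X \<cdot> p + w"
proof -
  let ?T = "(\<lambda>X. X \<cdot> p) ` lie H"
  obtain y z where yz: "y \<in> span ?T" "\<And>w. w \<in> span ?T \<Longrightarrow> orthogonal z w" "x = y + z"
    using orthogonal_subspace_decomp_exists by blast
  from yz(1) obtain X where X: "X \<in> lie H" "y = X \<cdot> p"
    using span_eq_iff[THEN iffD2, OF subspace_lie_act] by auto
  have "X \<cdot> p \<in> V" using lie_act_mem[OF X(1) subspace_V assms(1) act_mem] .
  then have "z \<in> V" using yz(3) X(2) subspace_diff[OF subspace_V assms(2)] by force
  moreover have "(Y \<cdot> p) \<bullet> z = 0" if "Y \<in> lie H" for Y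
    using yz(2)[of "Y \<cdot> p"] that by (auto intro: span_base simp: orthogonal_def inner_commute)
  ultimately have "z \<in> nrm H V p" by (simp add: nrm_def)
  with X yz(3) that show ?thesis by blast
qed

lemma dim_nrm:
  assumes "p \<in> V"
  shows "dim (nrm H V p) + dim ((\<lambda>X. X \<cdot> p) ` lie H) = dim V"
proof -
  have "nrm H V p = {y \<in> V. \<forall>x\<in>(\<lambda>X. X \<cdot> p) ` lie H. orthogonal x y}"
    by (auto simp: nrm_def orthogonal_def)
  moreover have "(\<lambda>X. X \<cdot> p) ` lie H \<subseteq> V"
    using lie_act_mem[OF _ subspace_V assms act_mem] by blast
  ultimately show ?thesis
    using dim_subspace_orthogonal_to_vectors[OF subspace_lie_act subspace_V] by simp
qed

text \<open>For a small multiple \<open>c *\<^sub>R w\<close>, \<open>p\<close> is an orbit point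
  nearest to \<open>p + c *\<^sub>R w\<close>. Isometries in the group carry this to
  \<open>g \<cdot> p\<close>, and nearest points yield normal vectors by
  \<open>nearest_nrm\<close>.\<close>

lemma nrm_move:
  assumes p: "p \<in> V" and w: "w \<in> nrm H V p" and g: "g \<in> H"
  shows "g \<cdot> w \<in> nrm H V (g \<cdot> p)"
proof -
  obtain s where s: "s > 0" "\<And>v h. (\<forall>X\<in>lie H. (X \<cdot> p) \<bullet> v = 0) \<Longrightarrow> norm v < s \<Longrightarrow> h \<in> H \<Longrightarrow>
     (h \<cdot> p) \<bullet> (p + v) \<le> p \<bullet> (p + v)"
    using small_normal_nearest by blast
  obtain g' where g': "g' \<in> H" "\<And>x. g \<cdot> g' \<cdot> x = x" "\<And>x. g' \<cdot> g \<cdot> x = x"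
    using obtain_inverse[OF g] by metis
  \<comment> \<open>The summand 1 covers \<open>w = 0\<close> and makes the bound
    \<open>norm (c *\<^sub>R w) < s\<close> strict.\<close>
  define c where "c = s / (norm w + 1)"
  have c: "c > 0" using s(1) by (simp add: c_def add_nonneg_pos)
  have "norm (c *\<^sub>R w) = s * (norm w / (norm w + 1))" using s(1) by (simp add: c_def)
  also have "\<dots> < s * 1" using s(1) by (intro mult_strict_left_mono) (auto simp: add_nonneg_pos)
  finally have "norm (c *\<^sub>R w) < s" by simp
  moreover have "\<forall>X\<in>lie H. (X \<cdot> p) \<bullet> (c *\<^sub>R w) = 0" using w by (simp add: nrm_def)
  ultimately have near: "(h \<cdot> p) \<bullet> (p + c *\<^sub>R w) \<le> p \<bullet> (p + c *\<^sub>R w)" if "h \<in> H" for h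
    using s(2) that by blast
  have "g \<cdot> (p + c *\<^sub>R w) \<in> nrm H V (g \<cdot> p)"
  proof (rule nearest_nrm)
    show "g \<cdot> (p + c *\<^sub>R w) \<in> V"
      using g p w nrm_subset subspace_V by (intro act_mem) (auto intro!: subspace_add subspace_scale)
    fix h assume h: "h \<in> H"
    have "(h \<cdot> g \<cdot> p) \<bullet> (g \<cdot> (p + c *\<^sub>R w)) = ((g' * h * g) \<cdot> p) \<bullet> (p + c *\<^sub>R w)"
      using inner_act_eq[OF g'(1), of "h \<cdot> g \<cdot> p" "g \<cdot> (p + c *\<^sub>R w)"] g'(3) by simp
    also have "\<dots> \<le> p \<bullet> (p + c *\<^sub>R w)" by (intro near mult_mem g' h g)
    also have "\<dots> = (g \<cdot> p) \<bullet> (g \<cdot> (p + c *\<^sub>R w))" by (simp only: inner_act_eq[OF g])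
    finally show "(h \<cdot> g \<cdot> p) \<bullet> (g \<cdot> (p + c *\<^sub>R w)) \<le> (g \<cdot> p) \<bullet> (g \<cdot> (p + c *\<^sub>R w))" .
  qed
  from subspace_diff[OF subspace_nrm this self_nrm[OF act_mem[OF g p]]]
  have "c *\<^sub>R (g \<cdot> w) \<in> nrm H V (g \<cdot> p)" by (simp add: act.add_right act.scaleR_right)
  from subspace_scale[OF subspace_nrm this, of "1 / c"] show ?thesis using c by simp
qed

lemma nrm_move_eq:
  assumes p: "p \<in> V" and g: "g \<in> H"
  shows "nrm H V (g \<cdot> p) = (\<cdot>) g ` nrm H V p"
proof
  obtain g' where g': "g' \<in> H" "\<And>x. g \<cdot> g' \<cdot> x = x" "\<And>x. g' \<cdot> g \<cdot> x = x"
    using obtain_inverse[OF g] by metis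
  show "nrm H V (g \<cdot> p) \<subseteq> (\<cdot>) g ` nrm H V p"
  proof
    fix w assume "w \<in> nrm H V (g \<cdot> p)"
    from nrm_move[OF act_mem[OF g p] this g'(1)] have "g' \<cdot> w \<in> nrm H V p" by (simp add: g')
    then show "w \<in> (\<cdot>) g ` nrm H V p" using g'(2)[of w] by (metis image_eqI)
  qed
qed (use nrm_move assms in auto)

lemma stab_add_nrm_small:
  "\<exists>s>0. \<forall>v\<in>nrm H V p. norm v < s \<longrightarrow> stab H (p + v) = stab H p \<inter> stab H v"
  using stab_add_small[of p] by (auto simp: nrm_def)

text \<open>Its dimension is an integer measure of how small an isotropy group is: a smaller group
  has a larger fixed space.\<close>

definition fixed_space :: "'v \<Rightarrow> 'v set" where
  "fixed_space p = {x \<in> V. \<forall>g\<in>stab H p. g \<cdot> x = x}"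

lemma subspace_fixed_space: "subspace (fixed_space p)"
  using subspace_V by (auto simp: subspace_def fixed_space_def act.add_right act.scaleR_right act.zero_right)

lemma fixed_space_move:
  assumes g: "g \<in> H" shows "dim (fixed_space p) \<le> dim (fixed_space (g \<cdot> p))"
proof -
  obtain g' where g': "g' \<in> H" "\<And>x. g \<cdot> g' \<cdot> x = x" "\<And>x. g' \<cdot> g \<cdot> x = x"
    using obtain_inverse[OF g] by metis
  have "(\<cdot>) g ` fixed_space p \<subseteq> fixed_space (g \<cdot> p)"
  proof
    fix y assume "y \<in> (\<cdot>) g ` fixed_space p"
    then obtain x where x: "x \<in> V" "\<And>h. h \<in> stab H p \<Longrightarrow> h \<cdot> x = x" "y = g \<cdot> x"
      by (auto simp: fixed_space_def)
    have "h \<cdot> y = y" if "h \<in> stab H (g \<cdot> p)" for h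
    proof -
      have "g' * h * g \<in> stab H p" using that g g' by (auto simp: stab_def mult_mem)
      from x(2)[OF this] have "g \<cdot> g' \<cdot> h \<cdot> g \<cdot> x = g \<cdot> x" by simp
      then show ?thesis using g'(2) x(3) by simp
    qed
    then show "y \<in> fixed_space (g \<cdot> p)" using x g by (simp add: fixed_space_def act_mem)
  qed
  then show ?thesis using dim_subset dim_act_image[OF g] by metis
qed

text \<open>The fixed spaces are nested, so the dimension bound makes them equal; \<open>x\<close>
  belongs to its own fixed space, hence to that of \<open>p\<close>.\<close>

lemma stab_subset_if_dim:
  assumes "p \<in> V" "x \<in> V" "stab H x \<subseteq> stab H p" "dim (fixed_space x) \<le> dim (fixed_space p)"
  shows "stab H p \<subseteq> stab H x"
proof -
  have "fixed_space p \<subseteq> fixed_space x" using assms(3) by (auto simp: fixed_space_def)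
  then have "fixed_space p = fixed_space x"
    by (rule subspace_dim_equal[OF subspace_fixed_space subspace_fixed_space]) (fact assms)
  moreover have "x \<in> fixed_space x" using assms(2) by (auto simp: fixed_space_def stab_def)
  ultimately show ?thesis by (auto simp: fixed_space_def stab_def)
qed

text \<open>
  Moving \<open>y\<close> to the orbit point nearest to \<open>p\<close>, the midpoint of \<open>p\<close> and \<open>y\<close> has isotropy group
  \<open>stab H p \<inter> stab H y\<close>, so a point whose isotropy group fixes as much as possible is regular.
\<close>

lemma reg_exists: "\<exists>p. reg H V p"
proof -
  have "\<exists>p. p \<in> V \<and> (\<forall>x. x \<in> V \<longrightarrow> dim (fixed_space x) \<le> dim (fixed_space p))"
    by (rule ex_has_greatest_nat[of _ 0 _ "Suc DIM('v)"])
       (auto simp: subspace_0[OF subspace_V] less_Suc_eq_le dim_subset_UNIV)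
  then obtain p where p: "p \<in> V" "\<And>x. x \<in> V \<Longrightarrow> dim (fixed_space x) \<le> dim (fixed_space p)"
    by blast
  have "\<exists>g\<in>H. stab H (g \<cdot> p) \<subseteq> stab H y" if y: "y \<in> V" for y
  proof -
    obtain g where g: "g \<in> H" "\<And>h. h \<in> H \<Longrightarrow> (h \<cdot> p) \<bullet> (g \<cdot> y) \<le> p \<bullet> (g \<cdot> y)"
      using nearest_exists by blast
    let ?m = "(1 - 1 / 2) *\<^sub>R p + (1 / 2) *\<^sub>R (g \<cdot> y)"
    have m: "stab H ?m = stab H p \<inter> stab H (g \<cdot> y)"
      using g(2) by (rule stab_segment) auto
    have mV: "?m \<in> V"
      by (intro subspace_add[OF subspace_V] subspace_scale[OF subspace_V] p(1) act_mem g(1) y)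
    have "stab H p \<subseteq> stab H ?m"
      by (rule stab_subset_if_dim[OF p(1) mV _ p(2)[OF mV]]) (unfold m, blast)
    then have *: "stab H p \<subseteq> stab H (g \<cdot> y)" unfolding m by blast
    obtain g' where g': "g' \<in> H" "\<And>x. g' \<cdot> g \<cdot> x = x"
      using obtain_inverse[OF g(1)] by metis
    from stab_move_subset[OF * g'(1)] show ?thesis using g' by auto
  qed
  with p show ?thesis by (auto simp: reg_def)
qed

lemma reg_mem: "reg H V p \<Longrightarrow> p \<in> V"
  by (simp add: reg_def)

lemma reg_move:
  assumes "reg H V p" "g \<in> H" shows "reg H V (g \<cdot> p)"
  unfolding reg_def
proof (intro conjI ballI)
  show "g \<cdot> p \<in> V" using assms act_mem by (simp add: reg_def)
  fix x assume "x \<in> V"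
  then obtain h where h: "h \<in> H" "stab H (h \<cdot> p) \<subseteq> stab H x" using assms by (auto simp: reg_def)
  obtain g' where g': "g' \<in> H" "\<And>x. g' \<cdot> g \<cdot> x = x"
    using obtain_inverse[OF assms(2)] by metis
  show "\<exists>h\<in>H. stab H (h \<cdot> g \<cdot> p) \<subseteq> stab H x"
    using h g' mult_mem by (intro bexI[of _ "h * g'"]) auto
qed

lemma reg_move_iff: "g \<in> H \<Longrightarrow> p \<in> V \<Longrightarrow> reg H V (g \<cdot> p) \<longleftrightarrow> reg H V p"
  by (metis obtain_inverse reg_move)

text \<open>\<open>stab H x\<close> lies between a conjugate of \<open>stab H p\<close> and
  \<open>stab H p\<close> itself. Conjugation does not change the dimension of the fixed space, so
  \<open>stab_subset_if_dim\<close> turns the inclusion into an equality.\<close>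

lemma reg_stab_subset:
  assumes p: "reg H V p" and x: "x \<in> V" "stab H x \<subseteq> stab H p"
  shows "reg H V x" "stab H x = stab H p"
proof -
  obtain g where g: "g \<in> H" "stab H (g \<cdot> p) \<subseteq> stab H x" using p x by (auto simp: reg_def)
  have V: "p \<in> V" "g \<cdot> p \<in> V" using p g act_mem by (auto simp: reg_def)
  obtain g' where g': "g' \<in> H" "\<And>x. g' \<cdot> g \<cdot> x = x" using obtain_inverse[OF g(1)] by metis
  have "fixed_space x \<subseteq> fixed_space (g \<cdot> p)" using g(2) by (auto simp: fixed_space_def)
  then have "dim (fixed_space x) \<le> dim (fixed_space (g \<cdot> p))" by (rule dim_subset)
  also have "\<dots> \<le> dim (fixed_space p)" using fixed_space_move[OF g'(1), of "g \<cdot> p"] g'(2) by simp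
  finally show eq: "stab H x = stab H p"
    using stab_subset_if_dim[OF V(1) x(1)] x(2) by blast
  show "reg H V x"
    unfolding reg_def
  proof (intro conjI ballI)
    fix y assume "y \<in> V"
    then obtain h where "h \<in> H" "stab H (h \<cdot> p) \<subseteq> stab H y" using p by (auto simp: reg_def)
    with stab_move_subset[of x p h] eq show "\<exists>h\<in>H. stab H (h \<cdot> x) \<subseteq> stab H y" by blast
  qed fact
qed

text \<open>Replace \<open>x\<close> by the point \<open>g \<cdot> x\<close> of its orbit nearest to
  \<open>p\<close>. The difference \<open>g \<cdot> x - p\<close> is normal at \<open>p\<close> and
  no longer than \<open>x - p\<close>, so the isotropy group of \<open>g \<cdot> x\<close> lies in
  \<open>stab H p\<close>.\<close>

lemma reg_open:
  assumes p: "reg H V p"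
  shows "\<exists>e>0. \<forall>x\<in>V. norm (x - p) < e \<longrightarrow> reg H V x"
proof -
  obtain s where s: "s > 0" "\<And>v. v \<in> nrm H V p \<Longrightarrow> norm v < s \<Longrightarrow> stab H (p + v) = stab H p \<inter> stab H v"
    using stab_add_nrm_small by blast
  have "reg H V x" if x: "x \<in> V" "norm (x - p) < s" for x
  proof -
    obtain g where g: "g \<in> H" "\<And>h. h \<in> H \<Longrightarrow> (h \<cdot> p) \<bullet> (g \<cdot> x) \<le> p \<bullet> (g \<cdot> x)"
      using nearest_exists by blast
    have gx: "g \<cdot> x \<in> V" by (rule act_mem[OF g(1) x(1)])
    have "g \<cdot> x - p \<in> nrm H V p"
      using nearest_nrm[OF gx g(2)] self_nrm[OF reg_mem[OF p]] subspace_diff[OF subspace_nrm] by blast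
    moreover have "norm (g \<cdot> x - p) \<le> norm (x - p)"
    proof (rule power2_le_imp_le)
      have "x \<bullet> p \<le> (g \<cdot> x) \<bullet> p"
        using g(2)[OF g(1)] inner_act_eq[OF g(1), of p x] by (simp add: inner_commute)
      then show "(norm (g \<cdot> x - p))\<^sup>2 \<le> (norm (x - p))\<^sup>2"
        unfolding power2_norm_diff by (simp add: inner_act_eq[OF g(1)])
    qed simp
    ultimately have "stab H (p + (g \<cdot> x - p)) = stab H p \<inter> stab H (g \<cdot> x - p)"
      using x by (intro s(2)) auto
    then have "stab H (g \<cdot> x) \<subseteq> stab H p" by simp
    from reg_stab_subset(1)[OF p gx this] show ?thesis
      using reg_move_iff[OF g(1) x(1)] by simp
  qed
  then show ?thesis using s(1) by blast
qed

text \<open>A linear choice of a Lie algebra element for each tangent vector of the orbit, fixed on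
  a basis and extended arbitrarily outside the tangent space. It serves for comparing dimensions of
  orbits and for a uniform bound in \<open>slice_small\<close>.\<close>

lemma lie_act_lift:
  "\<exists>f. linear f \<and> (\<forall>X\<in>lie H. f (X \<cdot> p) \<in> lie H \<and> f (X \<cdot> p) \<cdot> p = X \<cdot> p)"
proof -
  let ?T = "(\<lambda>X. X \<cdot> p) ` lie H"
  obtain B where B: "B \<subseteq> ?T" "independent B" "?T \<subseteq> span B"
    using maximal_independent_subset[of ?T] by blast
  then have "\<forall>b\<in>B. \<exists>X\<in>lie H. X \<cdot> p = b" by auto
  then obtain \<xi> where \<xi>: "\<And>b. b \<in> B \<Longrightarrow> \<xi> b \<in> lie H \<and> \<xi> b \<cdot> p = b" by metis
  obtain f where f: "linear f" "\<And>b. b \<in> B \<Longrightarrow> f b = \<xi> b"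
    using linear_independent_extend[OF B(2), of \<xi>] by auto
  let ?S = "{y. f y \<in> lie H \<and> f y \<cdot> p = y}"
  have "subspace ?S"
    by (rule subspaceI)
       (auto simp: linear_0[OF f(1)] linear_add[OF f(1)] linear_scale[OF f(1)] act.add_left
         act.scaleR_left act.zero_left subspace_0[OF subspace_lie]
         intro: subspace_add[OF subspace_lie] subspace_scale[OF subspace_lie])
  moreover have "B \<subseteq> ?S" using \<xi> f(2) by auto
  ultimately have "span B \<subseteq> ?S" by (rule span_minimal[rotated])
  with B(3) f(1) show ?thesis by blast
qed

text \<open>By hypothesis \<open>X \<cdot> p'\<close> depends only on \<open>X \<cdot> p\<close>;
  through the lift the tangent space at \<open>p'\<close> is a linear image of the one at
  \<open>p\<close>.\<close>

lemma dim_lie_act_le: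
  assumes "\<And>X. X \<in> lie H \<Longrightarrow> X \<cdot> p = 0 \<Longrightarrow> X \<cdot> p' = 0"
  shows "dim ((\<lambda>X. X \<cdot> p') ` lie H) \<le> dim ((\<lambda>X. X \<cdot> p) ` lie H)"
proof -
  obtain f where f: "linear f" "\<And>X. X \<in> lie H \<Longrightarrow> f (X \<cdot> p) \<in> lie H \<and> f (X \<cdot> p) \<cdot> p = X \<cdot> p"
    using lie_act_lift by metis
  have lin: "linear (\<lambda>y. f y \<cdot> p')"
    using linear_compose[OF f(1) bounded_linear.linear[OF act.bounded_linear_left]] by (simp add: o_def)
  have "X \<cdot> p' = f (X \<cdot> p) \<cdot> p'" if X: "X \<in> lie H" for X
  proof -
    have "(X - f (X \<cdot> p)) \<cdot> p' = 0"
      using f(2)[OF X] X by (intro assms subspace_diff[OF subspace_lie]) (auto simp: act.diff_left)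
    then show ?thesis by (simp add: act.diff_left)
  qed
  then have "(\<lambda>X. X \<cdot> p') ` lie H = (\<lambda>y. f y \<cdot> p') ` (\<lambda>X. X \<cdot> p) ` lie H"
    by (auto simp: image_image)
  then show ?thesis using dim_image_le[OF lin] by simp
qed

lemma lie_stab_iff: "X \<in> lie (stab H q) \<longleftrightarrow> X \<in> lie H \<and> X \<cdot> q = 0"
proof
  assume "X \<in> lie H \<and> X \<cdot> q = 0"
  then show "X \<in> lie (stab H q)" using exp_act_fixed by (auto simp: lie_def stab_def)
next
  assume X: "X \<in> lie (stab H q)"
  then have "(\<lambda>t. exp (t *\<^sub>R X) \<cdot> q) = (\<lambda>t. q)" by (auto simp: lie_def stab_def)
  with exp_act_has_vector_derivative[of X q 0] have "((\<lambda>t::real. q) has_vector_derivative X \<cdot> q) (at 0)"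
    by simp
  then have "X \<cdot> q = 0" using has_vector_derivative_const vector_derivative_unique_at by blast
  with X show "X \<in> lie H \<and> X \<cdot> q = 0" by (auto simp: lie_def stab_def)
qed

text \<open>Lie algebra elements killing \<open>p\<close> generate isotropy of \<open>p\<close>,
  hence also of \<open>x\<close>, so the tangent space at \<open>x\<close> is no larger than the one
  at \<open>p\<close>.\<close>

lemma dim_nrm_stab_mono:
  assumes "p \<in> V" "x \<in> V" "stab H p \<subseteq> stab H x"
  shows "dim (nrm H V p) \<le> dim (nrm H V x)"
proof -
  have "X \<cdot> x = 0" if "X \<in> lie H" "X \<cdot> p = 0" for X
  proof -
    have "X \<in> lie (stab H p)" using that by (simp add: lie_stab_iff)
    then have "X \<in> lie (stab H x)" using assms(3) by (auto simp: lie_def)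
    then show ?thesis by (simp add: lie_stab_iff)
  qed
  from dim_lie_act_le[of p x, OF this] show ?thesis
    using dim_nrm[OF assms(1)] dim_nrm[OF assms(2)] by simp
qed

lemma reg_dim_nrm_le:
  assumes p: "reg H V p" and x: "x \<in> V"
  shows "dim (nrm H V p) \<le> dim (nrm H V x)"
proof -
  obtain g where g: "g \<in> H" "stab H (g \<cdot> p) \<subseteq> stab H x" using p x by (auto simp: reg_def)
  have V: "p \<in> V" "g \<cdot> p \<in> V" using p g act_mem by (auto simp: reg_def)
  have "dim (nrm H V p) = dim (nrm H V (g \<cdot> p))"
    by (simp add: nrm_move_eq[OF V(1) g(1)] dim_act_image[OF g(1)])
  also have "\<dots> \<le> dim (nrm H V x)" by (rule dim_nrm_stab_mono[OF V(2) x g(2)])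
  finally show ?thesis .
qed

lemma reg_dim_nrm_eq: "reg H V p \<Longrightarrow> reg H V x \<Longrightarrow> dim (nrm H V p) = dim (nrm H V x)"
  using reg_dim_nrm_le reg_mem by (simp add: eq_iff)

end

section \<open>Linear sections\<close>

text \<open>The form that \<open>k_section\<close> takes for linear subspaces, see
  \<open>k_section_iff\<close>. Meeting every orbit is replaced by containing one regular point;
  \<open>orbit_meets\<close> recovers the rest.\<close>

definition sec :: "'v::euclidean_space endo set \<Rightarrow> 'v set \<Rightarrow> nat \<Rightarrow> 'v set \<Rightarrow> bool" where
  "sec H V k S \<longleftrightarrow> subspace S \<and> S \<subseteq> V \<and> (\<exists>p\<in>S. reg H V p) \<and>
     (\<forall>p\<in>S. reg H V p \<longrightarrow> nrm H V p \<subseteq> S \<and> dim S = dim (nrm H V p) + k) \<and>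
     (\<forall>p\<in>S. reg H V p \<longrightarrow> (\<forall>g\<in>H. g \<cdot> p \<in> S \<longrightarrow> (\<cdot>) g ` S = S))"

lemma linear_image_eq_if_subset:
  fixes f :: "'a::euclidean_space \<Rightarrow> 'a"
  assumes "linear f" "inj f" "subspace S" "f ` S \<subseteq> S" shows "f ` S = S"
proof (rule subspace_dim_equal)
  show "subspace (f ` S)" by (rule linear_subspace_image) fact+
  show "dim S \<le> dim (f ` S)"
    using dim_image_eq[OF assms(1), of S] assms(2) by (simp add: inj_on_subset[OF _ subset_UNIV])
qed fact+

lemma (in ortho_group) inj_act: "g \<in> H \<Longrightarrow> inj ((\<cdot>) g)"
  by (metis injI obtain_inverse)

context ortho_action
begin

text \<open>The point of the orbit of \<open>x\<close> nearest to \<open>p\<close> is normal to the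
  orbit of \<open>p\<close>.\<close>

lemma orbit_meets:
  assumes p: "p \<in> V" "nrm H V p \<subseteq> S" and x: "x \<in> V"
  shows "\<exists>g\<in>H. g \<cdot> x \<in> S"
proof -
  obtain g where g: "g \<in> H" "\<And>h. h \<in> H \<Longrightarrow> (h \<cdot> p) \<bullet> (g \<cdot> x) \<le> p \<bullet> (g \<cdot> x)"
    using nearest_exists by blast
  then have "g \<cdot> x \<in> nrm H V p" by (intro nearest_nrm act_mem x) auto
  with g p show ?thesis by blast
qed

text \<open>Normal spaces at regular points all have the same dimension, so one codimension serves
  everywhere. The subtraction is not truncated, because these spaces lie in
  \<open>S\<close>.\<close>

lemma secI:
  assumes "subspace S" "S \<subseteq> V" "p \<in> S" "reg H V p"
    and "\<And>x. x \<in> S \<Longrightarrow> reg H V x \<Longrightarrow> nrm H V x \<subseteq> S"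
    and "\<And>x g. x \<in> S \<Longrightarrow> reg H V x \<Longrightarrow> g \<in> H \<Longrightarrow> g \<cdot> x \<in> S \<Longrightarrow> (\<cdot>) g ` S = S"
  shows "sec H V (dim S - dim (nrm H V p)) S"
  unfolding sec_def
proof (intro conjI ballI impI)
  fix x assume x: "x \<in> S" "reg H V x"
  then have "dim (nrm H V x) \<le> dim S" by (intro dim_subset assms)
  then show "dim S = dim (nrm H V x) + (dim S - dim (nrm H V p))"
    using reg_dim_nrm_eq[OF x(2) assms(4)] by simp
qed (use assms in auto)

lemma secD:
  assumes "sec H V k S"
  shows "subspace S" "S \<subseteq> V" "\<exists>p\<in>S. reg H V p"
    "\<And>p. p \<in> S \<Longrightarrow> reg H V p \<Longrightarrow> nrm H V p \<subseteq> S"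
    "\<And>p. p \<in> S \<Longrightarrow> reg H V p \<Longrightarrow> dim S = dim (nrm H V p) + k"
    "\<And>p g. p \<in> S \<Longrightarrow> reg H V p \<Longrightarrow> g \<in> H \<Longrightarrow> g \<cdot> p \<in> S \<Longrightarrow> (\<cdot>) g ` S = S"
  using assms by (auto simp: sec_def)

lemma sec_exists: "\<exists>k. sec H V k V"
proof -
  obtain p where p: "reg H V p" using reg_exists by blast
  have "(\<cdot>) g ` V = V" if "g \<in> H" for g
    by (rule linear_image_eq_if_subset[OF linear_act inj_act[OF that] subspace_V])
       (use act_mem that in auto)
  then show ?thesis
    using secI[OF subspace_V order_refl reg_mem[OF p] p] nrm_subset by blast
qed

text \<open>The shared point \<open>p\<close> supplies the regular point of the intersection; the
  remaining conditions pass to intersections, the last one by injectivity of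
  \<open>g\<close>.\<close>

lemma sec_Int:
  assumes "sec H V k S" "sec H V l T" "p \<in> S" "p \<in> T" "reg H V p"
  shows "\<exists>m. sec H V m (S \<inter> T)"
proof (rule exI, rule secI[OF _ _ _ assms(5)])
  show "subspace (S \<inter> T)"
    by (rule subspace_inter[OF secD(1)[OF assms(1)] secD(1)[OF assms(2)]])
  show "S \<inter> T \<subseteq> V" using secD(2)[OF assms(1)] by blast
  show "p \<in> S \<inter> T" using assms(3,4) by blast
  show "nrm H V x \<subseteq> S \<inter> T" if "x \<in> S \<inter> T" "reg H V x" for x
    using secD(4)[OF assms(1) _ that(2)] secD(4)[OF assms(2) _ that(2)] that(1) by simp
  fix x g assume x: "x \<in> S \<inter> T" "reg H V x" "g \<in> H" "g \<cdot> x \<in> S \<inter> T"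
  then have "(\<cdot>) g ` S = S" "(\<cdot>) g ` T = T"
    using secD(6)[OF assms(1) _ x(2,3)] secD(6)[OF assms(2) _ x(2,3)] by auto
  then show "(\<cdot>) g ` (S \<inter> T) = S \<inter> T" by (simp add: image_Int[OF inj_act[OF x(3)]])
qed

lemma sec_move:
  assumes S: "sec H V k S" and g: "g \<in> H"
  shows "sec H V k ((\<cdot>) g ` S)"
proof -
  note S' = secD[OF S]
  obtain g' where g': "g' \<in> H" "\<And>x. g \<cdot> g' \<cdot> x = x" "\<And>x. g' \<cdot> g \<cdot> x = x"
    using obtain_inverse[OF g] by metis
  have reg_eq: "reg H V (g \<cdot> x) \<longleftrightarrow> reg H V x" if "x \<in> S" for x
    using reg_move_iff[OF g] S'(2) that by blast
  show ?thesis
    unfolding sec_def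
  proof (intro conjI)
    show "subspace ((\<cdot>) g ` S)" by (rule linear_subspace_image[OF linear_act S'(1)])
    show "(\<cdot>) g ` S \<subseteq> V" using act_mem g S'(2) by blast
    show "\<exists>p\<in>(\<cdot>) g ` S. reg H V p" using S'(3) reg_eq by blast
    show "\<forall>p\<in>(\<cdot>) g ` S. reg H V p \<longrightarrow>
        nrm H V p \<subseteq> (\<cdot>) g ` S \<and> dim ((\<cdot>) g ` S) = dim (nrm H V p) + k"
    proof (intro ballI impI)
      fix y assume "y \<in> (\<cdot>) g ` S" "reg H V y"
      then obtain x where x: "x \<in> S" "y = g \<cdot> x" "reg H V x" using reg_eq by blast
      have "x \<in> V" using x S'(2) by blast
      then show "nrm H V y \<subseteq> (\<cdot>) g ` S \<and> dim ((\<cdot>) g ` S) = dim (nrm H V y) + k"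
        using S'(4,5)[OF x(1,3)]
        by (simp add: x(2) nrm_move_eq[OF _ g] dim_act_image[OF g] image_mono)
    qed
    show "\<forall>p\<in>(\<cdot>) g ` S. reg H V p \<longrightarrow>
        (\<forall>h\<in>H. h \<cdot> p \<in> (\<cdot>) g ` S \<longrightarrow> (\<cdot>) h ` (\<cdot>) g ` S = (\<cdot>) g ` S)"
    proof (intro ballI impI)
      fix y h assume y: "y \<in> (\<cdot>) g ` S" "reg H V y" and h: "h \<in> H" "h \<cdot> y \<in> (\<cdot>) g ` S"
      then obtain x z where x: "x \<in> S" "y = g \<cdot> x" "reg H V x" and z: "z \<in> S" "h \<cdot> y = g \<cdot> z"
        using reg_eq by blast
      have "(g' * h * g) \<cdot> x = z" using x z g' by simp
      then have eq: "(\<cdot>) (g' * h * g) ` S = S"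
        using x z by (intro S'(6)[OF x(1,3)]) (auto intro!: mult_mem g' h g)
      have "(\<cdot>) g ` (\<cdot>) (g' * h * g) ` S = (\<cdot>) h ` (\<cdot>) g ` S"
        by (simp add: image_image g')
      then show "(\<cdot>) h ` (\<cdot>) g ` S = (\<cdot>) g ` S" using eq by simp
    qed
  qed
qed

section \<open>Minimal sections and their codimension\<close>

definition minimal_sec :: "'v \<Rightarrow> 'v set \<Rightarrow> bool" where
  "minimal_sec p S \<longleftrightarrow> p \<in> S \<and> (\<exists>k. sec H V k S) \<and>
     (\<forall>S'. p \<in> S' \<and> (\<exists>k. sec H V k S') \<and> S' \<subseteq> S \<longrightarrow> S' = S)"

text \<open>Take a section of least dimension among those inside \<open>S\<close> through
  \<open>p\<close>; nested subspaces of equal dimension coincide.\<close>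

lemma minimal_sec_below:
  assumes p: "reg H V p" "p \<in> S" and S: "sec H V k S"
  shows "\<exists>S0 k0. minimal_sec p S0 \<and> sec H V k0 S0 \<and> k0 \<le> k"
proof -
  let ?P = "\<lambda>T. p \<in> T \<and> T \<subseteq> S \<and> (\<exists>k. sec H V k T)"
  have "?P S" using assms by auto
  then obtain S0 where S0: "?P S0" and min: "\<And>T. ?P T \<Longrightarrow> dim S0 \<le> dim T"
    using ex_has_least_nat[of ?P S dim] by blast
  obtain k0 where k0: "sec H V k0 S0" using S0 by blast
  have "minimal_sec p S0"
    unfolding minimal_sec_def
  proof (intro conjI allI impI)
    fix T assume T: "p \<in> T \<and> (\<exists>k. sec H V k T) \<and> T \<subseteq> S0"
    then have "dim S0 \<le> dim T" using S0 by (intro min) auto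
    then show "T = S0" using T secD(1)[OF k0] secD(1) by (intro subspace_dim_equal) blast+
  qed (use S0 in auto)
  moreover have "k0 \<le> k"
    using secD(5)[OF S p(2,1)] secD(5)[OF k0 _ p(1)] S0 dim_subset[of S0 S] by auto
  ultimately show ?thesis using k0 by blast
qed

text \<open>Some translate of \<open>T\<close> passes through \<open>p\<close>. Its intersection
  with \<open>S\<close> is again a section through \<open>p\<close>, so by minimality it is all of
  \<open>S\<close>.\<close>

lemma minimal_sec_dim_le:
  assumes p: "reg H V p" and S: "minimal_sec p S" and T: "sec H V l T"
  shows "dim S \<le> dim T"
proof -
  obtain k where k: "sec H V k S" using S by (auto simp: minimal_sec_def)
  obtain x where x: "x \<in> T" "reg H V x" using secD(3)[OF T] by blast
  obtain g where g: "g \<in> H" "g \<cdot> p \<in> T"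
    using orbit_meets[OF reg_mem[OF x(2)] secD(4)[OF T x] reg_mem[OF p]] by blast
  obtain g' where g': "g' \<in> H" "\<And>x. g' \<cdot> g \<cdot> x = x" using obtain_inverse[OF g(1)] by metis
  have T': "sec H V l ((\<cdot>) g' ` T)" by (rule sec_move[OF T g'(1)])
  have pT: "p \<in> (\<cdot>) g' ` T" using g g' by (metis image_eqI)
  have pS: "p \<in> S" using S by (simp add: minimal_sec_def)
  have minimal: "S' = S" if "p \<in> S'" "\<exists>k. sec H V k S'" "S' \<subseteq> S" for S'
    using S that unfolding minimal_sec_def by simp
  have "S \<inter> (\<cdot>) g' ` T = S"
    by (rule minimal[OF IntI[OF pS pT] sec_Int[OF k T' pS pT p] Int_lower1])
  then have "S \<subseteq> (\<cdot>) g' ` T" by blast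
  then show ?thesis using dim_subset dim_act_image[OF g'(1)] by metis
qed

lemma minimal_sec_unique:
  assumes "reg H V p" "minimal_sec p S" "sec H V k S" "reg H V q" "minimal_sec q T" "sec H V l T"
  shows "k = l"
proof -
  have "dim S = dim T"
    using minimal_sec_dim_le[OF assms(1,2,6)] minimal_sec_dim_le[OF assms(4,5,3)] by simp
  moreover have "dim S = dim (nrm H V p) + k" "dim T = dim (nrm H V q) + l"
    using secD(5) assms by (auto simp: minimal_sec_def)
  ultimately show ?thesis using reg_dim_nrm_eq[OF assms(1,4)] by simp
qed

text \<open>
  Only the part \<open>X \<cdot> p\<close> of \<open>q\<close> tangent to the orbit of \<open>p\<close> has to be killed. It lies in \<open>S\<close>, and the
  orbit point nearest to \<open>p + \<delta> *\<^sub>R (X \<cdot> p)\<close> lies in \<open>S\<close> as well, since being nearest is a symmetric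
  relation and normal spaces at regular points of \<open>S\<close> are contained in \<open>S\<close>.
\<close>

lemma sec_nearest_nrm:
  assumes S: "sec H V k S" and p: "p \<in> S" "reg H V p" and q: "q \<in> S"
    and max: "\<And>g. g \<in> H \<Longrightarrow> (\<cdot>) g ` S = S \<Longrightarrow> (g \<cdot> p) \<bullet> q \<le> p \<bullet> q"
  shows "q \<in> nrm H V p"
proof -
  note S' = secD[OF S]
  have V: "p \<in> V" "q \<in> V" using p q S'(2) by auto
  obtain X w where X: "X \<in> lie H" and w: "w \<in> nrm H V p" and qeq: "q = X \<cdot> p + w"
    by (rule normal_decomposition[OF V])
  define u where "u = X \<cdot> p"
  have "w \<in> S" using S'(4)[OF p] w by blast
  then have "q - w \<in> S" by (rule subspace_diff[OF S'(1) q])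
  then have uS: "u \<in> S" by (simp add: qeq u_def)
  obtain e where e: "e > 0" "\<And>x. x \<in> V \<Longrightarrow> norm (x - p) < e \<Longrightarrow> reg H V x"
    using reg_open[OF p(2)] by blast
  \<comment> \<open>The factor in front keeps \<open>p + \<delta> n *\<^sub>R u\<close> within the
    ball of radius \<open>e\<close> consisting of regular points.\<close>
  define \<delta> where "\<delta> n = e / (norm u + 1) * (1 / real (Suc n))" for n
  have d_pos: "\<delta> n > 0" for n using e(1) by (simp add: \<delta>_def add_nonneg_pos)
  have "\<delta> \<longlonglongrightarrow> e / (norm u + 1) * 0"
    unfolding \<delta>_def by (intro tendsto_intros LIMSEQ_Suc[OF lim_1_over_n])
  then have d_lim: "\<delta> \<longlonglongrightarrow> 0" by simp
  have d_small: "norm (\<delta> n *\<^sub>R u) < e" for n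
  proof -
    have "norm u / (norm u + 1) * (1 / real (Suc n)) < 1 * 1"
      by (rule mult_less_le_imp_less) (auto simp: add_nonneg_pos)
    then have "e * (norm u / (norm u + 1) * (1 / real (Suc n))) < e * 1"
      using e(1) by (intro mult_strict_left_mono) auto
    then show ?thesis using d_pos[of n] e(1) by (simp add: \<delta>_def mult_ac)
  qed
  \<comment> \<open>The orbit point \<open>g \<cdot> p\<close> nearest to \<open>x\<close> is at
    least as near as \<open>c \<cdot> p\<close>, which is within o(\<open>\<delta> n\<close>) of
    \<open>x\<close>. As \<open>g\<close> preserves \<open>S\<close>, \<open>max\<close> bounds its
    product with \<open>q\<close>, so \<open>\<delta> n * (u \<bullet> q)\<close> is at most
    o(\<open>\<delta> n\<close>).\<close>
  have bound: "u \<bullet> q \<le> norm ((1 / \<delta> n) *\<^sub>R (exp (\<delta> n *\<^sub>R X) \<cdot> p - p) - u) * norm q" for n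
  proof -
    define x where "x = p + \<delta> n *\<^sub>R u"
    define c where "c = exp (\<delta> n *\<^sub>R X)"
    have c: "c \<in> H" by (simp add: c_def exp_mem X)
    have x: "x \<in> S" unfolding x_def by (intro subspace_add[OF S'(1)] subspace_scale[OF S'(1)] p uS)
    then have xV: "x \<in> V" using S'(2) by blast
    have x_reg: "reg H V x" by (rule e(2)[OF xV]) (use d_small in \<open>simp add: x_def\<close>)
    obtain g where g: "g \<in> H" "\<And>h. h \<in> H \<Longrightarrow> (h \<cdot> x) \<bullet> (g \<cdot> p) \<le> x \<bullet> (g \<cdot> p)"
      using nearest_exists by blast
    then have "g \<cdot> p \<in> nrm H V x" by (intro nearest_nrm act_mem V)
    then have "g \<cdot> p \<in> S" using S'(4)[OF x x_reg] by blast
    then have "(\<cdot>) g ` S = S" by (rule S'(6)[OF p g(1)])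
    then have gq: "(g \<cdot> p) \<bullet> q \<le> p \<bullet> q" using max g(1) by blast
    obtain c' where c': "c' \<in> H" "\<And>x y. (c \<cdot> x) \<bullet> y = x \<bullet> (c' \<cdot> y)"
      using obtain_inverse[OF c] by metis
    have "x \<bullet> (c \<cdot> p) = ((g * c') \<cdot> x) \<bullet> (g \<cdot> p)"
      using c'(2)[of p x] inner_act_eq[OF g(1), of "c' \<cdot> x" p] by (simp add: inner_commute)
    also have "\<dots> \<le> x \<bullet> (g \<cdot> p)" by (intro g(2) mult_mem g(1) c')
    finally have "(norm (x - g \<cdot> p))\<^sup>2 \<le> (norm (x - c \<cdot> p))\<^sup>2"
      unfolding power2_norm_diff inner_act_eq[OF g(1)] inner_act_eq[OF c] by simp
    then have near: "norm (x - g \<cdot> p) \<le> norm (x - c \<cdot> p)" by (rule power2_le_imp_le) simp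
    have "(x - g \<cdot> p) \<bullet> q \<le> norm (x - g \<cdot> p) * norm q" by (rule norm_cauchy_schwarz)
    also have "\<dots> \<le> norm (x - c \<cdot> p) * norm q" by (rule mult_right_mono[OF near]) simp
    finally have "(\<delta> n *\<^sub>R u) \<bullet> q \<le> norm (x - c \<cdot> p) * norm q"
      using gq by (simp add: x_def inner_diff_left inner_add_left)
    also have "x - c \<cdot> p = - (\<delta> n *\<^sub>R ((1 / \<delta> n) *\<^sub>R (c \<cdot> p - p) - u))"
      using d_pos[of n] by (simp add: x_def scaleR_diff_right)
    also have "norm \<dots> = \<delta> n * norm ((1 / \<delta> n) *\<^sub>R (c \<cdot> p - p) - u)"
      using d_pos[of n] by (simp only: norm_minus_cancel norm_scaleR)
    finally have "\<delta> n * (u \<bullet> q) \<le> \<delta> n * (norm ((1 / \<delta> n) *\<^sub>R (c \<cdot> p - p) - u) * norm q)"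
      by (simp only: inner_scaleR_left mult.assoc)
    then show ?thesis using d_pos[of n] by (simp add: c_def)
  qed
  have "(\<lambda>n. (1 / \<delta> n) *\<^sub>R (exp (\<delta> n *\<^sub>R X) \<cdot> p - p)) \<longlonglongrightarrow> u"
    using has_vector_derivative_sequentially[OF exp_act_has_vector_derivative[of X p 0] d_lim]
      d_pos by (simp add: less_imp_neq[symmetric] u_def)
  then have "(\<lambda>n. norm ((1 / \<delta> n) *\<^sub>R (exp (\<delta> n *\<^sub>R X) \<cdot> p - p) - u) * norm q) \<longlonglongrightarrow> norm (u - u) * norm q"
    by (intro tendsto_intros)
  then have "u \<bullet> q \<le> norm (u - u) * norm q"
    by (rule LIMSEQ_le_const) (use bound in auto)
  moreover have "u \<bullet> q = u \<bullet> u" using w X by (simp add: qeq u_def nrm_def inner_add_right)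
  ultimately have "u \<bullet> u \<le> 0" by simp
  then have "u = 0" by (metis inner_ge_zero inner_eq_zero_iff order_antisym)
  then show ?thesis using w by (simp add: qeq u_def)
qed

text \<open>Close to \<open>q\<close> the isotropy group of a point of the segment fixes both
  \<open>q\<close> and \<open>p - q\<close>, hence \<open>p\<close>; then
  \<open>reg_stab_subset\<close> applies.\<close>

lemma reg_segment:
  assumes p: "reg H V p" and q: "q \<in> V" "p \<in> nrm H V q"
  shows "\<exists>e>0. \<forall>s. 0 < s \<and> s < e \<longrightarrow> reg H V (q + s *\<^sub>R (p - q))"
proof -
  obtain s0 where s0: "s0 > 0" "\<And>v. v \<in> nrm H V q \<Longrightarrow> norm v < s0 \<Longrightarrow> stab H (q + v) = stab H q \<inter> stab H v"
    using stab_add_nrm_small by blast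
  have pq: "p - q \<in> nrm H V q" by (rule subspace_diff[OF subspace_nrm q(2) self_nrm[OF q(1)]])
  have "reg H V (q + s *\<^sub>R (p - q))" if s: "0 < s" "s < s0 / (norm (p - q) + 1)" for s
  proof (rule reg_stab_subset(1)[OF p])
    have "s * (norm (p - q) + 1) < s0" using s(2) by (simp add: less_divide_eq add_nonneg_pos)
    then have "s * norm (p - q) < s0" using s(1) by (simp add: algebra_simps)
    then have "norm (s *\<^sub>R (p - q)) < s0" using s(1) by (simp only: norm_scaleR)
    then have "stab H (q + s *\<^sub>R (p - q)) = stab H q \<inter> stab H (s *\<^sub>R (p - q))"
      by (intro s0(2) subspace_scale[OF subspace_nrm] pq)
    also have "\<dots> \<subseteq> stab H p" using s(1) by (auto simp: stab_def act.scaleR_right act.diff_right)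
    finally show "stab H (q + s *\<^sub>R (p - q)) \<subseteq> stab H p" .
    show "q + s *\<^sub>R (p - q) \<in> V"
      by (intro subspace_add[OF subspace_V] subspace_scale[OF subspace_V] subspace_diff[OF subspace_V]
          q(1) reg_mem[OF p])
  qed
  then show ?thesis using s0(1) by (intro exI[of _ "s0 / (norm (p - q) + 1)"]) (auto simp: add_nonneg_pos)
qed

end

section \<open>The slice representation\<close>

context ortho_group
begin

section \<open>Isotropy groups and setwise stabilizers as compact groups\<close>

lemma ortho_group_stab: "ortho_group (stab H q)"
proof
  show "1 \<in> stab H q" by (simp add: stab_def one_mem)
  show "g * h \<in> stab H q" if "g \<in> stab H q" "h \<in> stab H q" for g h
    using that by (simp add: stab_def mult_mem)
  show "\<exists>h\<in>stab H q. g * h = 1 \<and> h * g = 1" if g: "g \<in> stab H q" for g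
  proof -
    have gH: "g \<in> H" "g \<cdot> q = q" using g by (auto simp: stab_def)
    obtain h where h: "h \<in> H" "g * h = 1" "h * g = 1" "\<And>x. h \<cdot> g \<cdot> x = x"
      using obtain_inverse[OF gH(1)] by metis
    have "h \<cdot> q = q" using h(4)[of q] gH(2) by simp
    with h show ?thesis by (auto simp: stab_def)
  qed
  show "norm (g \<cdot> x) = norm x" if "g \<in> stab H q" for g x
    using that norm_act_eq by (simp add: stab_def)
  have "closed ((\<lambda>h. h \<cdot> q) -` {q})"
    by (intro closed_vimage closed_singleton continuous_intros act.continuous_on)
  moreover have "stab H q = H \<inter> (\<lambda>h. h \<cdot> q) -` {q}" by (auto simp: stab_def)
  ultimately show "compact (stab H q)" using compact by auto
qed

lemma ortho_group_setwise:
  assumes S: "subspace S" shows "ortho_group {g \<in> H. (\<cdot>) g ` S = S}" (is "ortho_group ?N")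
proof
  show "1 \<in> ?N" by (simp add: one_mem)
  show "g * h \<in> ?N" if "g \<in> ?N" "h \<in> ?N" for g h
  proof -
    have "(\<cdot>) (g * h) ` S = (\<cdot>) g ` (\<cdot>) h ` S" by (simp add: image_image)
    then show ?thesis using that by (simp add: mult_mem)
  qed
  show "\<exists>h\<in>?N. g * h = 1 \<and> h * g = 1" if g: "g \<in> ?N" for g
  proof -
    have gH: "g \<in> H" "(\<cdot>) g ` S = S" using g by auto
    obtain h where h: "h \<in> H" "g * h = 1" "h * g = 1" "\<And>x. h \<cdot> g \<cdot> x = x"
      using obtain_inverse[OF gH(1)] by metis
    have "(\<cdot>) h ` (\<cdot>) g ` S = S" by (simp add: image_image h(4))
    with h gH(2) show ?thesis by (intro bexI[of _ h]) auto
  qed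
  show "norm (g \<cdot> x) = norm x" if "g \<in> ?N" for g x
    using that norm_act_eq by simp
  \<comment> \<open>For injective linear maps, mapping \<open>S\<close> into itself already means
    mapping it onto itself, and the former is a closed condition.\<close>
  have "?N = H \<inter> (\<Inter>x\<in>S. (\<lambda>g. g \<cdot> x) -` S)"
    using linear_image_eq_if_subset[OF linear_act inj_act S] by auto
  moreover have "closed (\<Inter>x\<in>S. (\<lambda>g. g \<cdot> x) -` S)"
    by (intro closed_INT ballI closed_vimage closed_subspace[OF S] continuous_intros act.continuous_on)
  ultimately show "compact ?N" using compact by auto
qed

end

context ortho_action
begin

text \<open>Among the translates of a regular point of \<open>S\<close> under the group preserving
  \<open>S\<close>, one nearest to \<open>q\<close> works: \<open>sec_nearest_nrm\<close> upgrades
  nearness under that subgroup to normality for all of \<open>H\<close>.\<close>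

lemma sec_nrm_point:
  assumes S: "sec H V k S" and q: "q \<in> S"
  shows "\<exists>p\<in>S. reg H V p \<and> p \<in> nrm H V q"
proof -
  note S' = secD[OF S]
  define N where "N = {g \<in> H. (\<cdot>) g ` S = S}"
  interpret NN: ortho_group N unfolding N_def by (rule ortho_group_setwise[OF S'(1)])
  obtain x where x: "x \<in> S" "reg H V x" using S'(3) by blast
  have "continuous_on N (\<lambda>g. (g \<cdot> x) \<bullet> q)"
    by (intro continuous_intros act.continuous_on)
  then obtain g where g: "g \<in> N" "\<And>h. h \<in> N \<Longrightarrow> (h \<cdot> x) \<bullet> q \<le> (g \<cdot> x) \<bullet> q"
    using continuous_attains_sup[OF NN.compact] NN.one_mem by blast
  have gx: "g \<cdot> x \<in> S" "reg H V (g \<cdot> x)" using g(1) x reg_move by (auto simp: N_def)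
  have "(h \<cdot> g \<cdot> x) \<bullet> q \<le> (g \<cdot> x) \<bullet> q" if "h \<in> H" "(\<cdot>) h ` S = S" for h
    using g(2)[OF NN.mult_mem[OF _ g(1), of h]] that by (simp add: N_def)
  then have "q \<in> nrm H V (g \<cdot> x)" by (rule sec_nearest_nrm[OF S gx q])
  then show ?thesis using nrm_sym[OF reg_mem[OF gx(2)]] gx by blast
qed

text \<open>
  With \<open>N\<close> the stabilizer of \<open>S\<close>, the vectors of \<open>S\<close> normal to the \<open>N\<close>-orbit of \<open>q\<close> are normal to
  its \<open>H\<close>-orbit: near a regular point \<open>y\<close> of the \<open>N\<close>-slice this is \<open>sec_nearest_nrm\<close>.
\<close>

lemma sec_decomposition:
  assumes S: "sec H V k S" and q: "q \<in> S" and z: "z \<in> S"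
  shows "\<exists>X\<in>lie H. z - X \<cdot> q \<in> S \<inter> nrm H V q"
proof -
  note S' = secD[OF S]
  have qV: "q \<in> V" using q S'(2) by blast
  define N where "N = {g \<in> H. (\<cdot>) g ` S = S}"
  interpret NN: ortho_group N unfolding N_def by (rule ortho_group_setwise[OF S'(1)])
  have NS: "ortho_action N S"
    by unfold_locales (use S'(1) in \<open>auto simp: N_def\<close>)
  interpret NN: ortho_action N S by (rule NS)
  have lieN: "lie N \<subseteq> lie H" by (auto simp: lie_def N_def)
  have sub: "S \<inter> nrm H V q \<subseteq> nrm N S q" using lieN by (auto simp: nrm_def)
  obtain s0 where s0: "s0 > 0" "\<And>v h. (\<forall>X\<in>lie N. (X \<cdot> q) \<bullet> v = 0) \<Longrightarrow> norm v < s0 \<Longrightarrow> h \<in> N \<Longrightarrow>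
     (h \<cdot> q) \<bullet> (q + v) \<le> q \<bullet> (q + v)"
    using NN.small_normal_nearest[of q] by blast
  obtain p where p: "p \<in> S" "reg H V p" "p \<in> nrm H V q" using sec_nrm_point[OF S q] by blast
  obtain e0 where e0: "e0 > 0" "\<And>s. 0 < s \<Longrightarrow> s < e0 \<Longrightarrow> reg H V (q + s *\<^sub>R (p - q))"
    using reg_segment[OF p(2) qV p(3)] by blast
  \<comment> \<open>Small enough for \<open>y\<close> to be regular and within \<open>s0 / 2\<close>
    of \<open>q\<close>; the other half of \<open>s0\<close> is left for the vectors
    \<open>c\<close> below.\<close>
  define s where "s = min (e0 / 2) (s0 / 2 / (norm (p - q) + 1))"
  have s: "0 < s" "s < e0" "s \<le> s0 / 2 / (norm (p - q) + 1)"
    using s0(1) e0(1) by (auto simp: s_def add_nonneg_pos)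
  define y where "y = q + s *\<^sub>R (p - q)"
  have y_reg: "reg H V y" unfolding y_def by (rule e0(2)[OF s(1,2)])
  have yS: "y \<in> S" unfolding y_def
    by (intro subspace_add[OF S'(1)] subspace_scale[OF S'(1)] subspace_diff[OF S'(1)] p q)
  have yq: "y \<in> nrm H V q" unfolding y_def
    by (intro subspace_add[OF subspace_nrm] subspace_scale[OF subspace_nrm]
        subspace_diff[OF subspace_nrm] p self_nrm qV)
  have "s * (norm (p - q) + 1) \<le> s0 / 2" using s(3) by (subst (asm) pos_le_divide_eq) (simp_all add: add_nonneg_pos)
  then have "s * norm (p - q) < s0 / 2" using s(1) by (simp add: algebra_simps)
  then have y_small: "norm (y - q) < s0 / 2" using s(1) by (simp add: y_def)
  obtain e where e: "e > 0" "\<And>x. x \<in> V \<Longrightarrow> norm (x - y) < e \<Longrightarrow> reg H V x"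
    using reg_open[OF y_reg] by blast
  \<comment> \<open>Then \<open>y + c\<close> is still regular, and \<open>q\<close> is nearest to
    it in its \<open>N\<close>-orbit, so \<open>sec_nearest_nrm\<close> makes \<open>y + c\<close>
    normal to the \<open>H\<close>-orbit at \<open>q\<close>. Since \<open>y\<close> is normal too,
    so is the difference \<open>c\<close>.\<close>
  have small: "c \<in> nrm H V q" if c: "c \<in> nrm N S q" "norm c < min e (s0 / 2)" for c
  proof -
    have cS: "c \<in> S" using c(1) NN.nrm_subset by blast
    have x: "y + c \<in> S" by (rule subspace_add[OF S'(1) yS cS])
    then have xV: "y + c \<in> V" using S'(2) by blast
    have x_reg: "reg H V (y + c)" by (rule e(2)[OF xV]) (use c(2) in simp)
    have "y - q \<in> nrm N S q"
      using sub yS q subspace_diff[OF S'(1)] subspace_diff[OF subspace_nrm yq self_nrm[OF qV]] by blast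
    then have "(y - q) + c \<in> nrm N S q" by (rule subspace_add[OF NN.subspace_nrm _ c(1)])
    then have "\<forall>X\<in>lie N. (X \<cdot> q) \<bullet> ((y - q) + c) = 0" by (simp add: nrm_def)
    moreover have "norm ((y - q) + c) < s0"
      using norm_triangle_ineq[of "y - q" c] y_small c(2) by linarith
    ultimately have near: "(h \<cdot> q) \<bullet> (y + c) \<le> q \<bullet> (y + c)" if "h \<in> N" for h
      using s0(2)[of "(y - q) + c" h] that by (simp add: algebra_simps)
    have "(g \<cdot> (y + c)) \<bullet> q \<le> (y + c) \<bullet> q" if g: "g \<in> H" "(\<cdot>) g ` S = S" for g
    proof -
      have "g \<in> N" using g by (simp add: N_def)
      then obtain g' where g': "g' \<in> N" "\<And>x y. (g \<cdot> x) \<bullet> y = x \<bullet> (g' \<cdot> y)"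
        using NN.obtain_inverse by metis
      have "(g \<cdot> (y + c)) \<bullet> q = (g' \<cdot> q) \<bullet> (y + c)" by (subst g'(2)) (rule inner_commute)
      also have "\<dots> \<le> q \<bullet> (y + c)" by (rule near[OF g'(1)])
      finally show ?thesis by (simp only: inner_commute)
    qed
    then have "q \<in> nrm H V (y + c)" by (rule sec_nearest_nrm[OF S x x_reg q])
    then have "y + c \<in> nrm H V q" by (rule nrm_sym[OF xV])
    from subspace_diff[OF subspace_nrm this yq] show ?thesis by simp
  qed
  have all: "c \<in> nrm H V q" if c: "c \<in> nrm N S q" for c
  proof -
    define m where "m = min e (s0 / 2)"
    have m: "m > 0" using e(1) s0(1) by (simp add: m_def)
    define r where "r = m / (norm c + 1)"
    have r: "r > 0" using m by (simp add: r_def add_nonneg_pos)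
    have "r * (norm c + 1) = m" by (simp add: r_def add_nonneg_eq_0_iff)
    then have "r * norm c < m" using r by (simp add: algebra_simps)
    then have "r *\<^sub>R c \<in> nrm H V q"
      using r by (intro small subspace_scale[OF NN.subspace_nrm c]) (simp add: m_def)
    from subspace_scale[OF subspace_nrm this, of "1 / r"] show ?thesis using r by simp
  qed
  obtain X w where X: "X \<in> lie N" and w: "w \<in> nrm N S q" and zeq: "z = X \<cdot> q + w"
    by (rule NN.normal_decomposition[OF q z])
  have "z - X \<cdot> q \<in> S \<inter> nrm H V q" using all[OF w] w NN.nrm_subset by (auto simp: zeq)
  then show ?thesis using X lieN by blast
qed

lemma slice_ortho_action:
  assumes q: "q \<in> V" shows "ortho_action (stab H q) (nrm H V q)"
proof -
  interpret K: ortho_group "stab H q" by (rule ortho_group_stab)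
  show ?thesis
  proof unfold_locales
    show "g \<cdot> x \<in> nrm H V q" if "g \<in> stab H q" "x \<in> nrm H V q" for g x
      using nrm_move[OF q that(2), of g] that(1) by (simp add: stab_def)
  qed (rule subspace_nrm)
qed

lemma reg_scale:
  assumes "reg H V p" "c \<noteq> 0" shows "reg H V (c *\<^sub>R p)"
proof -
  have "stab H (g \<cdot> c *\<^sub>R p) = stab H (g \<cdot> p)" for g
    using assms(2) by (auto simp: stab_def act.scaleR_right)
  then show ?thesis
    using assms(1) subspace_scale[OF subspace_V] by (simp add: reg_def)
qed

lemma nrm_scale: "c \<noteq> 0 \<Longrightarrow> nrm H V (c *\<^sub>R p) = nrm H V p"
  by (auto simp: nrm_def act.scaleR_right)

lemma scale_small:
  assumes "s > (0 :: real)" obtains c where "c > 0" "norm (c *\<^sub>R (v :: 'v)) < s"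
proof
  show "s / (norm v + 1) > 0" using assms by (simp add: add_nonneg_pos)
  then have "s / (norm v + 1) * norm v < s / (norm v + 1) * (norm v + 1)" by (intro mult_strict_left_mono) auto
  also have "\<dots> = s" by (simp add: add_nonneg_eq_0_iff)
  finally show "norm ((s / (norm v + 1)) *\<^sub>R v) < s" using assms by simp
qed

text \<open>For small \<open>v\<close> the isotropy group of \<open>v\<close> in the slice is that
  of \<open>q + v\<close> in \<open>H\<close>. Each implication compares \<open>v\<close> with a
  small vector \<open>w\<close> known to be regular on the other side: a point regular for
  \<open>H\<close> pushed towards \<open>q\<close> along a segment, or a regular vector of the slice
  scaled down. Inclusions of isotropy groups then transfer regularity by
  \<open>reg_stab_subset\<close>.\<close>

lemma slice_reg_iff:
  assumes q: "q \<in> V"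
  shows "\<exists>s>0. \<forall>v\<in>nrm H V q. norm v < s \<longrightarrow> (reg (stab H q) (nrm H V q) v \<longleftrightarrow> reg H V (q + v))"
proof -
  interpret K: ortho_action "stab H q" "nrm H V q" by (rule slice_ortho_action[OF q])
  obtain s where s: "s > 0" and stab_eq: "\<And>v. v \<in> nrm H V q \<Longrightarrow> norm v < s \<Longrightarrow> stab H (q + v) = stab H q \<inter> stab H v"
    using stab_add_nrm_small by blast
  have stab_K: "stab (stab H q) v = stab H (q + v)" if "v \<in> nrm H V q" "norm v < s" for v
    using stab_eq[OF that] by (auto simp: stab_def)
  have in_V: "q + v \<in> V" if "v \<in> nrm H V q" for v
    using that nrm_subset q subspace_add[OF subspace_V] by blast
  have KD: "g \<in> H \<and> g \<cdot> (q + v) = q + g \<cdot> v" if "g \<in> stab H q" for g v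
    using that by (simp add: stab_def act.add_right)
  have K_move: "g \<cdot> v \<in> nrm H V q \<and> norm (g \<cdot> v) < s"
    if "g \<in> stab H q" "v \<in> nrm H V q" "norm v < s" for g v
    using K.act_mem[OF that(1,2)] K.norm_act_eq[OF that(1)] that(3) by simp
  have imp: "reg H V (q + v)" if v: "v \<in> nrm H V q" "norm v < s" "reg (stab H q) (nrm H V q) v" for v
  proof -
    obtain x where x: "reg H V x" using reg_exists by blast
    obtain g where g: "g \<in> H" "\<And>h. h \<in> H \<Longrightarrow> (h \<cdot> q) \<bullet> (g \<cdot> x) \<le> q \<bullet> (g \<cdot> x)"
      using nearest_exists by blast
    define p where "p = g \<cdot> x"
    have p: "reg H V p" "p \<in> nrm H V q"
      using reg_move[OF x g(1)] nearest_nrm[OF act_mem[OF g(1) reg_mem[OF x]] g(2)] by (auto simp: p_def)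
    obtain e where e: "e > 0" "\<And>t. 0 < t \<Longrightarrow> t < e \<Longrightarrow> reg H V (q + t *\<^sub>R (p - q))"
      using reg_segment[OF p(1) q p(2)] by blast
    obtain c where c: "c > 0" "norm (c *\<^sub>R (p - q)) < s" using scale_small[OF s] by blast
    define t where "t = min c (e / 2)"
    have t: "0 < t" "t < e" "t \<le> c" using c e by (auto simp: t_def)
    define u where "u = t *\<^sub>R (p - q)"
    have "norm u \<le> norm (c *\<^sub>R (p - q))" using t c by (simp add: u_def mult_right_mono)
    then have u: "u \<in> nrm H V q" "norm u < s"
      using c(2) by (auto simp: u_def intro!: subspace_scale[OF subspace_nrm] subspace_diff[OF subspace_nrm] p self_nrm q)
    obtain h where h: "h \<in> stab H q" "stab (stab H q) (h \<cdot> v) \<subseteq> stab (stab H q) u"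
      using v(3) u by (auto simp: reg_def)
    have "stab H (q + h \<cdot> v) \<subseteq> stab H (q + u)"
      using h(2) stab_K[OF u] stab_K K_move[OF h(1) v(1,2)] by simp
    then have "reg H V (q + h \<cdot> v)"
      using reg_stab_subset(1)[OF e(2)[OF t(1,2)] in_V] K_move[OF h(1) v(1,2)] by (simp add: u_def)
    then show ?thesis
      using KD[OF h(1), of v] reg_move_iff[of h "q + v"] in_V[OF v(1)] by simp
  qed
  have "reg (stab H q) (nrm H V q) v" if v: "v \<in> nrm H V q" "norm v < s" "reg H V (q + v)" for v
  proof -
    obtain v0 where v0: "reg (stab H q) (nrm H V q) v0" using K.reg_exists by blast
    obtain c where c: "c > 0" "norm (c *\<^sub>R v0) < s" using scale_small[OF s] by blast
    have v1: "reg (stab H q) (nrm H V q) (c *\<^sub>R v0)" using K.reg_scale[OF v0] c(1) by simp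
    obtain g where g: "g \<in> stab H q" "stab (stab H q) (g \<cdot> c *\<^sub>R v0) \<subseteq> stab (stab H q) v"
      using v1 v(1) by (auto simp: reg_def)
    define w where "w = g \<cdot> c *\<^sub>R v0"
    have w: "w \<in> nrm H V q" "norm w < s" "reg (stab H q) (nrm H V q) w"
      using K_move[OF g(1) K.reg_mem[OF v1] c(2)] K.reg_move[OF v1 g(1)] by (auto simp: w_def)
    have sub: "stab H (q + w) \<subseteq> stab H (q + v)"
      using g(2) stab_K[OF v(1,2)] stab_K[OF w(1,2)] by (simp add: w_def)
    have "stab H (q + w) = stab H (q + v)" by (rule reg_stab_subset(2)[OF v(3) in_V[OF w(1)] sub])
    then have "stab (stab H q) v \<subseteq> stab (stab H q) w"
      using stab_K[OF v(1,2)] stab_K[OF w(1,2)] by simp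
    then show ?thesis by (rule K.reg_stab_subset(1)[OF w(3) v(1)])
  qed
  with imp s show ?thesis by blast
qed

text \<open>Near \<open>q\<close> the slice is transversal to the orbits, quantitatively. With
  \<open>y = X \<cdot> q\<close> and the linear lift \<open>f\<close>, both hypotheses give
  \<open>y \<bullet> y + y \<bullet> (f y \<cdot> v) = 0\<close>; as \<open>f\<close> is bounded,
  the second term is too small to cancel the first unless \<open>y = 0\<close>.\<close>

lemma slice_small:
  assumes q: "q \<in> V"
  shows "\<exists>s>0. \<forall>v\<in>nrm H V q. norm v < s \<longrightarrow>
    (\<forall>X\<in>lie H. X \<cdot> (q + v) \<in> nrm H V q \<longrightarrow> X \<cdot> q = 0) \<and>
    (\<forall>X\<in>lie H. X \<cdot> q \<in> nrm H V (q + v) \<longrightarrow> X \<cdot> q = 0)"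
proof -
  interpret K: ortho_action "stab H q" "nrm H V q" by (rule slice_ortho_action[OF q])
  obtain f where f: "linear f" "\<And>X. X \<in> lie H \<Longrightarrow> f (X \<cdot> q) \<in> lie H \<and> f (X \<cdot> q) \<cdot> q = X \<cdot> q"
    using lie_act_lift by metis
  have "bounded_linear f" using f(1) by (simp add: linear_conv_bounded_linear)
  then obtain B where B: "B > 0" "\<And>y. norm (f y) \<le> norm y * B" using bounded_linear.pos_bounded by blast
  have key: "y = 0" if "y \<bullet> y + y \<bullet> (f y \<cdot> v) = 0" "norm v < 1 / B" for y v
  proof (rule ccontr)
    assume "y \<noteq> 0"
    have "y \<bullet> y \<le> norm y * norm (f y \<cdot> v)"
      using that(1) norm_cauchy_schwarz[of y "- (f y \<cdot> v)"] by simp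
    also have "\<dots> \<le> norm y * (norm y * B * norm v)"
      by (intro mult_left_mono order_trans[OF norm_act] mult_right_mono B) auto
    also have "\<dots> = (norm y * norm y) * (B * norm v)" by simp
    also have "\<dots> < (norm y * norm y) * 1"
      using \<open>y \<noteq> 0\<close> that(2) B(1) by (intro mult_strict_left_mono) (auto simp: field_simps)
    finally show False by (simp add: power2_norm_eq_inner flip: power2_eq_square)
  qed
  have "X \<cdot> q = 0" if v: "v \<in> nrm H V q" "norm v < 1 / B" and X: "X \<in> lie H" "X \<cdot> (q + v) \<in> nrm H V q" for X v
  proof (rule key[OF _ v(2)])
    let ?Y = "f (X \<cdot> q)"
    have Y: "?Y \<in> lie H" "?Y \<cdot> q = X \<cdot> q" using f(2)[OF X(1)] by auto
    \<comment> \<open>An unbounded isotropy part of \<open>X\<close> is removed here: it moves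
      \<open>v\<close> inside the slice, so \<open>X \<cdot> q + ?Y \<cdot> v\<close> is still
      normal at \<open>q\<close>, and \<open>?Y\<close> is controlled by
      \<open>X \<cdot> q\<close>.\<close>
    have "X - ?Y \<in> lie (stab H q)"
      using Y X(1) subspace_diff[OF subspace_lie] by (simp add: lie_stab_iff act.diff_left)
    then have "(X - ?Y) \<cdot> v \<in> nrm H V q" by (rule K.lie_act_mem[OF _ subspace_nrm v(1) K.act_mem])
    from subspace_diff[OF subspace_nrm X(2) this] have "X \<cdot> q + ?Y \<cdot> v \<in> nrm H V q"
      by (simp add: act.add_right act.diff_left algebra_simps)
    then have "(X \<cdot> q) \<bullet> (X \<cdot> q + ?Y \<cdot> v) = 0" using X(1) by (simp add: nrm_def)
    then show "(X \<cdot> q) \<bullet> (X \<cdot> q) + (X \<cdot> q) \<bullet> (?Y \<cdot> v) = 0" by (simp only: inner_add_right)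
  qed
  moreover have "X \<cdot> q = 0" if v: "norm v < 1 / B" and X: "X \<in> lie H" "X \<cdot> q \<in> nrm H V (q + v)" for X v
  proof (rule key[OF _ v])
    let ?Y = "f (X \<cdot> q)"
    have Y: "?Y \<in> lie H" "?Y \<cdot> q = X \<cdot> q" using f(2)[OF X(1)] by auto
    have "(?Y \<cdot> (q + v)) \<bullet> (X \<cdot> q) = 0" using X(2) Y(1) by (simp add: nrm_def)
    then show "(X \<cdot> q) \<bullet> (X \<cdot> q) + (X \<cdot> q) \<bullet> (?Y \<cdot> v) = 0"
      using inner_commute[of "?Y \<cdot> v" "X \<cdot> q"] by (simp add: act.add_right Y(2) inner_add_left)
  qed
  ultimately show ?thesis using B(1) by (intro exI[of _ "1 / B"]) auto
qed

text \<open>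
  If \<open>q \<in> S\<close>, then \<open>S \<inter> nrm H V q\<close> is a section of the slice representation: at a small regular \<open>v\<close>
  the slice's normal space is the orthogonal projection of \<open>nrm H V (q + v) \<subseteq> S\<close> to \<open>nrm H V q\<close>,
  and by \<open>sec_decomposition\<close> that projection maps \<open>S\<close> into itself.
\<close>

theorem slice_sec_exists:
  assumes q: "q \<in> V" and S0: "sec H V k S0"
  shows "\<exists>l\<le>k. \<exists>S. sec (stab H q) (nrm H V q) l S"
proof -
  obtain x0 where x0: "x0 \<in> S0" "reg H V x0" using secD(3)[OF S0] by blast
  obtain g0 where g0: "g0 \<in> H" "g0 \<cdot> q \<in> S0"
    using orbit_meets[OF reg_mem[OF x0(2)] secD(4)[OF S0 x0] q] by blast
  obtain g1 where g1: "g1 \<in> H" "\<And>x. g1 \<cdot> g0 \<cdot> x = x" using obtain_inverse[OF g0(1)] by metis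
  define S where "S = (\<cdot>) g1 ` S0"
  have S: "sec H V k S" unfolding S_def by (rule sec_move[OF S0 g1(1)])
  have qS: "q \<in> S" using g0 g1 unfolding S_def by (metis image_eqI)
  note S' = secD[OF S]
  interpret K: ortho_action "stab H q" "nrm H V q" by (rule slice_ortho_action[OF q])
  let ?\<nu> = "nrm H V q"
  obtain s1 where s1: "s1 > 0" "\<And>v. v \<in> ?\<nu> \<Longrightarrow> norm v < s1 \<Longrightarrow> reg (stab H q) ?\<nu> v \<longleftrightarrow> reg H V (q + v)"
    using slice_reg_iff[OF q] by blast
  obtain s2 where s2: "s2 > 0"
    "\<And>v X. v \<in> ?\<nu> \<Longrightarrow> norm v < s2 \<Longrightarrow> X \<in> lie H \<Longrightarrow> X \<cdot> (q + v) \<in> ?\<nu> \<Longrightarrow> X \<cdot> q = 0"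
    "\<And>v X. v \<in> ?\<nu> \<Longrightarrow> norm v < s2 \<Longrightarrow> X \<in> lie H \<Longrightarrow> X \<cdot> q \<in> nrm H V (q + v) \<Longrightarrow> X \<cdot> q = 0"
    using slice_small[OF q] by blast
  define s where "s = min s1 s2"
  have s: "s > 0" "s \<le> s1" "s \<le> s2" using s1(1) s2(1) by (auto simp: s_def)
  have in_V: "q + v \<in> V" if "v \<in> ?\<nu>" for v
    using that nrm_subset q subspace_add[OF subspace_V] by blast
  have in_S: "q + v \<in> S" if "v \<in> S" for v
    by (rule subspace_add[OF S'(1) qS that])
  \<comment> \<open>Velocities \<open>Y \<cdot> v\<close> of the isotropy group lie in the slice, so
    the tangential part \<open>X \<cdot> q\<close> does not contribute to the inner product with
    them.\<close>
  have proj: "y \<in> nrm (stab H q) ?\<nu> v"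
    if v: "v \<in> ?\<nu>" and y: "y \<in> ?\<nu>" and X: "X \<in> lie H" "X \<cdot> q + y \<in> nrm H V (q + v)" for v y X
  proof -
    have "(Y \<cdot> v) \<bullet> y = 0" if Y: "Y \<in> lie (stab H q)" for Y
    proof -
      have "(Y \<cdot> v) \<in> ?\<nu>" by (rule K.lie_act_mem[OF Y subspace_nrm v K.act_mem])
      then have "(Y \<cdot> v) \<bullet> (X \<cdot> q) = 0" using X(1) by (simp add: nrm_def inner_commute)
      moreover have "(Y \<cdot> (q + v)) \<bullet> (X \<cdot> q + y) = 0" using X(2) Y by (simp add: nrm_def lie_stab_iff)
      ultimately show ?thesis using Y by (simp add: lie_stab_iff act.add_right inner_add_right)
    qed
    with y show ?thesis by (simp add: nrm_def)
  qed
  have nrm_small: "nrm (stab H q) ?\<nu> v \<subseteq> S"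
    if v: "v \<in> S" "v \<in> ?\<nu>" "norm v < s" "reg (stab H q) ?\<nu> v" for v
  proof
    fix w assume w: "w \<in> nrm (stab H q) ?\<nu> v"
    have qv: "reg H V (q + v)" using s1(2) v s by auto
    have nS: "nrm H V (q + v) \<subseteq> S" by (rule S'(4)[OF in_S[OF v(1)] qv])
    \<comment> \<open>The orthogonal projection of \<open>nrm H V (q + v)\<close> to the slice. It
      lies in \<open>S\<close>, and every normal vector \<open>w\<close> of the slice representation
      is shown to belong to it.\<close>
    let ?A = "{y \<in> ?\<nu>. \<exists>X\<in>lie H. X \<cdot> q + y \<in> nrm H V (q + v)}"
    have "subspace ?A"
    proof (rule subspaceI)
      show "0 \<in> ?A"
        using subspace_0[OF subspace_nrm] subspace_0[OF subspace_lie]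
        by (auto intro!: bexI[of _ 0] simp: act.zero_left)
    next
      fix y z assume "y \<in> ?A" "z \<in> ?A"
      then obtain X Y where XY: "X \<in> lie H" "X \<cdot> q + y \<in> nrm H V (q + v)" "Y \<in> lie H" "Y \<cdot> q + z \<in> nrm H V (q + v)"
        and yz: "y \<in> ?\<nu>" "z \<in> ?\<nu>" by blast
      have "(X + Y) \<cdot> q + (y + z) \<in> nrm H V (q + v)"
        using subspace_add[OF subspace_nrm XY(2,4)] by (simp add: act.add_left algebra_simps)
      then show "y + z \<in> ?A"
        using subspace_add[OF subspace_lie XY(1,3)] subspace_add[OF subspace_nrm yz] by blast
    next
      fix c :: real and y assume "y \<in> ?A"
      then obtain X where X: "X \<in> lie H" "X \<cdot> q + y \<in> nrm H V (q + v)" and y: "y \<in> ?\<nu>" by blast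
      have "(c *\<^sub>R X) \<cdot> q + c *\<^sub>R y \<in> nrm H V (q + v)"
        using subspace_scale[OF subspace_nrm X(2), of c] by (simp add: act.scaleR_left algebra_simps)
      then show "c *\<^sub>R y \<in> ?A"
        using subspace_scale[OF subspace_lie X(1)] subspace_scale[OF subspace_nrm y] by blast
    qed
    then have span_A: "span ?A = ?A" by (simp add: span_eq_iff)
    have A_S: "?A \<subseteq> S"
    proof
      fix y assume "y \<in> ?A"
      then obtain X where y: "y \<in> ?\<nu>" and X: "X \<in> lie H" "X \<cdot> q + y \<in> nrm H V (q + v)" by blast
      obtain Y where Y: "Y \<in> lie H" "X \<cdot> q + y - Y \<cdot> q \<in> S \<inter> ?\<nu>"
        using sec_decomposition[OF S qS, of "X \<cdot> q + y"] X(2) nS by blast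
      have "X \<cdot> q + y - Y \<cdot> q - y \<in> ?\<nu>" using Y(2) y subspace_diff[OF subspace_nrm] by blast
      then have mem: "(X - Y) \<cdot> q \<in> ?\<nu>" by (simp add: act.diff_left algebra_simps)
      have "X - Y \<in> lie H" by (rule subspace_diff[OF subspace_lie X(1) Y(1)])
      with mem have "((X - Y) \<cdot> q) \<bullet> ((X - Y) \<cdot> q) = 0" by (simp add: nrm_def)
      then have "X \<cdot> q = Y \<cdot> q" by (simp add: act.diff_left)
      then show "y \<in> S" using Y(2) by simp
    qed
    \<comment> \<open>The component \<open>z\<close> orthogonal to \<open>?A\<close> vanishes. It is
      orthogonal to the normal part \<open>n\<close> of itself at \<open>q + v\<close>, so
      \<open>z\<close> is a velocity \<open>X \<cdot> (q + v)\<close>. Being normal at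
      \<open>q\<close>, it has \<open>X \<cdot> q = 0\<close> by \<open>s2\<close>, so it is a slice
      velocity at \<open>v\<close> and orthogonal to \<open>w\<close>; it is also orthogonal to
      \<open>w1\<close>.\<close>
    obtain w1 z where wz: "w1 \<in> span ?A" "\<And>y. y \<in> span ?A \<Longrightarrow> orthogonal z y" "w = w1 + z"
      using orthogonal_subspace_decomp_exists by blast
    have w1: "w1 \<in> ?A" using wz(1) span_A by simp
    have z_perp: "z \<bullet> y = 0" if "y \<in> ?A" for y
      using wz(2)[unfolded span_A, OF that] by (simp add: orthogonal_def)
    have "w \<in> ?\<nu>" using w K.nrm_subset by blast
    then have zn: "z \<in> ?\<nu>" using w1 wz(3) subspace_diff[OF subspace_nrm, of w q w1] by auto
    then have zV: "z \<in> V" using nrm_subset by blast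
    obtain X n where X: "X \<in> lie H" and n: "n \<in> nrm H V (q + v)" and z: "z = X \<cdot> (q + v) + n"
      by (rule normal_decomposition[OF in_V[OF v(2)] zV])
    have "n \<in> V" using n nrm_subset by blast
    obtain Y y where Y: "Y \<in> lie H" and y: "y \<in> ?\<nu>" and ny: "n = Y \<cdot> q + y"
      by (rule normal_decomposition[OF q \<open>n \<in> V\<close>])
    have "y \<in> ?A" using n Y y ny by blast
    then have "z \<bullet> n = 0" using z_perp zn Y by (simp add: ny inner_add_right nrm_def inner_commute)
    moreover have "(X \<cdot> (q + v)) \<bullet> n = 0" using n X by (simp add: nrm_def)
    ultimately have "n = 0" by (simp add: z inner_add_left)
    then have zX: "z = X \<cdot> (q + v)" using z by simp
    then have Xq: "X \<cdot> q = 0" using s2(2)[of v X] v s X zn by auto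
    then have "X \<in> lie (stab H q)" using X by (simp add: lie_stab_iff)
    then have "(X \<cdot> v) \<bullet> w = 0" using w by (simp add: nrm_def)
    then have "z \<bullet> w = 0" by (simp add: zX act.add_right Xq)
    then have "z = 0" using z_perp[OF w1] by (simp add: wz(3) inner_add_right)
    then show "w \<in> S" using w1 A_S wz(3) by auto
  qed
  obtain p where p: "p \<in> S" "reg H V p" "p \<in> ?\<nu>" using sec_nrm_point[OF S qS] by blast
  obtain e where e: "e > 0" "\<And>t. 0 < t \<Longrightarrow> t < e \<Longrightarrow> reg H V (q + t *\<^sub>R (p - q))"
    using reg_segment[OF p(2) q p(3)] by blast
  obtain c where c: "c > 0" "norm (c *\<^sub>R (p - q)) < s" using scale_small[OF s(1)] by blast
  define t where "t = min c (e / 2)"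
  have t: "0 < t" "t < e" "t \<le> c" using c e by (auto simp: t_def)
  define v0 where "v0 = t *\<^sub>R (p - q)"
  have "norm v0 \<le> norm (c *\<^sub>R (p - q))" using t c by (simp add: v0_def mult_right_mono)
  then have v0: "v0 \<in> ?\<nu>" "v0 \<in> S" "norm v0 < s" "reg H V (q + v0)"
    using c(2) e(2)[OF t(1,2)]
    by (auto simp: v0_def intro!: subspace_scale[OF subspace_nrm] subspace_diff[OF subspace_nrm] p self_nrm q
        subspace_scale[OF S'(1)] subspace_diff[OF S'(1)] qS)
  have v0_reg: "reg (stab H q) ?\<nu> v0" using s1(2) v0 s by auto
  \<comment> \<open>Regularity and normal spaces in the slice do not change under nonzero scaling,
    so the section conditions need checking only at small vectors.\<close>
  have small_scale: "\<exists>c>0. norm (c *\<^sub>R x) < s \<and> c *\<^sub>R x \<in> S \<and> c *\<^sub>R x \<in> ?\<nu> \<and> reg (stab H q) ?\<nu> (c *\<^sub>R x)"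
    if x: "x \<in> S \<inter> ?\<nu>" "reg (stab H q) ?\<nu> x" for x
  proof -
    obtain c where "c > 0" "norm (c *\<^sub>R x) < s" using scale_small[OF s(1)] by blast
    then show ?thesis
      using x K.reg_scale[OF x(2), of c] subspace_scale[OF S'(1)] subspace_scale[OF subspace_nrm]
      by (intro exI[of _ c]) auto
  qed
  have sec: "sec (stab H q) ?\<nu> (dim (S \<inter> ?\<nu>) - dim (nrm (stab H q) ?\<nu> v0)) (S \<inter> ?\<nu>)"
  proof (rule K.secI)
    show "subspace (S \<inter> ?\<nu>)" by (rule subspace_inter[OF S'(1) subspace_nrm])
    show "S \<inter> ?\<nu> \<subseteq> ?\<nu>" by blast
    show "v0 \<in> S \<inter> ?\<nu>" using v0 by blast
    show "reg (stab H q) ?\<nu> v0" by (rule v0_reg)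
  next
    fix x assume x: "x \<in> S \<inter> ?\<nu>" "reg (stab H q) ?\<nu> x"
    then obtain c where c: "c > 0" "norm (c *\<^sub>R x) < s" "c *\<^sub>R x \<in> S" "c *\<^sub>R x \<in> ?\<nu>" "reg (stab H q) ?\<nu> (c *\<^sub>R x)"
      using small_scale by blast
    have "nrm (stab H q) ?\<nu> x \<subseteq> S" using nrm_small[OF c(3,4,2,5)] K.nrm_scale[of c x] c(1) by simp
    then show "nrm (stab H q) ?\<nu> x \<subseteq> S \<inter> ?\<nu>" using K.nrm_subset by blast
  next
    fix x g assume x: "x \<in> S \<inter> ?\<nu>" "reg (stab H q) ?\<nu> x" and g: "g \<in> stab H q" "g \<cdot> x \<in> S \<inter> ?\<nu>"
    obtain c where c: "c > 0" "norm (c *\<^sub>R x) < s" "c *\<^sub>R x \<in> S" "c *\<^sub>R x \<in> ?\<nu>" "reg (stab H q) ?\<nu> (c *\<^sub>R x)"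
      using small_scale[OF x] by blast
    have gH: "g \<in> H" "g \<cdot> q = q" using g(1) by (auto simp: stab_def)
    have "reg H V (q + c *\<^sub>R x)" using s1(2) c s by auto
    moreover have "g \<cdot> (q + c *\<^sub>R x) \<in> S"
      using g(2) subspace_scale[OF S'(1)] by (auto simp: act.add_right act.scaleR_right gH intro!: in_S)
    ultimately have "(\<cdot>) g ` S = S" using S'(6)[OF in_S[OF c(3)] _ gH(1)] by blast
    moreover have "(\<cdot>) g ` ?\<nu> = ?\<nu>" using nrm_move_eq[OF q gH(1)] gH(2) by simp
    ultimately show "(\<cdot>) g ` (S \<inter> ?\<nu>) = S \<inter> ?\<nu>" by (simp add: image_Int[OF inj_act[OF gH(1)]])
  qed
  \<comment> \<open>The normal space at \<open>q + v0\<close> meets the tangent space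
    \<open>?T\<close> only in 0, and its projection along \<open>?T\<close> lies in the slice's
    normal space. Comparing the two sums with \<open>?T\<close> gives the inequality.\<close>
  have "dim (nrm H V (q + v0)) \<le> dim (nrm (stab H q) ?\<nu> v0)"
  proof -
    let ?T = "(\<lambda>X. X \<cdot> q) ` lie H" and ?n = "nrm H V (q + v0)" and ?m = "nrm (stab H q) ?\<nu> v0"
    have "?n \<inter> ?T \<subseteq> {0}" using s2(3)[OF v0(1)] v0(3) s(3) by auto
    then have "?n \<inter> ?T = {0}" using subspace_0[OF subspace_nrm] subspace_0[OF subspace_lie_act] by blast
    then have "dim ?n + dim ?T = dim {x + y |x y. x \<in> ?n \<and> y \<in> ?T}"
      using dim_sums_Int[OF subspace_nrm[of "q + v0"] subspace_lie_act[of q]] by simp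
    also have "\<dots> \<le> dim {x + y |x y. x \<in> ?m \<and> y \<in> ?T}"
    proof (rule dim_subset, safe)
      fix n X assume n: "n \<in> ?n" and X: "X \<in> lie H"
      have "n \<in> V" using n nrm_subset by blast
      obtain Y y where Y: "Y \<in> lie H" "y \<in> ?\<nu>" "n = Y \<cdot> q + y"
        by (rule normal_decomposition[OF q \<open>n \<in> V\<close>])
      have "y \<in> ?m" using proj[OF v0(1) Y(2,1)] n Y(3) by simp
      moreover have "n + X \<cdot> q = y + (Y + X) \<cdot> q" by (simp add: Y(3) act.add_left)
      ultimately show "\<exists>x y. n + X \<cdot> q = x + y \<and> x \<in> ?m \<and> y \<in> ?T"
        using subspace_add[OF subspace_lie Y(1) X] by blast
    qed
    also have "\<dots> \<le> dim ?m + dim ?T"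
      using dim_sums_Int[OF K.subspace_nrm[of v0] subspace_lie_act[of q]] by linarith
    finally show ?thesis by simp
  qed
  moreover have "dim S = dim (nrm H V (q + v0)) + k" by (rule S'(5)[OF in_S[OF v0(2)] v0(4)])
  moreover have "dim (S \<inter> ?\<nu>) \<le> dim S" by (rule dim_subset) blast
  ultimately have "dim (S \<inter> ?\<nu>) - dim (nrm (stab H q) ?\<nu> v0) \<le> k" by linarith
  with sec show ?thesis by blast
qed

end

section \<open>Complete totally geodesic submanifolds\<close>

lemma Ck_on_cong:
  assumes "open U" "\<And>x. x \<in> U \<Longrightarrow> f x = g x" "Ck_on k f U"
  shows "Ck_on k g U"
  using assms(2,3)
proof (induction k arbitrary: f g)
  case 0
  then show ?case by (simp cong: continuous_on_cong)
next
  case (Suc k)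
  have der: "(g has_derivative frechet_derivative f (at x)) (at x)" if x: "x \<in> U" for x
  proof -
    have "(f has_derivative frechet_derivative f (at x)) (at x)"
      using Suc.prems(2) x by (simp flip: frechet_derivative_works)
    then show ?thesis
      by (rule has_derivative_transform_within_open[OF _ assms(1) x Suc.prems(1)])
  qed
  then have eq: "frechet_derivative g (at x) = frechet_derivative f (at x)" if "x \<in> U" for x
    using frechet_derivative_at that by metis
  have "Ck_on k (\<lambda>x. frechet_derivative g (at x) v) U" for v
    by (rule Suc.IH[of "\<lambda>x. frechet_derivative f (at x) v"]) (use Suc.prems eq in auto)
  with der show ?case by (auto simp: differentiable_def)
qed

text \<open>The factor \<open>r\<close> closes the induction: the derivative in direction
  \<open>v\<close> has the same shape, with \<open>r * v\<close> for \<open>r\<close> and the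
  derivative of \<open>g\<close> along \<open>e\<close> for \<open>g\<close>.\<close>

lemma Ck_on_line:
  fixes g :: "'a::euclidean_space \<Rightarrow> 'b::euclidean_space"
  assumes W: "open W"
  shows "Ck_on k g W \<Longrightarrow> Ck_on k (\<lambda>t::real. r *\<^sub>R g (a + t *\<^sub>R e)) {t. a + t *\<^sub>R e \<in> W}"
proof (induction k arbitrary: g r)
  case 0
  then show ?case
    by (auto intro!: continuous_intros continuous_on_compose2[of W g])
next
  case (Suc k)
  have "{t. a + t *\<^sub>R e \<in> W} = (\<lambda>t. a + t *\<^sub>R e) -` W" by auto
  then have open_T: "open {t. a + t *\<^sub>R e \<in> W}"
    by (simp only:) (intro open_vimage W continuous_intros)
  have der: "((\<lambda>t. r *\<^sub>R g (a + t *\<^sub>R e)) has_derivative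
      (\<lambda>v. (r * v) *\<^sub>R frechet_derivative g (at (a + t *\<^sub>R e)) e)) (at t)"
    if t: "a + t *\<^sub>R e \<in> W" for t
  proof -
    let ?D = "frechet_derivative g (at (a + t *\<^sub>R e))"
    have g: "(g has_derivative ?D) (at (a + t *\<^sub>R e))"
      using Suc.prems t by (simp flip: frechet_derivative_works)
    have line: "((\<lambda>t. a + t *\<^sub>R e) has_derivative (\<lambda>v. v *\<^sub>R e)) (at t)"
      by (auto intro!: derivative_eq_intros)
    have "((\<lambda>t. r *\<^sub>R g (a + t *\<^sub>R e)) has_derivative (\<lambda>v. r *\<^sub>R ?D (v *\<^sub>R e))) (at t)"
      using has_derivative_scaleR_right[OF diff_chain_at[OF line g], of r] by (simp add: o_def)
    moreover have "r *\<^sub>R ?D (v *\<^sub>R e) = (r * v) *\<^sub>R ?D e" for v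
      using linear_scale[OF has_derivative_linear[OF g]] by simp
    ultimately show ?thesis by simp
  qed
  then have eq: "(\<lambda>v. (r * v) *\<^sub>R frechet_derivative g (at (a + t *\<^sub>R e)) e) =
      frechet_derivative (\<lambda>t. r *\<^sub>R g (a + t *\<^sub>R e)) (at t)" if "a + t *\<^sub>R e \<in> W" for t
    using frechet_derivative_at that by blast
  have "Ck_on k (\<lambda>t. frechet_derivative (\<lambda>t. r *\<^sub>R g (a + t *\<^sub>R e)) (at t) v) {t. a + t *\<^sub>R e \<in> W}" for v
  proof (rule Ck_on_cong[OF open_T])
    show "Ck_on k (\<lambda>t. (r * v) *\<^sub>R frechet_derivative g (at (a + t *\<^sub>R e)) e) {t. a + t *\<^sub>R e \<in> W}"
      using Suc.prems by (intro Suc.IH) auto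
    show "(r * v) *\<^sub>R frechet_derivative g (at (a + t *\<^sub>R e)) e
        = frechet_derivative (\<lambda>t. r *\<^sub>R g (a + t *\<^sub>R e)) (at t) v" if "t \<in> {t. a + t *\<^sub>R e \<in> W}" for t
      using eq[of t] that by (metis mem_Collect_eq)
  qed
  with der show ?case by (auto simp: differentiable_def)
qed

lemma smooth_onE:
  assumes "smooth_on U f" "x \<in> U"
  obtains W g where "open W" "x \<in> W" "\<forall>k. Ck_on k g W" "\<forall>y\<in>U \<inter> W. g y = f y"
  using bspec[OF assms(1)[unfolded smooth_on_def] assms(2)] by (elim exE conjE) (rule that)

lemma smooth_on_compose_line:
  fixes \<psi> :: "'a::euclidean_space \<Rightarrow> 'b::euclidean_space"
  assumes "smooth_on U \<psi>" "\<And>t::real. t \<in> I \<Longrightarrow> a + t *\<^sub>R e \<in> U"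
  shows "smooth_on I (\<lambda>t. \<psi> (a + t *\<^sub>R e))"
  unfolding smooth_on_def
proof
  fix t assume t: "t \<in> I"
  obtain W g where W0: "open W" "a + t *\<^sub>R e \<in> W" "\<forall>k. Ck_on k g W" "\<forall>y\<in>U \<inter> W. g y = \<psi> y"
    by (rule smooth_onE[OF assms(1) assms(2)[OF t]])
  note W = W0(1,2) W0(3,4)[rule_format]
  let ?T = "{t. a + t *\<^sub>R e \<in> W}"
  have "?T = (\<lambda>t. a + t *\<^sub>R e) -` W" by auto
  then have "open ?T" by (simp only:) (intro open_vimage W continuous_intros)
  moreover have "Ck_on k (\<lambda>t. g (a + t *\<^sub>R e)) ?T" for k
    using Ck_on_line[OF W(1,3), of k 1 a e] by simp
  moreover have "g (a + y *\<^sub>R e) = \<psi> (a + y *\<^sub>R e)" if "y \<in> I \<inter> ?T" for y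
    using that by (intro W(4)) (simp add: assms(2))
  ultimately show "\<exists>T h. open T \<and> t \<in> T \<and> (\<forall>k. Ck_on k h T) \<and> (\<forall>y\<in>I \<inter> T. h y = \<psi> (a + y *\<^sub>R e))"
    using W(2) by blast
qed

text \<open>The sequence \<open>c\<close> lists a curve with all its successive derivatives, so
  smoothness of an explicit curve reduces to one differentiation rule.\<close>

lemma smooth_on_curveI:
  fixes c :: "nat \<Rightarrow> real \<Rightarrow> 'a::euclidean_space"
  assumes "\<And>k t. (c k has_vector_derivative c (Suc k) t) (at t)"
  shows "smooth_on I (c 0)"
proof -
  have "Ck_on k (\<lambda>t. r *\<^sub>R c j t) UNIV" for k r j
  proof (induction k arbitrary: r j)
    case 0
    have "continuous_on UNIV (c j)"
      by (intro continuous_at_imp_continuous_on ballI has_vector_derivative_continuous[OF assms])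
    then show ?case by (auto intro!: continuous_intros)
  next
    case (Suc k)
    have der: "((\<lambda>t. r *\<^sub>R c j t) has_derivative (\<lambda>v. (r * v) *\<^sub>R c (Suc j) t)) (at t)" for t
      using has_derivative_scaleR_right[OF assms[of j t, unfolded has_vector_derivative_def], of r] by simp
    then have "frechet_derivative (\<lambda>t. r *\<^sub>R c j t) (at t) = (\<lambda>v. (r * v) *\<^sub>R c (Suc j) t)" for t
      using frechet_derivative_at by metis
    with der Suc show ?case by (auto simp: differentiable_def)
  qed
  from this[of _ 1] show ?thesis
    unfolding smooth_on_def by (intro ballI exI[of _ UNIV] exI[of _ "c 0"]) auto
qed

lemma smooth_on_line: "smooth_on I (\<lambda>t::real. p + t *\<^sub>R (v :: 'a::euclidean_space))"
proof -
  define c where "c k t = (if k = 0 then p + t *\<^sub>R v else if k = Suc 0 then v else 0)" for k and t :: real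
  have "(c k has_vector_derivative c (Suc k) t) (at t)" for k t
    unfolding c_def by (auto intro!: derivative_eq_intros simp: has_vector_derivative_def)
  then have "smooth_on I (c 0)" by (rule smooth_on_curveI)
  then show ?thesis by (simp add: c_def[abs_def])
qed

lemma line_has_vector_derivative: "((\<lambda>t. p + t *\<^sub>R v) has_vector_derivative v) (at t)"
  by (auto intro!: derivative_eq_intros simp: has_vector_derivative_def)

lemma smooth_on_exp_act: "smooth_on I (\<lambda>t. exp (t *\<^sub>R X) \<cdot> p)"
proof -
  have "((\<lambda>t. exp (t *\<^sub>R X) \<cdot> X ^ k \<cdot> p) has_vector_derivative exp (t *\<^sub>R X) \<cdot> X ^ Suc k \<cdot> p) (at t)" for k t
    using exp_act_has_vector_derivative[of X "X ^ k \<cdot> p" t] by simp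
  from smooth_on_curveI[of "\<lambda>k t. exp (t *\<^sub>R X) \<cdot> X ^ k \<cdot> p", OF this, of I] show ?thesis by simp
qed

lemma smooth_on_imp_differentiable:
  assumes "smooth_on U f" "open U" "x \<in> U" shows "f differentiable (at x)"
proof -
  obtain W g where W0: "open W" "x \<in> W" "\<forall>k. Ck_on k g W" "\<forall>y\<in>U \<inter> W. g y = f y"
    by (rule smooth_onE[OF assms(1,3)])
  note W = W0(1,2) W0(3,4)[rule_format]
  have "g differentiable (at x)" using W(2) W(3)[of "Suc 0"] by auto
  then obtain D where "(g has_derivative D) (at x)" by (auto simp: differentiable_def)
  then have "(f has_derivative D) (at x)"
    by (rule has_derivative_transform_within_open[OF _ open_Int[OF assms(2) W(1)]])
       (use W(2,4) assms(3) in auto)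
  then show ?thesis by (auto simp: differentiable_def)
qed

lemma smooth_on_imp_continuous_on:
  assumes "smooth_on U f" shows "continuous_on U f"
  unfolding continuous_on_eq_continuous_within
proof
  fix x assume x: "x \<in> U"
  obtain W g where W0: "open W" "x \<in> W" "\<forall>k. Ck_on k g W" "\<forall>y\<in>U \<inter> W. g y = f y"
    by (rule smooth_onE[OF assms x])
  note W = W0(1,2) W0(3,4)[rule_format]
  have "continuous_on W g" using W(3)[of 0] by simp
  then have "continuous_on (U \<inter> W) f"
    by (rule continuous_on_eq[OF continuous_on_subset]) (use W in auto)
  then have "continuous (at x within U \<inter> W) f"
    using x W(2) by (simp add: continuous_on_eq_continuous_within)
  moreover have "at x within U \<inter> W = at x within U"
    by (rule at_within_nhd[OF W(2,1)]) blast
  ultimately show "continuous (at x within U) f" by simp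
qed

lemma smooth_on_curve_twice:
  fixes c :: "real \<Rightarrow> 'a::euclidean_space"
  assumes "smooth_on I c" "open I" "t \<in> I"
  shows "(c has_vector_derivative vector_derivative c (at t)) (at t)"
    and "((\<lambda>s. vector_derivative c (at s)) has_vector_derivative
          vector_derivative (\<lambda>s. vector_derivative c (at s)) (at t)) (at t)"
proof -
  have c: "(c has_vector_derivative vector_derivative c (at s)) (at s)" if "s \<in> I" for s
    using smooth_on_imp_differentiable[OF assms(1,2) that] vector_derivative_works by blast
  then show "(c has_vector_derivative vector_derivative c (at t)) (at t)" using assms(3) by blast
  obtain W g where W0: "open W" "t \<in> W" "\<forall>k. Ck_on k g W" "\<forall>y\<in>I \<inter> W. g y = c y"
    by (rule smooth_onE[OF assms(1,3)])
  note W = W0(1,2) W0(3,4)[rule_format]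
  have eq: "frechet_derivative g (at s) 1 = vector_derivative c (at s)" if s: "s \<in> I \<inter> W" for s
  proof -
    have "(g has_vector_derivative vector_derivative c (at s)) (at s)"
      using has_vector_derivative_transform_within_open[OF c, of s "I \<inter> W" g] s W assms(2)
      by auto
    then have "(g has_derivative (\<lambda>r. r *\<^sub>R vector_derivative c (at s))) (at s)"
      by (simp add: has_vector_derivative_def)
    from frechet_derivative_at[OF this, symmetric] show ?thesis by simp
  qed
  have "(\<lambda>s. frechet_derivative g (at s) 1) differentiable (at t)"
    using W(2) W(3)[of "Suc (Suc 0)"] by auto
  then obtain D where "((\<lambda>s. frechet_derivative g (at s) 1) has_derivative D) (at t)"
    by (auto simp: differentiable_def)
  then have "((\<lambda>s. vector_derivative c (at s)) has_derivative D) (at t)"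
    by (rule has_derivative_transform_within_open[OF _ open_Int[OF assms(2) W(1)]])
       (use W(2) assms(3) eq in auto)
  then show "((\<lambda>s. vector_derivative c (at s)) has_vector_derivative
          vector_derivative (\<lambda>s. vector_derivative c (at s)) (at t)) (at t)"
    using vector_derivative_works differentiable_def by blast
qed

section \<open>Tangent spaces and geodesics\<close>

lemma tangent_space_subspace:
  assumes S: "subspace S" and p: "p \<in> S" shows "tangent_space S p = S"
proof
  show "tangent_space S p \<subseteq> S"
  proof
    fix v assume "v \<in> tangent_space S p"
    then obtain c e where c: "e > 0" "c ` {-e<..<e} \<subseteq> S" "(c has_vector_derivative v) (at (0::real))"
      unfolding tangent_space_def by blast
    then show "v \<in> S"
      by (intro has_vector_derivative_mem_subspace[OF c(3) S c(1)]) (auto simp: image_subset_iff abs_less_iff)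
  qed
  show "S \<subseteq> tangent_space S p"
  proof
    fix v assume v: "v \<in> S"
    have "p + t *\<^sub>R v \<in> S" for t by (intro subspace_add[OF S] subspace_scale[OF S] p v)
    then show "v \<in> tangent_space S p"
      unfolding tangent_space_def
      using smooth_on_line line_has_vector_derivative[of p v 0]
      by (intro CollectI exI[of _ "\<lambda>t. p + t *\<^sub>R v"] exI[of _ 1]) auto
  qed
qed

lemma mem_orthogonal_comp: "x \<in> W\<^sup>\<bottom> \<longleftrightarrow> (\<forall>y\<in>W. y \<bullet> x = 0)"
  by (simp add: orthogonal_comp_def orthogonal_def)

lemma open_real_abs:
  assumes "open (I :: real set)" "s \<in> I" shows "\<exists>e>0. \<forall>r. \<bar>r - s\<bar> < e \<longrightarrow> r \<in> I"
  using assms by (simp add: open_dist dist_real_def)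

lemma curve_second_derivative_mem:
  assumes c: "smooth_on I c" "open I" "t \<in> I" "c ` I \<subseteq> S" and S: "subspace S"
  shows "vector_derivative (\<lambda>s. vector_derivative c (at s)) (at t) \<in> S"
proof -
  have 1: "vector_derivative c (at s) \<in> S" if s: "s \<in> I" for s
  proof -
    obtain e where "e > 0" "\<And>r. \<bar>r - s\<bar> < e \<Longrightarrow> r \<in> I" using open_real_abs[OF c(2) s] by blast
    then show ?thesis
      using c(4) by (intro has_vector_derivative_mem_subspace[OF smooth_on_curve_twice(1)[OF c(1,2) s] S]) auto
  qed
  obtain e where "e > 0" "\<And>r. \<bar>r - t\<bar> < e \<Longrightarrow> r \<in> I" using open_real_abs[OF c(2,3)] by blast
  then show ?thesis
    using 1 by (intro has_vector_derivative_mem_subspace[OF smooth_on_curve_twice(2)[OF c(1-3)] S]) auto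
qed

text \<open>The acceleration is normal to \<open>S\<close>, but as a derivative of a curve inside
  \<open>S\<close> it also belongs to \<open>S\<close>.\<close>

lemma geodesic_on_subspace:
  assumes "geodesic_on I S c" "open I" "t \<in> I" "subspace S"
  shows "vector_derivative (\<lambda>s. vector_derivative c (at s)) (at t) = 0"
proof -
  have c: "smooth_on I c" "c ` I \<subseteq> S" using assms(1) by (auto simp: geodesic_on_def)
  let ?a = "vector_derivative (\<lambda>s. vector_derivative c (at s)) (at t)"
  have "tangent_space S (c t) = S" using c(2) assms(3,4) by (intro tangent_space_subspace) auto
  then have "?a \<in> S\<^sup>\<bottom>" using assms(1,3) by (auto simp: geodesic_on_def)
  moreover have "?a \<in> S" by (rule curve_second_derivative_mem[OF c(1) assms(2,3) c(2) assms(4)])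
  ultimately have "?a \<bullet> ?a = 0" by (simp add: mem_orthogonal_comp)
  then show ?thesis by simp
qed

lemma totally_geodesic_in_subspace:
  assumes "subspace S" "S \<subseteq> V" shows "totally_geodesic_in V S"
  unfolding totally_geodesic_in_def
proof (intro conjI allI impI)
  fix I c assume c: "open I \<and> is_interval I \<and> geodesic_on I S c"
  then have "vector_derivative (\<lambda>s. vector_derivative c (at s)) (at t) = 0" if "t \<in> I" for t
    using geodesic_on_subspace that assms(1) by blast
  then show "geodesic_on I V c"
    using c assms(2) subspace_0[OF subspace_orthogonal_comp] by (auto simp: geodesic_on_def)
qed fact

lemma geodesically_complete_subspace:
  assumes S: "subspace S" shows "geodesically_complete S"
  unfolding geodesically_complete_def
proof (intro ballI)
  fix p v assume p: "p \<in> S" and "v \<in> tangent_space S p"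
  then have v: "v \<in> S" using tangent_space_subspace[OF S p] by simp
  let ?c = "\<lambda>t. p + t *\<^sub>R v"
  have "vector_derivative ?c (at s) = v" for s
    using line_has_vector_derivative vector_derivative_at by blast
  then have "geodesic_on UNIV S ?c"
    using smooth_on_line subspace_0[OF subspace_orthogonal_comp] subspace_add[OF S p subspace_scale[OF S v]]
    by (auto simp: geodesic_on_def)
  then show "\<exists>c. geodesic_on UNIV S c \<and> c 0 = p \<and> (c has_vector_derivative v) (at 0)"
    using line_has_vector_derivative[of p v 0] by (intro exI[of _ ?c]) auto
qed

lemma smooth_on_id: "smooth_on A (\<lambda>x :: 'a::euclidean_space. x)"
proof -
  have const: "Ck_on k (\<lambda>x :: 'a. v :: 'a) UNIV" for k v
    by (induction k arbitrary: v) (auto simp: frechet_derivative_const)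
  have "Ck_on k (\<lambda>x :: 'a. x) UNIV" for k
    by (cases k) (use const in \<open>auto simp: frechet_derivative_ident\<close>)
  then show ?thesis unfolding smooth_on_def by (intro ballI exI[of _ UNIV] exI[of _ "\<lambda>x. x"]) auto
qed

lemma submanifold_subspace:
  assumes S: "subspace (S :: 'a::euclidean_space set)" shows "submanifold S"
  unfolding submanifold_def
proof (rule exI[of _ "dim S"], rule ballI)
  fix p
  have hom: "homeomorphism UNIV UNIV (\<lambda>x :: 'a. x) (\<lambda>x. x)" by (auto simp: homeomorphism_def)
  show "\<exists>(U :: 'a set) (U' :: 'a set) \<phi> \<psi> E. open U \<and> p \<in> U \<and> open U' \<and> homeomorphism U U' \<phi> \<psi> \<and> smooth_on U \<phi> \<and>
      smooth_on U' \<psi> \<and> subspace E \<and> dim E = dim S \<and> \<phi> ` (S \<inter> U) = E \<inter> U'"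
    by (rule exI[of _ UNIV], rule exI[of _ UNIV], rule exI[of _ "\<lambda>x. x"], rule exI[of _ "\<lambda>x. x"],
        rule exI[of _ S]) (use S smooth_on_id hom in auto)
qed

text \<open>The geodesic provided by completeness is also one of the linear space \<open>V\<close>,
  so it has no acceleration and is a straight line.\<close>

lemma geodesic_line:
  assumes V: "subspace V" and "totally_geodesic_in V S" "geodesically_complete S"
    and p: "p \<in> S" "v \<in> tangent_space S p"
  shows "p + t *\<^sub>R v \<in> S"
proof -
  obtain c where c: "geodesic_on UNIV S c" "c 0 = p" "(c has_vector_derivative v) (at 0)"
    using assms(3) p unfolding geodesically_complete_def by blast
  have cV: "geodesic_on UNIV V c"
    using assms(2) c(1) unfolding totally_geodesic_in_def by (simp add: is_interval_univ)
  have sm: "smooth_on UNIV c" using c(1) by (simp add: geodesic_on_def)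
  let ?c' = "\<lambda>s. vector_derivative c (at s)"
  have zero: "\<And>s. s \<in> UNIV \<Longrightarrow> (?c' has_vector_derivative 0) (at s within UNIV)"
    using smooth_on_curve_twice(2)[OF sm] geodesic_on_subspace[OF cV _ _ V] by simp
  obtain w where "\<And>s. s \<in> UNIV \<Longrightarrow> ?c' s = w"
    using has_vector_derivative_zero_constant[OF convex_UNIV zero] by blast
  moreover have "?c' 0 = v" by (rule vector_derivative_at[OF c(3)])
  ultimately have "?c' s = v" for s by simp
  then have c': "(c has_vector_derivative v) (at s)" for s
    using smooth_on_curve_twice(1)[OF sm, of s] by simp
  have "\<And>s. s \<in> UNIV \<Longrightarrow> ((\<lambda>s. c s - s *\<^sub>R v) has_vector_derivative 0) (at s within UNIV)"
    using has_vector_derivative_diff[OF c' line_has_vector_derivative[of 0 v]] by simp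
  then obtain w where "\<And>s. s \<in> UNIV \<Longrightarrow> c s - s *\<^sub>R v = w"
    using has_vector_derivative_zero_constant[OF convex_UNIV] by blast
  from this[of t] this[of 0] c(2) have "c t = p + t *\<^sub>R v" by (simp add: algebra_simps)
  moreover have "c t \<in> S" using c(1) by (auto simp: geodesic_on_def image_subset_iff)
  ultimately show ?thesis by simp
qed

text \<open>The tangent space is the image of \<open>E\<close> under the derivative \<open>D\<close>
  of the inverse chart, and \<open>D\<close> is injective because the derivative of
  \<open>\<phi>\<close> is a left inverse. In both directions curves are transported through the
  chart.\<close>

lemma tangent_space_chart:
  fixes \<phi> \<psi> :: "'v::euclidean_space \<Rightarrow> 'v"
  assumes U: "open U" "p \<in> U" "open U'" and hom: "homeomorphism U U' \<phi> \<psi>"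
    and sm: "smooth_on U \<phi>" "smooth_on U' \<psi>" and E: "subspace E" and im: "\<phi> ` (S \<inter> U) = E \<inter> U'" and p: "p \<in> S"
  shows "subspace (tangent_space S p)" "dim (tangent_space S p) = dim E"
proof -
  define a where "a = \<phi> p"
  have aU: "a \<in> U'" "a \<in> E" using U(2) hom im p by (auto simp: a_def homeomorphism_def)
  have \<psi>a: "\<psi> a = p" using hom U(2) by (simp add: a_def homeomorphism_def)
  obtain D where D: "(\<psi> has_derivative D) (at a)"
    using smooth_on_imp_differentiable[OF sm(2) U(3) aU(1)] by (auto simp: differentiable_def)
  obtain A where A: "(\<phi> has_derivative A) (at p)"
    using smooth_on_imp_differentiable[OF sm(1) U(1,2)] by (auto simp: differentiable_def)
  have "(\<phi> \<circ> \<psi> has_derivative A \<circ> D) (at a)"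
    by (rule diff_chain_at[OF D]) (simp add: \<psi>a A)
  then have "((\<lambda>x. x) has_derivative A \<circ> D) (at a)"
    by (rule has_derivative_transform_within_open[OF _ U(3) aU(1)]) (use hom in \<open>simp add: homeomorphism_def\<close>)
  from has_derivative_unique[OF this has_derivative_ident] have AD: "A (D e) = e" for e
    by (metis comp_apply)
  have linD: "linear D" by (rule has_derivative_linear[OF D])
  have "tangent_space S p = D ` E"
  proof
    show "D ` E \<subseteq> tangent_space S p"
    proof
      fix v assume "v \<in> D ` E"
      then obtain e where e: "e \<in> E" "v = D e" by blast
      have "open ((\<lambda>t::real. a + t *\<^sub>R e) -` U')" by (intro open_vimage U continuous_intros)
      from open_real_abs[OF this, of 0] aU(1)
      obtain r where r: "r > 0" "\<And>t. \<bar>t\<bar> < r \<Longrightarrow> a + t *\<^sub>R e \<in> U'" by auto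
      then have mem: "a + t *\<^sub>R e \<in> U'" if "t \<in> {-r<..<r}" for t
        using that by auto
      have "smooth_on {-r<..<r} (\<lambda>t. \<psi> (a + t *\<^sub>R e))"
        by (rule smooth_on_compose_line[OF sm(2) mem])
      moreover have "\<psi> (a + t *\<^sub>R e) \<in> S" if t: "t \<in> {-r<..<r}" for t
      proof -
        have "a + t *\<^sub>R e \<in> E \<inter> U'" using mem[OF t] subspace_add[OF E aU(2) subspace_scale[OF E e(1)]] by simp
        then obtain x where "x \<in> S \<inter> U" "a + t *\<^sub>R e = \<phi> x" using im by (metis imageE)
        then show ?thesis using hom by (auto simp: homeomorphism_def)
      qed
      moreover have "((\<lambda>t. \<psi> (a + t *\<^sub>R e)) has_vector_derivative v) (at 0)"
      proof -
        have line: "((\<lambda>t::real. a + t *\<^sub>R e) has_derivative (\<lambda>t. t *\<^sub>R e)) (at 0)"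
          by (auto intro!: derivative_eq_intros)
        have "(\<psi> \<circ> (\<lambda>t. a + t *\<^sub>R e) has_derivative D \<circ> (\<lambda>t. t *\<^sub>R e)) (at 0)"
          by (rule diff_chain_at[OF line]) (simp add: D)
        then show ?thesis by (simp add: has_vector_derivative_def o_def linear_scale[OF linD] e(2))
      qed
      ultimately show "v \<in> tangent_space S p"
        unfolding tangent_space_def
        using r(1) \<psi>a by (intro CollectI exI[of _ "\<lambda>t. \<psi> (a + t *\<^sub>R e)"] exI[of _ r]) auto
    qed
    show "tangent_space S p \<subseteq> D ` E"
    proof
      fix v assume "v \<in> tangent_space S p"
      then obtain c e where e: "e > 0" and c: "smooth_on {-e<..<e} c" "c ` {-e<..<e} \<subseteq> S" "c 0 = p"
        and v: "(c has_vector_derivative v) (at (0::real))"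
        unfolding tangent_space_def by blast
      have "continuous_on {-e<..<e} c" by (rule smooth_on_imp_continuous_on[OF c(1)])
      then have "open (c -` U \<inter> {-e<..<e})"
        using U(1) by (simp add: continuous_on_open_vimage)
      from open_real_abs[OF this, of 0] c(3) U(2) e
      obtain r where r: "r > 0" "\<And>t. \<bar>t\<bar> < r \<Longrightarrow> c t \<in> U \<and> t \<in> {-e<..<e}" by auto
      then have mem: "c t \<in> S \<inter> U" if "\<bar>t\<bar> < r" for t
        using that c(2) by blast
      have dv: "(c has_derivative (\<lambda>t. t *\<^sub>R v)) (at 0)" using v by (simp add: has_vector_derivative_def)
      have "(\<phi> \<circ> c has_derivative A \<circ> (\<lambda>t. t *\<^sub>R v)) (at 0)"
        by (rule diff_chain_at[OF dv]) (simp add: c(3) A)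
      then have d\<phi>: "(\<phi> \<circ> c has_vector_derivative A v) (at 0)"
        by (simp add: has_vector_derivative_def o_def linear_scale[OF has_derivative_linear[OF A]])
      have Av: "A v \<in> E"
      proof (rule has_vector_derivative_mem_subspace[OF d\<phi> E r(1)])
        show "(\<phi> \<circ> c) t \<in> E" if "\<bar>t - 0\<bar> < r" for t using mem[of t] im that by auto
      qed
      have "(\<psi> \<circ> (\<phi> \<circ> c) has_derivative D \<circ> (\<lambda>t. t *\<^sub>R A v)) (at 0)"
        by (rule diff_chain_at[OF d\<phi>[unfolded has_vector_derivative_def]]) (simp add: c(3) D flip: a_def)
      then have "(\<psi> \<circ> (\<phi> \<circ> c) has_vector_derivative D (A v)) (at 0)"
        by (simp add: has_vector_derivative_def o_def linear_scale[OF linD])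
      then have "(c has_vector_derivative D (A v)) (at 0)"
      proof (rule has_vector_derivative_transform_within_open[of _ _ _ "ball 0 r"])
        show "(\<psi> \<circ> (\<phi> \<circ> c)) t = c t" if "t \<in> ball 0 r" for t
          using mem[of t] that hom by (simp add: homeomorphism_def dist_real_def)
      qed (use r(1) in auto)
      then have "v = D (A v)" using v vector_derivative_unique_at by blast
      then show "v \<in> D ` E" using Av by blast
    qed
  qed
  moreover have "inj_on D (span E)" by (metis AD inj_onI)
  ultimately show "subspace (tangent_space S p)" "dim (tangent_space S p) = dim E"
    using linear_subspace_image[OF linD E] dim_image_eq[OF linD] by auto
qed

text \<open>The tangent space \<open>T\<close> at 0 is contained in \<open>S\<close>, since
  geodesics are straight lines. It has the dimension of the charts of \<open>S\<close>, so by
  invariance of domain it is open in \<open>S\<close>; it is also closed, and \<open>S\<close> is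
  connected.\<close>

lemma complete_totally_geodesic_subspace:
  fixes S :: "'v::euclidean_space set"
  assumes V: "subspace V" and S: "submanifold S" "connected S" "geodesically_complete S"
    "totally_geodesic_in V S" "0 \<in> S"
  shows "subspace S"
proof -
  obtain d where d: "\<forall>p\<in>S. \<exists>(U::'v set) (U'::'v set) \<phi> \<psi> E.
        open U \<and> p \<in> U \<and> open U' \<and> homeomorphism U U' \<phi> \<psi> \<and> smooth_on U \<phi> \<and> smooth_on U' \<psi> \<and>
        subspace E \<and> dim E = d \<and> \<phi> ` (S \<inter> U) = E \<inter> U'"
    using S(1)[unfolded submanifold_def] by (elim exE)
  define T where "T = tangent_space S 0"
  have T: "subspace T" "dim T = d"
  proof -
    from bspec[OF d S(5)] obtain U U' :: "'v set" and \<phi> \<psi> E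
      where c: "open U \<and> 0 \<in> U \<and> open U' \<and> homeomorphism U U' \<phi> \<psi> \<and> smooth_on U \<phi> \<and>
        smooth_on U' \<psi> \<and> subspace E \<and> dim E = d \<and> \<phi> ` (S \<inter> U) = E \<inter> U'"
      by (elim exE)
    then show "subspace T" "dim T = d"
      unfolding T_def using tangent_space_chart[of U 0 U' \<phi> \<psi> E S] S(5) by auto
  qed
  have TS: "T \<subseteq> S"
    using geodesic_line[OF V S(4,3,5), of _ 1] by (auto simp: T_def)
  have near: "\<exists>W. open W \<and> p \<in> W \<and> S \<inter> W \<subseteq> T" if p: "p \<in> T" for p
  proof -
    have pS: "p \<in> S" using p TS by blast
    from bspec[OF d pS] obtain U U' :: "'v set" and \<phi> \<psi> E
      where c0: "open U \<and> p \<in> U \<and> open U' \<and> homeomorphism U U' \<phi> \<psi> \<and> smooth_on U \<phi> \<and>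
        smooth_on U' \<psi> \<and> subspace E \<and> dim E = d \<and> \<phi> ` (S \<inter> U) = E \<inter> U'"
      by (elim exE)
    then have c: "open U" "p \<in> U" "open U'" "homeomorphism U U' \<phi> \<psi>"
      "subspace E" "dim E = d" "\<phi> ` (S \<inter> U) = E \<inter> U'"
      by auto
    have cont: "continuous_on U \<phi>" and inj: "inj_on \<phi> U"
      using c(4) by (auto simp: homeomorphism_def intro: inj_on_inverseI)
    have "openin (top_of_set E) (\<phi> ` (T \<inter> U))"
    proof (rule invariance_of_domain_subspaces[OF _ T(1) c(5)])
      show "openin (top_of_set T) (T \<inter> U)" using c(1) by blast
      show "dim E \<le> dim T" using c(6) T(2) by simp
      show "continuous_on (T \<inter> U) \<phi>" using cont by (rule continuous_on_subset) blast
      show "\<phi> \<in> T \<inter> U \<rightarrow> E" using c(7) TS by blast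
      show "inj_on \<phi> (T \<inter> U)" using inj by (rule inj_on_subset) blast
    qed
    then obtain O' where O': "open O'" "\<phi> ` (T \<inter> U) = E \<inter> O'" by (auto simp: openin_open)
    have "open (\<phi> -` O' \<inter> U)" using cont c(1) O'(1) by (simp add: continuous_on_open_vimage)
    moreover have "p \<in> \<phi> -` O' \<inter> U" using p c(2) O'(2) by blast
    moreover have "S \<inter> (\<phi> -` O' \<inter> U) \<subseteq> T"
    proof
      fix x assume x: "x \<in> S \<inter> (\<phi> -` O' \<inter> U)"
      then have "\<phi> x \<in> E \<inter> O'" using c(7) by blast
      then obtain y where "y \<in> T \<inter> U" "\<phi> x = \<phi> y" using O'(2) by (metis imageE)
      then show "x \<in> T" using inj x by (metis IntD1 IntD2 inj_onD)
    qed
    ultimately show ?thesis by blast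
  qed
  have "openin (top_of_set S) T"
  proof (subst openin_subopen, intro ballI)
    fix p assume p: "p \<in> T"
    obtain W where W: "open W" "p \<in> W" "S \<inter> W \<subseteq> T" using near[OF p] by blast
    show "\<exists>T'. openin (top_of_set S) T' \<and> p \<in> T' \<and> T' \<subseteq> T"
      by (rule exI[of _ "S \<inter> W"]) (use W p TS in \<open>auto intro: openin_open_Int\<close>)
  qed
  moreover have "closedin (top_of_set S) T"
    using closed_subspace[OF T(1)] TS by (simp add: closed_subset)
  ultimately have "T = S" using S(2) subspace_0[OF T(1)] unfolding connected_clopen by blast
  then show ?thesis using T(1) by simp
qed

section \<open>Representations of groups\<close>

text \<open>Velocities \<open>X \<cdot> p\<close> are tangent along exponential curves. Conversely,
  along any curve in the orbit through \<open>p\<close>, the inner product with \<open>p + u\<close>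
  is maximal at \<open>p\<close> for each small normal \<open>u\<close>, so a tangent vector is
  orthogonal to \<open>p + u\<close>. Taking \<open>u = 0\<close> and a small multiple of
  \<open>w\<close> makes it orthogonal to \<open>w\<close>.\<close>

lemma (in ortho_action) normal_space_in_orbit:
  assumes p: "p \<in> V" shows "normal_space_in V ((\<lambda>g. g \<cdot> p) ` H) p = nrm H V p"
proof
  let ?O = "(\<lambda>g. g \<cdot> p) ` H"
  show "normal_space_in V ?O p \<subseteq> nrm H V p"
  proof
    fix w assume w: "w \<in> normal_space_in V ?O p"
    have "(X \<cdot> p) \<bullet> w = 0" if X: "X \<in> lie H" for X
    proof -
      have "(\<lambda>t. exp (t *\<^sub>R X) \<cdot> p) ` {-1<..<1} \<subseteq> ?O" using exp_mem[OF X] by auto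
      then have "X \<cdot> p \<in> tangent_space ?O p"
        unfolding tangent_space_def
        using smooth_on_exp_act[of "{-1<..<1}" X p] exp_act_has_vector_derivative[of X p 0]
        by (intro CollectI exI[of _ "\<lambda>t. exp (t *\<^sub>R X) \<cdot> p"] exI[of _ 1]) simp
      then show ?thesis using w by (simp add: normal_space_in_def mem_orthogonal_comp)
    qed
    then show "w \<in> nrm H V p" using w by (simp add: nrm_def normal_space_in_def)
  qed
  show "nrm H V p \<subseteq> normal_space_in V ?O p"
  proof
    fix w assume w: "w \<in> nrm H V p"
    obtain s where s: "s > 0" "\<And>v h. (\<forall>X\<in>lie H. (X \<cdot> p) \<bullet> v = 0) \<Longrightarrow> norm v < s \<Longrightarrow> h \<in> H \<Longrightarrow>
       (h \<cdot> p) \<bullet> (p + v) \<le> p \<bullet> (p + v)"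
      using small_normal_nearest[of p] by blast
    obtain r where r: "r > 0" "norm (r *\<^sub>R w) < s" using scale_small[OF s(1)] by blast
    have "v \<bullet> w = 0" if v: "v \<in> tangent_space ?O p" for v
    proof -
      obtain c e where c: "e > 0" "c ` {-e<..<e} \<subseteq> ?O" "c 0 = p" "(c has_vector_derivative v) (at (0::real))"
        using v unfolding tangent_space_def by blast
      have crit: "v \<bullet> (p + u) = 0" if u: "\<forall>X\<in>lie H. (X \<cdot> p) \<bullet> u = 0" "norm u < s" for u
      proof -
        have "((\<lambda>t. c t \<bullet> (p + u)) has_vector_derivative v \<bullet> (p + u)) (at 0)"
          by (rule bounded_linear.has_vector_derivative[OF bounded_linear_inner_left c(4)])
        then have "DERIV (\<lambda>t. c t \<bullet> (p + u)) 0 :> v \<bullet> (p + u)"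
          by (simp add: has_real_derivative_iff_has_vector_derivative)
        moreover have "c t \<bullet> (p + u) \<le> c 0 \<bullet> (p + u)" if "\<bar>0 - t\<bar> < e" for t
        proof -
          have "c t \<in> ?O" using c(2) that by (auto simp: image_subset_iff abs_less_iff)
          then show ?thesis using s(2)[OF u] c(3) by auto
        qed
        ultimately show ?thesis by (intro DERIV_local_max[OF _ c(1)]) auto
      qed
      have "v \<bullet> (p + 0) = 0" by (rule crit) (use s(1) in auto)
      moreover have "v \<bullet> (p + r *\<^sub>R w) = 0" by (rule crit) (use w r in \<open>auto simp: nrm_def\<close>)
      ultimately show ?thesis using r(1) by (simp add: inner_add_right)
    qed
    then show "w \<in> normal_space_in V ?O p"
      using w by (simp add: nrm_def normal_space_in_def mem_orthogonal_comp)
  qed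
qed

locale linear_rep = group G + ortho_action "L ` carrier G" V
  for G :: "('g, 'm) monoid_scheme" (structure) and V :: "'v::euclidean_space set" and L :: "'g \<Rightarrow> 'v endo" +
  fixes \<rho> :: "'g \<Rightarrow> 'v \<Rightarrow> 'v"
  assumes L_mult: "g \<in> carrier G \<Longrightarrow> h \<in> carrier G \<Longrightarrow> L (g \<otimes> h) = L g * L h"
    and rho_eq: "g \<in> carrier G \<Longrightarrow> x \<in> V \<Longrightarrow> \<rho> g x = L g \<cdot> x"
begin

abbreviation "H \<equiv> L ` carrier G"

lemma L_one: "L \<one> = 1"
proof -
  obtain h where h: "L \<one> * h = 1" using inverse_mem[of "L \<one>"] by blast
  have "L \<one> = L \<one> * (L \<one> * h)" using h by simp
  also have "\<dots> = (L \<one> * L \<one>) * h" by (simp only: mult.assoc)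
  also have "\<dots> = L \<one> * h" using L_mult[of \<one> \<one>] by simp
  finally show ?thesis using h by simp
qed

lemma L_inv: "g \<in> carrier G \<Longrightarrow> L (inv g) \<cdot> L g \<cdot> x = x" "g \<in> carrier G \<Longrightarrow> L g \<cdot> L (inv g) \<cdot> x = x"
  using L_mult[of "inv g" g] L_mult[of g "inv g"] L_one by (simp_all flip: act_mult)

lemma orbit_eq: "x \<in> V \<Longrightarrow> orbit G \<rho> x = (\<lambda>h. h \<cdot> x) ` H"
  using rho_eq unfolding orbit_def by (auto simp: image_iff) metis+

lemma mem_stabilizer: "x \<in> V \<Longrightarrow> g \<in> stabilizer G \<rho> x \<longleftrightarrow> g \<in> carrier G \<and> L g \<in> stab H x"
  using rho_eq by (auto simp: stabilizer_def stab_def)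

text \<open>Stabilizers in \<open>G\<close> are full preimages under \<open>L\<close>, so inclusions
  between them can be tested in the image.\<close>

lemma conj_stabilizer_subset:
  assumes p: "p \<in> V" and x: "x \<in> V" and g: "g \<in> carrier G"
  shows "(\<lambda>h. g \<otimes> h \<otimes> inv g) ` stabilizer G \<rho> p \<subseteq> stabilizer G \<rho> x \<longleftrightarrow> stab H (L g \<cdot> p) \<subseteq> stab H x"
proof
  assume sub: "(\<lambda>h. g \<otimes> h \<otimes> inv g) ` stabilizer G \<rho> p \<subseteq> stabilizer G \<rho> x"
  show "stab H (L g \<cdot> p) \<subseteq> stab H x"
  proof
    fix k assume k: "k \<in> stab H (L g \<cdot> p)"
    then obtain h where h: "h \<in> carrier G" "k = L h" "L h \<cdot> L g \<cdot> p = L g \<cdot> p" by (auto simp: stab_def)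
    have c: "inv g \<otimes> h \<otimes> g \<in> carrier G" using h(1) g by simp
    have "L (inv g \<otimes> h \<otimes> g) \<cdot> p = p" using h g by (simp add: L_mult L_inv)
    then have "inv g \<otimes> h \<otimes> g \<in> stabilizer G \<rho> p"
      using c by (simp add: mem_stabilizer[OF p] stab_def)
    then have "g \<otimes> (inv g \<otimes> h \<otimes> g) \<otimes> inv g \<in> stabilizer G \<rho> x" using sub by blast
    moreover have "g \<otimes> (inv g \<otimes> h \<otimes> g) \<otimes> inv g = h" using g h(1) by (simp add: m_assoc) (simp flip: m_assoc)
    ultimately show "k \<in> stab H x" using mem_stabilizer[OF x] h(2) by simp
  qed
next
  assume sub: "stab H (L g \<cdot> p) \<subseteq> stab H x"
  show "(\<lambda>h. g \<otimes> h \<otimes> inv g) ` stabilizer G \<rho> p \<subseteq> stabilizer G \<rho> x"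
  proof
    fix k assume "k \<in> (\<lambda>h. g \<otimes> h \<otimes> inv g) ` stabilizer G \<rho> p"
    then obtain h where h: "h \<in> carrier G" "L h \<cdot> p = p" "k = g \<otimes> h \<otimes> inv g"
      using mem_stabilizer[OF p] by (auto simp: stab_def)
    have c: "k \<in> carrier G" using h g by simp
    have "L k \<cdot> L g \<cdot> p = L g \<cdot> p" using h g by (simp add: L_mult L_inv)
    then have "L k \<in> stab H (L g \<cdot> p)" using c by (simp add: stab_def)
    then show "k \<in> stabilizer G \<rho> x" using sub mem_stabilizer[OF x] h g by auto
  qed
qed

lemma regular_point_iff: "regular_point G V \<rho> p \<longleftrightarrow> reg H V p"
proof
  assume "regular_point G V \<rho> p"
  then obtain p' where p: "p \<in> V" and p': "p' \<in> V" "orbit G \<rho> p = orbit G \<rho> p'"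
    "\<And>x. x \<in> V \<Longrightarrow> \<exists>g\<in>carrier G. (\<lambda>h. g \<otimes> h \<otimes> inv g) ` stabilizer G \<rho> p' \<subseteq> stabilizer G \<rho> x"
    unfolding regular_point_def principal_orbit_def by blast
  have reg: "reg H V p'"
    unfolding reg_def
  proof (intro conjI ballI p'(1))
    fix x assume x: "x \<in> V"
    from p'(3)[OF x] show "\<exists>g\<in>H. stab H (g \<cdot> p') \<subseteq> stab H x"
      using conj_stabilizer_subset[OF p'(1) x] by blast
  qed
  have "p \<in> (\<lambda>h. h \<cdot> p) ` H" using one_mem by (intro image_eqI[of _ _ 1]) auto
  then have "p \<in> (\<lambda>h. h \<cdot> p') ` H" using orbit_eq[OF p] orbit_eq[OF p'(1)] p'(2) by simp
  then obtain g where "g \<in> H" "p = g \<cdot> p'" by blast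
  then show "reg H V p" using reg_move[OF reg] by simp
next
  assume reg: "reg H V p"
  then have p: "p \<in> V" by (rule reg_mem)
  have "\<exists>g\<in>carrier G. (\<lambda>h. g \<otimes> h \<otimes> inv g) ` stabilizer G \<rho> p \<subseteq> stabilizer G \<rho> x" if x: "x \<in> V" for x
  proof -
    obtain g where "g \<in> carrier G" "stab H (L g \<cdot> p) \<subseteq> stab H x" using reg x unfolding reg_def by blast
    then show ?thesis using conj_stabilizer_subset[OF p x] by blast
  qed
  with p show "regular_point G V \<rho> p" unfolding regular_point_def principal_orbit_def by blast
qed

lemma normal_space_orbit: "p \<in> V \<Longrightarrow> normal_space_in V (orbit G \<rho> p) p = nrm H V p"
  by (simp add: orbit_eq normal_space_in_orbit)

lemma image_rho: "g \<in> carrier G \<Longrightarrow> S \<subseteq> V \<Longrightarrow> \<rho> g ` S = (\<cdot>) (L g) ` S"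
  using rho_eq by (intro image_cong) auto

lemma k_section_iff: "k_section G V \<rho> k S \<longleftrightarrow> sec H V k S"
proof
  assume k: "k_section G V \<rho> k S"
  then have S: "S \<subseteq> V" "submanifold S" "connected S" "geodesically_complete S" "totally_geodesic_in V S"
    and meets: "\<And>x. x \<in> V \<Longrightarrow> S \<inter> orbit G \<rho> x \<noteq> {}"
    unfolding k_section_def orbits_def by auto
  have V0: "0 \<in> V" by (rule subspace_0[OF subspace_V])
  \<comment> \<open>The orbit of 0 is a single point, so meeting all orbits puts 0 into
    \<open>S\<close> and makes \<open>S\<close> linear.\<close>
  have "S \<inter> orbit G \<rho> 0 \<noteq> {}" by (rule meets[OF V0])
  then have "0 \<in> S" by (auto simp: orbit_eq[OF V0] act.zero_right)
  with S have sub: "subspace S" using complete_totally_geodesic_subspace[OF subspace_V] by blast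
  note T = tangent_space_subspace[OF sub]
  obtain x where x: "reg H V x" using reg_exists by blast
  have "S \<inter> orbit G \<rho> x \<noteq> {}" by (rule meets[OF reg_mem[OF x]])
  then obtain g where g: "g \<in> H" "g \<cdot> x \<in> S" using orbit_eq[OF reg_mem[OF x]] by auto
  have "\<exists>p\<in>S. reg H V p" using g reg_move[OF x g(1)] by blast
  moreover have "nrm H V p \<subseteq> S \<and> dim S = dim (nrm H V p) + k" if p: "p \<in> S" "reg H V p" for p
  proof -
    have "normal_space_in V (orbit G \<rho> p) p \<subseteq> tangent_space S p \<and>
        dim (tangent_space S p) = dim (normal_space_in V (orbit G \<rho> p) p) + k"
      using k p regular_point_iff unfolding k_section_def by blast
    then show ?thesis by (simp only: T[OF p(1)] normal_space_orbit[OF reg_mem[OF p(2)]])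
  qed
  moreover have "(\<cdot>) g ` S = S" if p: "p \<in> S" "reg H V p" and g: "g \<in> H" "g \<cdot> p \<in> S" for p g
  proof -
    obtain h where h: "h \<in> carrier G" "g = L h" using g(1) by blast
    have "\<rho> h p \<in> S" using g(2) h rho_eq reg_mem[OF p(2)] by simp
    then have "\<rho> h ` S = S" using k p h regular_point_iff unfolding k_section_def by blast
    then show ?thesis using image_rho[OF h(1) S(1)] h(2) by simp
  qed
  ultimately show "sec H V k S" unfolding sec_def using sub S(1) by blast
next
  assume S: "sec H V k S"
  note S' = secD[OF S]
  note T = tangent_space_subspace[OF S'(1)]
  show "k_section G V \<rho> k S"
    unfolding k_section_def regular_point_iff
  proof (intro conjI ballI impI)
    show "submanifold S" by (rule submanifold_subspace[OF S'(1)])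
    show "connected S" by (rule convex_connected[OF subspace_imp_convex[OF S'(1)]])
    show "geodesically_complete S" by (rule geodesically_complete_subspace[OF S'(1)])
    show "totally_geodesic_in V S" by (rule totally_geodesic_in_subspace[OF S'(1,2)])
    fix X assume "X \<in> orbits G V \<rho>"
    then obtain x where x: "x \<in> V" "X = (\<lambda>h. h \<cdot> x) ` H" using orbit_eq by (auto simp: orbits_def)
    obtain p where p: "p \<in> S" "reg H V p" using S'(3) by blast
    show "S \<inter> X \<noteq> {}" using orbit_meets[OF reg_mem[OF p(2)] S'(4)[OF p] x(1)] x(2) by blast
  next
    fix p assume p: "p \<in> S" "reg H V p"
    show "normal_space_in V (orbit G \<rho> p) p \<subseteq> tangent_space S p"
      "dim (tangent_space S p) = dim (normal_space_in V (orbit G \<rho> p) p) + k"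
      unfolding T[OF p(1)] normal_space_orbit[OF reg_mem[OF p(2)]] using S'(4,5)[OF p] by auto
  next
    fix p g assume p: "p \<in> S" "reg H V p" and g: "g \<in> carrier G" "\<rho> g p \<in> S"
    have "L g \<cdot> p \<in> S" using g rho_eq reg_mem[OF p(2)] by simp
    then show "\<rho> g ` S = S" using S'(6)[OF p imageI[OF g(1)]] image_rho[OF g(1) S'(2)] by simp
  qed (rule S'(2))
qed

lemma minimal_section_iff: "minimal_section G V \<rho> p S \<longleftrightarrow> minimal_sec p S"
  by (auto simp: minimal_section_def sections_through_def minimal_sec_def k_section_iff)

text \<open>Justifies the definite description: a minimal section exists inside the section
  \<open>V\<close>, and \<open>minimal_sec_unique\<close> fixes its codimension.\<close>

lemma copolarity_witness:
  obtains p S where "reg H V p" "minimal_sec p S" "sec H V (copolarity G V \<rho>) S"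
proof -
  obtain p where p: "reg H V p" using reg_exists by blast
  obtain k where k: "sec H V k V" using sec_exists by blast
  obtain S k0 where S: "minimal_sec p S" "sec H V k0 S"
    using minimal_sec_below[OF p reg_mem[OF p] k] by blast
  have "copolarity G V \<rho> = k0"
    unfolding copolarity_def regular_point_iff minimal_section_iff k_section_iff
  proof (rule the_equality)
    show "\<exists>p S. reg H V p \<and> minimal_sec p S \<and> sec H V k0 S" using p S by blast
    show "k = k0" if "\<exists>p S. reg H V p \<and> minimal_sec p S \<and> sec H V k S" for k
      using that minimal_sec_unique[OF _ _ _ p S] by blast
  qed
  with p S that show thesis by blast
qed

text \<open>Every section contains a minimal one through each of its regular points, and the
  codimension of the latter is the copolarity.\<close>

lemma copolarity_le:
  assumes S: "sec H V k S" shows "copolarity G V \<rho> \<le> k"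
proof -
  obtain p T where T: "reg H V p" "minimal_sec p T" "sec H V (copolarity G V \<rho>) T"
    by (rule copolarity_witness)
  obtain x where x: "x \<in> S" "reg H V x" using secD(3)[OF S] by blast
  obtain S0 k0 where S0: "minimal_sec x S0" "sec H V k0 S0" "k0 \<le> k"
    using minimal_sec_below[OF x(2,1) S] by blast
  have "copolarity G V \<rho> = k0" by (rule minimal_sec_unique[OF T x(2) S0(1,2)])
  with S0(3) show ?thesis by simp
qed

end

section \<open>From Lie group representations to compact groups of operators\<close>

lemma orthogonal_projection_exists:
  assumes V: "subspace (V :: 'v::euclidean_space set)"
  shows "\<exists>P. linear P \<and> (\<forall>x. P x \<in> V \<and> (\<forall>y\<in>V. y \<bullet> (x - P x) = 0))"
proof -
  have "\<exists>y. y \<in> V \<and> (\<forall>z\<in>V. z \<bullet> (x - y) = 0)" for x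
  proof -
    obtain y z where "y \<in> span V" "\<And>w. w \<in> span V \<Longrightarrow> orthogonal z w" "x = y + z"
      using orthogonal_subspace_decomp_exists by blast
    moreover have "span V = V" using V by (simp add: span_eq_iff)
    ultimately show ?thesis by (intro exI[of _ y]) (auto simp: orthogonal_def inner_commute)
  qed
  then obtain P where P: "\<And>x. P x \<in> V" "\<And>x z. z \<in> V \<Longrightarrow> z \<bullet> (x - P x) = 0" by metis
  have uniq: "P x = y" if y: "y \<in> V" "\<And>z. z \<in> V \<Longrightarrow> z \<bullet> (x - y) = 0" for x y
  proof -
    have d: "P x - y \<in> V" by (rule subspace_diff[OF V P(1) y(1)])
    have "(P x - y) \<bullet> (P x - y) = (P x - y) \<bullet> (x - y) - (P x - y) \<bullet> (x - P x)"
      by (simp add: inner_diff_right)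
    also have "\<dots> = 0" using P(2)[OF d] y(2)[OF d] by simp
    finally show ?thesis by simp
  qed
  have "linear P"
  proof (rule linearI)
    show "P (x + y) = P x + P y" for x y
    proof (rule uniq[OF subspace_add[OF V P(1) P(1)]])
      fix z assume z: "z \<in> V"
      have "x + y - (P x + P y) = (x - P x) + (y - P y)" by simp
      then show "z \<bullet> (x + y - (P x + P y)) = 0" using P(2)[OF z] by (simp only: inner_add_right)
    qed
    show "P (c *\<^sub>R x) = c *\<^sub>R P x" for c x
    proof (rule uniq[OF subspace_scale[OF V P(1)]])
      fix z assume z: "z \<in> V"
      have "c *\<^sub>R x - c *\<^sub>R P x = c *\<^sub>R (x - P x)" by (simp add: scaleR_diff_right)
      then show "z \<bullet> (c *\<^sub>R x - c *\<^sub>R P x) = 0" using P(2)[OF z] by (simp only: inner_scaleR_right)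
    qed
  qed
  with P show ?thesis by blast
qed

text \<open>A derivative within a proper subspace is not unique as a linear map, but its values on
  \<open>V\<close> are, as restriction to the line through \<open>q\<close> in direction
  \<open>v\<close> shows.\<close>

lemma frechet_derivative_within_subspace:
  assumes V: "subspace (V :: 'v::euclidean_space set)" and A: "\<And>x. x \<in> V \<Longrightarrow> f x = A \<cdot> x"
    and q: "q \<in> V" and v: "v \<in> V"
  shows "frechet_derivative f (at q within V) v = A \<cdot> v"
proof -
  have "((\<cdot>) A has_derivative (\<cdot>) A) (at q within V)"
    by (rule bounded_linear_imp_has_derivative[OF act.bounded_linear_right])
  from has_derivative_transform[OF q A this] have "(f has_derivative (\<cdot>) A) (at q within V)" by simp
  then have D: "(f has_derivative frechet_derivative f (at q within V)) (at q within V)"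
    by (meson differentiableI frechet_derivative_works)
  let ?l = "\<lambda>t::real. q + t *\<^sub>R v"
  have lV: "?l t \<in> V" for t by (intro subspace_add[OF V] subspace_scale[OF V] q v)
  have line: "(?l has_derivative (\<lambda>t. t *\<^sub>R v)) (at 0)"
    by (auto intro!: derivative_eq_intros)
  have "(f has_derivative frechet_derivative f (at q within V)) (at (?l 0) within range ?l)"
    using has_derivative_subset[OF D, of "range ?l"] lV by auto
  then have "((\<lambda>t. f (?l t)) has_derivative (\<lambda>t. frechet_derivative f (at q within V) (t *\<^sub>R v))) (at 0)"
    by (rule has_derivative_in_compose[OF line])
  moreover have "(\<lambda>t. f (?l t)) = (\<lambda>t. A \<cdot> q + t *\<^sub>R (A \<cdot> v))"
    using A lV by (simp add: act.add_right act.scaleR_right)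
  ultimately have "((\<lambda>t. A \<cdot> q + t *\<^sub>R (A \<cdot> v)) has_derivative
      (\<lambda>t. frechet_derivative f (at q within V) (t *\<^sub>R v))) (at 0)" by simp
  moreover have "((\<lambda>t. A \<cdot> q + t *\<^sub>R (A \<cdot> v)) has_derivative (\<lambda>t. t *\<^sub>R (A \<cdot> v))) (at (0::real))"
    by (auto intro!: derivative_eq_intros)
  ultimately have "(\<lambda>t. frechet_derivative f (at q within V) (t *\<^sub>R v)) = (\<lambda>t. t *\<^sub>R (A \<cdot> v))"
    by (rule has_derivative_unique)
  from fun_cong[OF this, of 1] show ?thesis by simp
qed

text \<open>An operator is a finite sum of rank-one operators depending linearly on its values on
  the basis, so pointwise continuity implies continuity in norm.\<close>

lemma continuous_map_endo:
  assumes "\<And>x. continuous_map T euclidean (\<lambda>g. L g \<cdot> x)"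
  shows "continuous_map T euclidean (L :: 'g \<Rightarrow> 'v::euclidean_space endo)"
proof -
  have "\<exists>E :: 'v \<Rightarrow> 'v endo. linear E \<and> (\<forall>y x. E y \<cdot> x = (x \<bullet> b) *\<^sub>R y)" for b :: 'v
  proof -
    have "\<exists>A. \<forall>x. A \<cdot> x = (x \<bullet> b) *\<^sub>R y" for y :: 'v
      by (rule endo_of_linear) (auto intro!: linearI simp: inner_add_left algebra_simps)
    then obtain E :: "'v \<Rightarrow> 'v endo" where E: "\<And>y x. E y \<cdot> x = (x \<bullet> b) *\<^sub>R y" by metis
    have "linear E"
      by (rule linearI; rule endo_eqI)
         (simp_all add: E act.add_left act.scaleR_left algebra_simps)
    with E show ?thesis by blast
  qed
  then obtain E :: "'v \<Rightarrow> 'v \<Rightarrow> 'v endo" where E: "\<And>b. linear (E b)" "\<And>b y x. E b y \<cdot> x = (x \<bullet> b) *\<^sub>R y"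
    by metis
  have "L g = (\<Sum>b\<in>Basis. E b (L g \<cdot> b))" for g
  proof (rule endo_eqI)
    fix x
    have "L g \<cdot> x = L g \<cdot> (\<Sum>b\<in>Basis. (x \<bullet> b) *\<^sub>R b)" by (simp add: euclidean_representation)
    also have "\<dots> = (\<Sum>b\<in>Basis. (x \<bullet> b) *\<^sub>R (L g \<cdot> b))" by (simp add: act.sum_right act.scaleR_right)
    also have "\<dots> = (\<Sum>b\<in>Basis. E b (L g \<cdot> b)) \<cdot> x" by (simp add: act.sum_left E(2))
    finally show "L g \<cdot> x = (\<Sum>b\<in>Basis. E b (L g \<cdot> b)) \<cdot> x" .
  qed
  moreover have "continuous_map T euclidean (\<lambda>g. \<Sum>b\<in>Basis. E b (L g \<cdot> b))"
  proof (rule continuous_map_sum[OF finite_Basis])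
    fix b :: 'v
    have "continuous_on UNIV (E b)"
      using E(1) by (simp add: linear_continuous_on linear_conv_bounded_linear)
    then have "continuous_map euclidean euclidean (E b)" by simp
    from continuous_map_compose[OF assms this]
    show "continuous_map T euclidean (\<lambda>g. E b (L g \<cdot> b))" by (simp add: o_def)
  qed
  ultimately show ?thesis by simp
qed

lemma action_continuous_map:
  assumes G: "compact_lie_group G T E \<A>" and rep: "orthogonal_representation G \<A> V \<rho>" and x: "x \<in> V"
  shows "continuous_map T euclidean (\<lambda>g. \<rho> g x)"
proof (rule pasting_lemma[where I = \<A> and T = fst and f = "\<lambda>_ g. \<rho> g x"])
  have atlas: "\<And>U \<phi>. (U, \<phi>) \<in> \<A> \<Longrightarrow> chart T E U \<phi>" "(\<Union>(U, \<phi>)\<in>\<A>. U) = topspace T"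
    using G unfolding compact_lie_group_def smooth_atlas_def by auto
  fix i assume "i \<in> \<A>"
  then obtain U \<phi> where i: "i = (U, \<phi>)" "(U, \<phi>) \<in> \<A>" by (cases i) auto
  have ch: "openin T U" "homeomorphic_map (subtopology T U) (top_of_set (\<phi> ` U)) \<phi>"
    using atlas(1)[OF i(2)] by (auto simp: chart_def)
  show "openin T (fst i)" using ch(1) i by simp
  have "smooth_on (\<phi> ` U \<times> V) (\<lambda>(a, x). \<rho> (inv_into U \<phi> a) x)"
    using rep i(2) unfolding orthogonal_representation_def by auto
  then have "continuous_on (\<phi> ` U \<times> V) (\<lambda>(a, x). \<rho> (inv_into U \<phi> a) x)"
    by (rule smooth_on_imp_continuous_on)
  then have "continuous_on (\<phi> ` U) (\<lambda>a. (\<lambda>(a, x). \<rho> (inv_into U \<phi> a) x) (a, x))"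
    by (rule continuous_on_compose2) (use x in \<open>auto intro!: continuous_intros\<close>)
  then have "continuous_map (top_of_set (\<phi> ` U)) euclidean (\<lambda>a. \<rho> (inv_into U \<phi> a) x)" by simp
  from continuous_map_compose[OF homeomorphic_imp_continuous_map[OF ch(2)] this]
  have cont: "continuous_map (subtopology T U) euclidean (\<lambda>g. \<rho> (inv_into U \<phi> (\<phi> g)) x)"
    by (simp add: o_def)
  have "topspace (subtopology T U) = U" using openin_subset[OF ch(1)] by auto
  moreover from this have "inj_on \<phi> U" using homeomorphic_imp_injective_map[OF ch(2)] by simp
  ultimately have "\<rho> (inv_into U \<phi> (\<phi> g)) x = \<rho> g x" if "g \<in> topspace (subtopology T U)" for g
    using that by simp
  from continuous_map_eq[OF cont this]
  show "continuous_map (subtopology T (fst i)) euclidean (\<lambda>g. \<rho> g x)" using i by simp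
next
  fix g assume "g \<in> topspace T"
  then have "g \<in> (\<Union>(U, \<phi>)\<in>\<A>. U)"
    using G unfolding compact_lie_group_def smooth_atlas_def by simp
  then show "\<exists>j. j \<in> \<A> \<and> g \<in> fst j \<and> \<rho> g x = \<rho> g x" by auto
qed simp

text \<open>\<open>L g\<close> acts as \<open>\<rho> g\<close> on \<open>V\<close> and as the
  identity on the orthogonal complement; Pythagoras makes it an isometry of the whole space.\<close>

lemma linear_rep_exists:
  fixes V :: "'v::euclidean_space set"
  assumes G: "compact_lie_group G T E \<A>" and rep: "orthogonal_representation G \<A> V \<rho>"
  shows "\<exists>L. linear_rep G V L \<rho>"
proof -
  have V: "subspace V" and action: "group_action G V \<rho>"
    and add: "\<And>g x y. g \<in> carrier G \<Longrightarrow> x \<in> V \<Longrightarrow> y \<in> V \<Longrightarrow> \<rho> g (x + y) = \<rho> g x + \<rho> g y"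
    and scale: "\<And>g x c. g \<in> carrier G \<Longrightarrow> x \<in> V \<Longrightarrow> \<rho> g (c *\<^sub>R x) = c *\<^sub>R \<rho> g x"
    and isom: "\<And>g x. g \<in> carrier G \<Longrightarrow> x \<in> V \<Longrightarrow> norm (\<rho> g x) = norm x"
    using rep unfolding orthogonal_representation_def by auto
  have grp: "group G" and top: "topspace T = carrier G" and cpt: "compact_space T"
    using G unfolding compact_lie_group_def by auto
  interpret group G by (rule grp)
  interpret group_action G V \<rho> by (rule action)
  have mem: "\<rho> g x \<in> V" if "g \<in> carrier G" "x \<in> V" for g x
    using element_image[OF that] by simp
  obtain P where P: "linear P" "\<And>x. P x \<in> V" "\<And>x y. y \<in> V \<Longrightarrow> y \<bullet> (x - P x) = 0"
    using orthogonal_projection_exists[OF V] by blast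
  have P_V: "P x = x" if x: "x \<in> V" for x
  proof -
    have "(x - P x) \<bullet> (x - P x) = 0" by (rule P(3)[OF subspace_diff[OF V x P(2)]])
    then show ?thesis by simp
  qed
  have "\<exists>A. \<forall>x. A \<cdot> x = \<rho> g (P x) + (x - P x)" if g: "g \<in> carrier G" for g
    by (rule endo_of_linear)
       (auto intro!: linearI simp: linear_add[OF P(1)] linear_scale[OF P(1)] add[OF g] scale[OF g] P(2) algebra_simps)
  then obtain L where L: "\<And>g x. g \<in> carrier G \<Longrightarrow> L g \<cdot> x = \<rho> g (P x) + (x - P x)" by metis
  have L_V: "L g \<cdot> x = \<rho> g x" if "g \<in> carrier G" "x \<in> V" for g x
    using that by (simp add: L P_V)
  have P_L: "P (L g \<cdot> x) = \<rho> g (P x)" if "g \<in> carrier G" for g x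
  proof -
    have "P (x - P x) = 0" using P_V[OF P(2)[of x]] by (simp add: linear_diff[OF P(1)])
    then show ?thesis using that by (simp add: L linear_add[OF P(1)] P_V mem P(2))
  qed
  have L_mult: "L (g \<otimes>\<^bsub>G\<^esub> h) = L g * L h" if g: "g \<in> carrier G" "h \<in> carrier G" for g h
  proof (rule endo_eqI)
    fix x
    have "(L g * L h) \<cdot> x = \<rho> g (P (L h \<cdot> x)) + (L h \<cdot> x - P (L h \<cdot> x))" using g by (simp add: L)
    also have "\<dots> = \<rho> g (\<rho> h (P x)) + (x - P x)" using g by (simp add: P_L) (simp add: L)
    also have "\<dots> = L (g \<otimes>\<^bsub>G\<^esub> h) \<cdot> x" using g composition_rule[OF P(2) g] by (simp add: L)
    finally show "L (g \<otimes>\<^bsub>G\<^esub> h) \<cdot> x = (L g * L h) \<cdot> x" by simp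
  qed
  have L_one: "L \<one>\<^bsub>G\<^esub> = 1"
  proof (rule endo_eqI)
    show "L \<one>\<^bsub>G\<^esub> \<cdot> x = 1 \<cdot> x" for x
      using id_eq_one P(2)[of x] by (simp add: L) (metis restrict_apply')
  qed
  have L_norm: "norm (L g \<cdot> x) = norm x" if g: "g \<in> carrier G" for g x
  proof -
    have "(norm (L g \<cdot> x))\<^sup>2 = (norm (\<rho> g (P x)))\<^sup>2 + (norm (x - P x))\<^sup>2"
      unfolding L[OF g] using norm_add_Pythagorean[of "\<rho> g (P x)" "x - P x"] P(3)[OF mem[OF g P(2)], of x x]
      by (simp add: orthogonal_def)
    also have "\<dots> = (norm (P x))\<^sup>2 + (norm (x - P x))\<^sup>2" by (simp add: isom[OF g P(2)])
    also have "\<dots> = (norm (P x + (x - P x)))\<^sup>2"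
      using norm_add_Pythagorean[of "P x" "x - P x"] P(3)[OF P(2), of x x] by (simp add: orthogonal_def)
    finally have "(norm (L g \<cdot> x))\<^sup>2 = (norm x)\<^sup>2" by simp
    then show ?thesis by simp
  qed
  have "continuous_map T euclidean (\<lambda>g. L g \<cdot> x)" for x
  proof -
    have "continuous_map T euclidean (\<lambda>g. \<rho> g (P x) + (x - P x))"
      by (intro continuous_map_add action_continuous_map[OF G rep P(2)]) simp
    then show ?thesis by (rule continuous_map_eq) (simp add: L top)
  qed
  then have "continuous_map T euclidean L" by (rule continuous_map_endo)
  then have "compactin euclidean (L ` topspace T)"
    by (rule image_compactin[rotated]) (use cpt in \<open>simp add: compact_space_def\<close>)
  then have cptL: "compact (L ` carrier G)" by (simp add: top)
  have "linear_rep G V L \<rho>"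
  proof unfold_locales
    show "1 \<in> L ` carrier G" using L_one by (metis imageI one_closed)
    show "\<exists>h\<in>L ` carrier G. g * h = 1 \<and> h * g = 1" if "g \<in> L ` carrier G" for g
    proof -
      from that obtain a where a: "g = L a" "a \<in> carrier G" by (rule imageE)
      have i: "inv\<^bsub>G\<^esub> a \<in> carrier G" using a(2) by (rule inv_closed)
      have "L a * L (inv\<^bsub>G\<^esub> a) = 1" "L (inv\<^bsub>G\<^esub> a) * L a = 1"
        unfolding L_mult[OF a(2) i, symmetric] L_mult[OF i a(2), symmetric] using a(2) L_one
        by (simp_all only: r_inv l_inv)
      then show ?thesis unfolding a(1) using i by blast
    qed
    show "g * h \<in> L ` carrier G" if gh: "g \<in> L ` carrier G" "h \<in> L ` carrier G" for g h
    proof -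
      from gh(1) obtain a where a: "g = L a" "a \<in> carrier G" by (rule imageE)
      from gh(2) obtain b where b: "h = L b" "b \<in> carrier G" by (rule imageE)
      show ?thesis
        unfolding a(1) b(1) L_mult[OF a(2) b(2), symmetric] by (rule imageI[OF m_closed[OF a(2) b(2)]])
    qed
    show "subspace V" by (rule V)
  qed (use L_norm L_V mem L_mult cptL in auto)
  then show ?thesis by blast
qed

text \<open>The derivative of a linear action is the action itself, so the same operators
  \<open>L\<close> represent the slice; only the group and the space shrink.\<close>

lemma (in linear_rep) slice_linear_rep:
  assumes q: "q \<in> V" and action: "group_action G V \<rho>"
  shows "linear_rep (isotropy_group G \<rho> q) (normal_space_in V (orbit G \<rho> q) q) L (slice_action G V \<rho> q)"
    and "L ` carrier (isotropy_group G \<rho> q) = stab H q"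
proof -
  show img: "L ` carrier (isotropy_group G \<rho> q) = stab H q"
    using mem_stabilizer[OF q] by (auto simp: isotropy_group_def stab_def)
  have "subgroup (stabilizer G \<rho> q) G" by (rule group_action.stabilizer_subgroup[OF action q])
  then have "group (isotropy_group G \<rho> q)"
    unfolding isotropy_group_def by (rule subgroup.subgroup_is_group[OF _ is_group])
  moreover have "ortho_action (L ` carrier (isotropy_group G \<rho> q)) (normal_space_in V (orbit G \<rho> q) q)"
    unfolding img normal_space_orbit[OF q] by (rule slice_ortho_action[OF q])
  moreover have "linear_rep_axioms (isotropy_group G \<rho> q) (normal_space_in V (orbit G \<rho> q) q) L (slice_action G V \<rho> q)"
  proof
    fix g h assume gh: "g \<in> carrier (isotropy_group G \<rho> q)" "h \<in> carrier (isotropy_group G \<rho> q)"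
    then show "L (g \<otimes>\<^bsub>isotropy_group G \<rho> q\<^esub> h) = L g * L h"
      using L_mult mem_stabilizer[OF q] by (auto simp: isotropy_group_def)
  next
    fix g x assume g: "g \<in> carrier (isotropy_group G \<rho> q)" and x: "x \<in> normal_space_in V (orbit G \<rho> q) q"
    have gG: "g \<in> carrier G" using g mem_stabilizer[OF q] by (auto simp: isotropy_group_def)
    have "x \<in> V" using x by (simp add: normal_space_in_def)
    then show "slice_action G V \<rho> q g x = L g \<cdot> x"
      using frechet_derivative_within_subspace[OF subspace_V rho_eq[OF gG] q] x
      by (simp add: slice_action_def)
  qed
  ultimately show "linear_rep (isotropy_group G \<rho> q) (normal_space_in V (orbit G \<rho> q) q) L (slice_action G V \<rho> q)"
    by (rule linear_rep.intro)
qed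

theorem theorem6:
  fixes G :: "('g, 'm) monoid_scheme"
    and T :: "'g topology"
    and E :: "'e::euclidean_space set"
    and \<A> :: "('g set \<times> ('g \<Rightarrow> 'e)) set"
    and V :: "'v::euclidean_space set"
    and \<rho> :: "'g \<Rightarrow> 'v \<Rightarrow> 'v"
    and q :: 'v
    and k :: nat
  assumes "compact_lie_group G T E \<A>"
    and "orthogonal_representation G \<A> V \<rho>"
    and "q \<in> V"
    and "copolarity G V \<rho> \<le> k"
  shows "copolarity (isotropy_group G \<rho> q) (normal_space_in V (orbit G \<rho> q) q)
           (slice_action G V \<rho> q) \<le> k"
proof -
  obtain L where L: "linear_rep G V L \<rho>" using linear_rep_exists[OF assms(1,2)] by blast
  interpret linear_rep G V L \<rho> by (rule L)
  have action: "group_action G V \<rho>"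
    using assms(2) by (simp add: orthogonal_representation_def)
  interpret slice: linear_rep "isotropy_group G \<rho> q" "normal_space_in V (orbit G \<rho> q) q" L "slice_action G V \<rho> q"
    by (rule slice_linear_rep(1)[OF assms(3) action])
  \<comment> \<open>The copolarity is the codimension attained by an actual section, which produces
    a section of the slice with no larger codimension.\<close>
  obtain p S where "sec H V (copolarity G V \<rho>) S" by (rule copolarity_witness)
  then obtain l S' where l: "l \<le> copolarity G V \<rho>" "sec (stab H q) (nrm H V q) l S'"
    using slice_sec_exists[OF assms(3)] by blast
  then have "sec (L ` carrier (isotropy_group G \<rho> q)) (normal_space_in V (orbit G \<rho> q) q) l S'"
    by (simp only: slice_linear_rep(2)[OF assms(3) action] normal_space_orbit[OF assms(3)])
  from slice.copolarity_le[OF this] l(1) assms(4) show ?thesis by simp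
qed

end
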